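(* Let $N\ge3$, $m>0$, $b\ge0$, and let $d\mu=\rho(x)\,dx$ on $\mathbb{R}^N$ with $\rho(x)=e^{-b|x|^m}$. Then there exists a positive constant $C$ such that for all $u\in H^1_\mu$ $$\left(\frac{N-2}{2}\right)^2\int_{\mathbb{R}^N}\frac{u^2}{|x|^2}\,d\mu\le\int_{\mathbb{R}^N}|\nabla u|^2\,d\mu+C\int_{\mathbb{R}^N}u^2\,d\mu,$$ and $\left(\frac{N-2}{2}\right)^2$ is the best constant.
   Context: $L^2_\mu:=L^2(\mathbb{R}^N,d\mu)$, and $H^1_\mu$ is the Sobolev space of functions in $L^2_\mu$ whose weak first derivatives belong to $L^2_\mu$; functions are real-valued. "Best constant" means that for every larger $c$ in place of $\left(\frac{N-2}{2}\right)^2$ there is no constant $C$ for which the inequality holds for all $u\in H^1_\mu$. *)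

theory Defs
  imports "HOL-Analysis.Analysis"
begin

(* The space R^N is an arbitrary Euclidean space 'a with N = DIM('a). Elements of L^2 and H^1 are
   represented by Borel measurable functions, which are not identified when they agree a.e. *)

definition weighted_measure :: "real \<Rightarrow> real \<Rightarrow> 'a::euclidean_space measure" where
  "weighted_measure b m = density lborel (\<lambda>x. ennreal (exp (- b * norm x powr m)))"

primrec Ck :: "nat \<Rightarrow> ('a::euclidean_space \<Rightarrow> real) \<Rightarrow> bool" where
  "Ck 0 f \<longleftrightarrow> continuous_on UNIV f"
| "Ck (Suc k) f \<longleftrightarrow> (\<forall>x. f differentiable (at x)) \<and>
     (\<forall>i\<in>Basis. Ck k (\<lambda>x. frechet_derivative f (at x) i))"

definition test_function :: "('a::euclidean_space \<Rightarrow> real) \<Rightarrow> bool" where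
  "test_function \<phi> \<longleftrightarrow> (\<forall>k. Ck k \<phi>) \<and> compact (closure {x. \<phi> x \<noteq> 0})"

definition locally_integrable ::
    "('a::euclidean_space \<Rightarrow> 'b::{banach,second_countable_topology}) \<Rightarrow> bool" where
  "locally_integrable f \<longleftrightarrow> (\<forall>K. compact K \<longrightarrow> set_integrable lborel K f)"

(* Weak derivatives are taken with respect to Lebesgue measure, not the weighted measure.
   The weak gradient is determined only up to a null set, hence a relation. *)
definition weak_gradient ::
    "('a::euclidean_space \<Rightarrow> real) \<Rightarrow> ('a \<Rightarrow> 'a) \<Rightarrow> bool" where
  "weak_gradient u g \<longleftrightarrow> locally_integrable u \<and> locally_integrable g \<and>
     (\<forall>\<phi>. test_function \<phi> \<longrightarrow> (\<forall>i\<in>Basis.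
        (\<integral>x. u x * frechet_derivative \<phi> (at x) i \<partial>lborel) =
        - (\<integral>x. (g x \<bullet> i) * \<phi> x \<partial>lborel)))"

definition L2 :: "'a measure \<Rightarrow> ('a \<Rightarrow> 'b::real_normed_vector) set" where
  "L2 M = {f \<in> borel_measurable M. integrable M (\<lambda>x. (norm (f x))\<^sup>2)}"

definition H1 :: "'a::euclidean_space measure \<Rightarrow> ('a \<Rightarrow> real) set" where
  "H1 M = {u \<in> L2 M. \<exists>g. weak_gradient u g \<and> g \<in> L2 M}"

(* The integrals are taken in [0,\<infinity>], so that finiteness of the left-hand side is part of the claim.
   Division by zero at x = 0 is irrelevant for measures with a density. For C < 0 the inequality
   reads as the one for C = 0, which is weaker than the genuine one; so the (non-)existence of
   some C is unaffected. *)
definition hardy_inequality :: "'a::euclidean_space measure \<Rightarrow> real \<Rightarrow> real \<Rightarrow> bool" where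
  "hardy_inequality M c C \<longleftrightarrow> (\<forall>u\<in>H1 M. \<forall>g. weak_gradient u g \<longrightarrow>
     ennreal c * (\<integral>\<^sup>+x. ennreal ((u x)\<^sup>2 / (norm x)\<^sup>2) \<partial>M)
       \<le> (\<integral>\<^sup>+x. ennreal ((norm (g x))\<^sup>2) \<partial>M)
          + ennreal C * (\<integral>\<^sup>+x. ennreal ((u x)\<^sup>2) \<partial>M))"

end

theory Submission
  imports Defs "HOL-Real_Asymp.Real_Asymp"
begin

text \<open>
Write \<open>a = (N - 2) / 2\<close>, \<open>s = \<bar>x\<bar>\<^sup>2\<close>, and let \<open>\<rho>\<close> be the density. For a smooth radial field \<open>h(s) x\<close>
one has \<open>\<integral> u\<^sup>2 div (h x) = - 2 \<integral> u h x \<bullet> g\<close>, and expanding \<open>0 \<le> \<rho> \<bar>g + (h / \<rho>) u x\<bar>\<^sup>2\<close> gives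
\<open>\<integral> \<bar>g\<bar>\<^sup>2 \<rho> \<ge> \<integral> u\<^sup>2 (N h + 2 s h' - s h\<^sup>2 / \<rho>)\<close>. The classical choice \<open>h = a \<rho> / s\<close> leaves an error of order
\<open>\<bar>x\<bar>\<^bsup>m-2\<^esup>\<close>, which is unbounded for \<open>m < 2\<close>; with \<open>h = (a + k \<bar>x\<bar>\<^sup>m) \<rho> / s\<close> and \<open>k > a b\<close> the error has the
favourable sign near the origin. A cutoff that increases away from the origin also contributes with the
favourable sign, so cutting off there costs nothing in the limit.

The product rule for \<open>u\<^sup>2\<close> follows by testing with \<open>\<phi>(x) \<eta>(x - y)\<close> for fixed \<open>y\<close> and with \<open>\<eta>(x - y)\<close> for
fixed \<open>x\<close>: in the sum of the two identities the derivatives of the mollifier \<open>\<eta>\<close> cancel.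

For optimality take \<open>u = \<bar>x\<bar>\<^bsup>-a\<^esup>\<close> on a shell \<open>2 / n \<le> s \<le> s\<^sub>1 / 2\<close>, cut off on two layers whose contribution
is scale invariant, hence bounded in \<open>n\<close>, whereas \<open>\<integral> u\<^sup>2 / \<bar>x\<bar>\<^sup>2\<close> grows like \<open>ln n\<close>. Taking \<open>s\<^sub>1\<close> small absorbs
the term \<open>C \<integral> u\<^sup>2\<close>.
\<close>

section \<open>Smooth functions and cutoffs\<close>

lemma Ck_SucI:
  assumes "\<And>x. (f has_derivative D x) (at x)" "\<And>i. i \<in> Basis \<Longrightarrow> Ck k (\<lambda>x. D x i)"
  shows "Ck (Suc k) f"
proof -
  have "frechet_derivative f (at x) = D x" for x
    using frechet_derivative_at[OF assms(1)] by metis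
  then show ?thesis using assms by (auto simp: differentiable_def)
qed

lemma Ck_Suc_has_derivative:
  "Ck (Suc k) f \<Longrightarrow> (f has_derivative frechet_derivative f (at x)) (at x)"
  by (simp add: frechet_derivative_works)

lemma Ck_SucD: "Ck (Suc k) f \<Longrightarrow> Ck k f"
proof (induction k arbitrary: f)
  case 0
  then have "f differentiable at x" for x by simp
  then show ?case
    by (simp add: continuous_at_imp_continuous_on differentiable_imp_continuous_within)
next
  case (Suc k)
  have "Ck k (\<lambda>x. frechet_derivative f (at x) i)" if "i \<in> Basis" for i
    using Suc.prems that by (intro Suc.IH) auto
  moreover have "\<forall>x. f differentiable at x" using Suc.prems by simp
  ultimately show ?case by simp
qed

section \<open>Closure of the classes \<open>Ck\<close> under algebraic operations and
  composition\<close>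

lemma Ck_const: "Ck k (\<lambda>x. c)"
proof (induction k arbitrary: c)
  case (Suc k)
  show ?case by (rule Ck_SucI[where D="\<lambda>_ _. 0"]) (auto intro: Suc)
qed simp

lemma Ck_inner: "Ck k (\<lambda>x. x \<bullet> c)"
proof (cases k)
  case (Suc l)
  show ?thesis unfolding Suc
    by (rule Ck_SucI[where D="\<lambda>_ h. h \<bullet> c"]) (intro Ck_const has_derivative_inner_left has_derivative_ident)+
qed (simp add: continuous_intros)

lemma Ck_add: "Ck k f \<Longrightarrow> Ck k g \<Longrightarrow> Ck k (\<lambda>x. f x + g x)"
proof (induction k arbitrary: f g)
  case 0
  then show ?case by (simp add: continuous_intros)
next
  case (Suc k)
  show ?case
    by (rule Ck_SucI[OF has_derivative_add[OF Ck_Suc_has_derivative[OF Suc.prems(1)] Ck_Suc_has_derivative[OF Suc.prems(2)]]])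
       (use Suc in auto)
qed

lemma Ck_mult: "Ck k f \<Longrightarrow> Ck k g \<Longrightarrow> Ck k (\<lambda>x. f x * g x)"
proof (induction k arbitrary: f g)
  case 0
  then show ?case by (simp add: continuous_intros)
next
  case (Suc k)
  show ?case
    by (rule Ck_SucI[OF has_derivative_mult[OF Ck_Suc_has_derivative[OF Suc.prems(1)] Ck_Suc_has_derivative[OF Suc.prems(2)]]])
       (use Suc.prems Ck_SucD[OF Suc.prems(1)] Ck_SucD[OF Suc.prems(2)] in \<open>auto intro!: Ck_add Suc.IH\<close>)
qed

lemma Ck_inverse:
  assumes "Ck k f" "\<And>x. f x \<noteq> 0"
  shows "Ck k (\<lambda>x. inverse (f x))"
  using assms(1)
proof (induction k)
  case 0
  then show ?case using assms(2) by (auto intro: continuous_intros)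
next
  case (Suc k)
  have "((\<lambda>x. inverse (f x)) has_derivative
     (\<lambda>h. - (inverse (f x) * frechet_derivative f (at x) h * inverse (f x)))) (at x)" for x
    using Deriv.has_derivative_inverse[OF assms(2) Ck_Suc_has_derivative[OF Suc.prems]] .
  moreover have "Ck k (\<lambda>x. - 1 * (inverse (f x) * frechet_derivative f (at x) i * inverse (f x)))"
    if "i \<in> Basis" for i
    using that Suc.prems Suc.IH[OF Ck_SucD[OF Suc.prems]] by (intro Ck_mult Ck_const) auto
  ultimately show ?case by (intro Ck_SucI) auto
qed

lemma real_has_derivative_apply:
  fixes h :: "real \<Rightarrow> real"
  assumes "(h has_derivative D) F"
  shows "D = (\<lambda>y. y * D 1)"
proof
  fix y show "D y = y * D 1"
    using linear_cmul[OF has_derivative_linear[OF assms], of y 1] by simp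
qed

text \<open>The outer function lives on the line, so its derivative is multiplication by the number
  \<open>?D (f x)\<close>. The induction hypothesis therefore applies to \<open>?D\<close> as the
  new outer function, with the inner function unchanged.\<close>

lemma Ck_compose:
  fixes h :: "real \<Rightarrow> real"
  shows "Ck k h \<Longrightarrow> Ck k f \<Longrightarrow> Ck k (\<lambda>x. h (f x))"
proof (induction k arbitrary: h)
  case 0
  then show ?case by (auto intro: continuous_on_compose2)
next
  case (Suc k)
  let ?D = "\<lambda>x. frechet_derivative h (at x) 1"
  have h: "(h has_derivative (\<lambda>y. y * ?D x)) (at x)" for x
    by (rule has_derivative_eq_rhs[OF Ck_Suc_has_derivative[OF Suc.prems(1)]])
      (rule real_has_derivative_apply[OF Ck_Suc_has_derivative[OF Suc.prems(1)]])
  have "((\<lambda>x. h (f x)) has_derivative (\<lambda>y. frechet_derivative f (at x) y * ?D (f x))) (at x)" for x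
    using has_derivative_compose[OF Ck_Suc_has_derivative[OF Suc.prems(2), of x] h[of "f x"]] .
  moreover have "Ck k (\<lambda>x. frechet_derivative f (at x) i * ?D (f x))" if "i \<in> Basis" for i
    using that Suc.prems Ck_SucD[OF Suc.prems(2)] by (intro Ck_mult Suc.IH[of ?D]) auto
  ultimately show ?case by (intro Ck_SucI) auto
qed

text \<open>One derivative turns the logarithm into a product with \<open>inverse (f x)\<close>, so
  a case distinction replaces the induction.\<close>

lemma Ck_ln:
  assumes "Ck k f" "\<And>x. f x > 0"
  shows "Ck k (\<lambda>x. ln (f x))"
proof (cases k)
  case 0
  then show ?thesis using assms by (auto intro!: continuous_intros simp: less_imp_neq[symmetric])
next
  case (Suc l)
  have "((\<lambda>x. ln (f x)) has_derivative (\<lambda>h. frechet_derivative f (at x) h * inverse (f x))) (at x)" for x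
    using has_derivative_ln[OF assms(2) Ck_Suc_has_derivative[OF assms(1)[unfolded Suc]]] .
  moreover have "Ck l (\<lambda>x. frechet_derivative f (at x) i * inverse (f x))" if "i \<in> Basis" for i
    using that assms Suc Ck_SucD[of l f] by (intro Ck_mult Ck_inverse) (auto simp: less_imp_neq[symmetric])
  ultimately show ?thesis unfolding Suc by (intro Ck_SucI) auto
qed

text \<open>Smoothness is split off from \<open>test_function\<close> because the one-variable
  profiles, steps and powers from which test functions are assembled are not compactly
  supported.\<close>

definition smooth :: "('a::euclidean_space \<Rightarrow> real) \<Rightarrow> bool" where
  "smooth f \<longleftrightarrow> (\<forall>k. Ck k f)"

lemma smooth_const: "smooth (\<lambda>x. c)"
  and smooth_inner: "smooth (\<lambda>x. x \<bullet> d)"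
  and smooth_add: "smooth f \<Longrightarrow> smooth g \<Longrightarrow> smooth (\<lambda>x. f x + g x)"
  and smooth_mult: "smooth f \<Longrightarrow> smooth g \<Longrightarrow> smooth (\<lambda>x. f x * g x)"
  and smooth_compose: "smooth (h :: real \<Rightarrow> real) \<Longrightarrow> smooth f \<Longrightarrow> smooth (\<lambda>x. h (f x))"
  and smooth_inverse: "smooth f \<Longrightarrow> (\<And>x. f x \<noteq> 0) \<Longrightarrow> smooth (\<lambda>x. inverse (f x))"
  and smooth_ln: "smooth f \<Longrightarrow> (\<And>x. f x > 0) \<Longrightarrow> smooth (\<lambda>x. ln (f x))"
  by (simp_all add: smooth_def Ck_const Ck_inner Ck_add Ck_mult Ck_compose Ck_inverse Ck_ln)

lemma smooth_diff: "smooth f \<Longrightarrow> smooth g \<Longrightarrow> smooth (\<lambda>x. f x - g x)"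
  using smooth_add[of f "\<lambda>x. -1 * g x"] smooth_mult[OF smooth_const, of g "-1"] by simp

lemma smooth_divide: "smooth f \<Longrightarrow> smooth g \<Longrightarrow> (\<And>x. g x \<noteq> 0) \<Longrightarrow> smooth (\<lambda>x. f x / g x)"
  unfolding divide_inverse by (intro smooth_mult smooth_inverse)

lemma smooth_id: "smooth (\<lambda>x::real. x)"
  using smooth_inner[of "1::real"] by simp

lemma smooth_inner_self: "smooth (\<lambda>x::'a::euclidean_space. x \<bullet> x)"
proof -
  have "smooth (\<lambda>x::'a. \<Sum>i\<in>S. (x \<bullet> i) * (x \<bullet> i))" if "finite S" for S
    using that by induction (auto intro!: smooth_const smooth_add smooth_mult smooth_inner)
  from this[of Basis] show ?thesis by (simp flip: euclidean_inner)
qed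

lemma Ck_real_SucI:
  fixes f :: "real \<Rightarrow> real"
  assumes "\<And>x. (f has_real_derivative f' x) (at x)" "Ck k f'"
  shows "Ck (Suc k) f"
  by (rule Ck_SucI[where D="\<lambda>x h. f' x * h"]) (use assms in \<open>auto simp: has_field_derivative_def\<close>)

lemma smooth_exp: "smooth (\<lambda>x. exp x :: real)"
  unfolding smooth_def
proof
  fix k show "Ck k (\<lambda>x. exp x :: real)"
    by (induction k) (auto intro!: Ck_real_SucI continuous_intros simp del: Ck.simps(2))
qed

lemma smooth_powr:
  assumes "smooth f" "\<And>x. f x > 0"
  shows "smooth (\<lambda>x. f x powr p)"
proof -
  have "smooth (\<lambda>x. exp (p * ln (f x)))"
    using assms by (intro smooth_compose[OF smooth_exp] smooth_mult smooth_const smooth_ln)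
  moreover have "(\<lambda>x. f x powr p) = (\<lambda>x. exp (p * ln (f x)))"
    using assms(2) by (auto simp: powr_def fun_eq_iff less_imp_neq[symmetric])
  ultimately show ?thesis by simp
qed

lemma smooth_has_derivative:
  "smooth f \<Longrightarrow> (f has_derivative frechet_derivative f (at x)) (at x)"
  by (rule Ck_Suc_has_derivative[of 0]) (simp only: smooth_def)

lemma smooth_frechet_derivative:
  "smooth f \<Longrightarrow> i \<in> Basis \<Longrightarrow> smooth (\<lambda>x. frechet_derivative f (at x) i)"
  unfolding smooth_def
  using Ck.simps(2)[of _ f] by blast

lemma smooth_continuous: "smooth f \<Longrightarrow> continuous_on A f"
  unfolding smooth_def by (metis Ck.simps(1) continuous_on_subset top_greatest)

lemma smooth_DERIV:
  fixes f :: "real \<Rightarrow> real"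
  assumes "smooth f"
  obtains f' where "\<And>x. (f has_real_derivative f' x) (at x)" "smooth f'"
proof
  show "smooth (\<lambda>x. frechet_derivative f (at x) 1)"
    by (rule smooth_frechet_derivative[OF assms]) simp
  show "(f has_real_derivative frechet_derivative f (at x) 1) (at x)" for x
  proof -
    let ?D = "frechet_derivative f (at x)"
    have "(f has_derivative ?D) (at x)" by (rule smooth_has_derivative[OF assms])
    moreover from this have "?D = (*) (?D 1)"
      using real_has_derivative_apply[of f ?D] by (metis mult.commute ext)
    ultimately show ?thesis unfolding has_field_derivative_def by metis
  qed
qed

section \<open>Flat functions and a smooth step from 0 to 1\<close>

definition flat_exp :: "nat \<Rightarrow> real \<Rightarrow> real" where
  "flat_exp j t = (if t > 0 then exp (- 1 / t) / t ^ j else 0)"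

text \<open>The index \<open>j\<close> is there so that the family is closed under differentiation
  up to linear combinations, which makes smoothness a simple induction. At 0 the difference quotient
  from the right is \<open>exp (- 1 / h) / h ^ Suc j\<close>, which tends to 0 because the
  exponential beats every power; from the left it vanishes.\<close>

lemma DERIV_flat_exp: "(flat_exp j has_real_derivative (flat_exp (j+2) t - real j * flat_exp (j+1) t)) (at t)"
proof (cases "t = 0")
  case True
  have "((\<lambda>h. exp (- 1 / h) / h ^ Suc j) \<longlongrightarrow> 0) (at_right (0::real))"
    by real_asymp
  then have r: "((\<lambda>h. flat_exp j h / h) \<longlongrightarrow> 0) (at_right 0)"
    by (rule Lim_transform_eventually)
      (auto simp: flat_exp_def eventually_at_filter field_simps)
  have l: "((\<lambda>h. flat_exp j h / h) \<longlongrightarrow> 0) (at_left 0)"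
    by (rule Lim_transform_eventually[OF tendsto_const[of 0]])
      (auto simp: flat_exp_def eventually_at_filter)
  from l r have "((\<lambda>h. flat_exp j h / h) \<longlongrightarrow> 0) (at 0)"
    by (simp add: filterlim_split_at)
  then show ?thesis by (simp add: True flat_exp_def DERIV_def)
next
  case False
  show ?thesis
  proof (cases "t > 0")
    case t: True
    have "((\<lambda>t. exp (- 1 / t) / t ^ j) has_real_derivative (flat_exp (j+2) t - real j * flat_exp (j+1) t)) (at t)"
    proof -
      have "((\<lambda>t. exp (- 1 / t)) has_real_derivative (exp (- 1 / t) / t\<^sup>2)) (at t)"
        using t by (auto intro!: derivative_eq_intros simp: power2_eq_square)
      moreover have "((\<lambda>t. inverse (t ^ j)) has_real_derivative (- real j / t ^ (j+1))) (at t)"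
      proof (cases j)
        case (Suc n)
        have "((\<lambda>t. inverse (t ^ Suc n)) has_real_derivative
            - (inverse (t ^ Suc n) * (real (Suc n) * t ^ n) * inverse (t ^ Suc n))) (at t)"
          using DERIV_inverse'[OF DERIV_pow[of "Suc n" t UNIV]] t by simp
        also have "- (inverse (t ^ Suc n) * (real (Suc n) * t ^ n) * inverse (t ^ Suc n)) = - real j / t ^ (j+1)"
          using t Suc by (simp add: divide_simps del: of_nat_Suc) 
        finally show ?thesis using Suc by simp
      qed simp
      ultimately have "((\<lambda>t. exp (- 1 / t) * inverse (t ^ j)) has_real_derivative
          (exp (- 1 / t) / t\<^sup>2 * inverse (t ^ j) + (- real j / t ^ (j+1)) * exp (- 1 / t))) (at t)"
        by (rule DERIV_mult)
      also have "(exp (- 1 / t) / t\<^sup>2 * inverse (t ^ j) + (- real j / t ^ (j+1)) * exp (- 1 / t))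
          = flat_exp (j+2) t - real j * flat_exp (j+1) t"
        using t by (simp add: flat_exp_def power_add divide_simps power2_eq_square)
      finally show ?thesis by (simp add: divide_inverse)
    qed
    moreover have "\<forall>\<^sub>F s in nhds t. exp (- 1 / s) / s ^ j = flat_exp j s"
      by (rule eventually_mono[OF eventually_nhds_in_open[of "{0<..}" t]]) (use t in \<open>auto simp: flat_exp_def\<close>)
    ultimately show ?thesis
      by (subst (asm) DERIV_cong_ev[OF refl _ refl])
  next
    case f: False
    have ev: "\<forall>\<^sub>F s in nhds t. flat_exp j s = 0"
      by (rule eventually_mono[OF eventually_nhds_in_open[of "{..<0}" t]]) (use f False in \<open>auto simp: flat_exp_def\<close>)
    have "(flat_exp j has_real_derivative 0) (at t)"
      by (subst DERIV_cong_ev[OF refl ev refl]) simp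
    then show ?thesis using f by (simp add: flat_exp_def)
  qed
qed

lemma smooth_flat_exp: "smooth (flat_exp j)"
  unfolding smooth_def
proof
  fix k show "Ck k (flat_exp j)"
  proof (induction k arbitrary: j)
    case 0
    show ?case using DERIV_flat_exp by (auto intro!: continuous_at_imp_continuous_on DERIV_isCont)
  next
    case (Suc k)
    have "Ck k (\<lambda>t. flat_exp (j+2) t + (- real j) * flat_exp (j+1) t)"
      by (intro Ck_add Ck_mult Ck_const Suc)
    then show ?case by (intro Ck_real_SucI[OF DERIV_flat_exp]) simp
  qed
qed

lemma flat_exp_pos: "t > 0 \<Longrightarrow> flat_exp j t > 0"
  and flat_exp_nonneg: "flat_exp j t \<ge> 0"
  and flat_exp_eq_0: "t \<le> 0 \<Longrightarrow> flat_exp j t = 0"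
  by (auto simp: flat_exp_def)

text \<open>The standard transition function. In quotient form its smoothness and its range follow
  from algebraic closure rules and from positivity of the denominator.\<close>

definition smooth_step :: "real \<Rightarrow> real" where
  "smooth_step t = flat_exp 0 t / (flat_exp 0 t + flat_exp 0 (1 - t))"

lemma smooth_step_denom_pos: "flat_exp 0 t + flat_exp 0 (1 - t) > 0"
  using flat_exp_pos[of t 0] flat_exp_pos[of "1 - t" 0] flat_exp_nonneg[of 0 t] flat_exp_nonneg[of 0 "1 - t"]
  by (cases "t > 0") (auto intro: add_pos_nonneg add_nonneg_pos)

lemma smooth_smooth_step: "smooth smooth_step"
proof -
  have "smooth (\<lambda>t. flat_exp 0 t / (flat_exp 0 t + flat_exp 0 (1 - t)))"
    using smooth_step_denom_pos
    by (intro smooth_divide smooth_add smooth_flat_exp smooth_compose[OF smooth_flat_exp] smooth_diff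
        smooth_const smooth_id) (auto simp: less_imp_neq[symmetric])
  then show ?thesis by (simp add: smooth_step_def[abs_def])
qed

lemma smooth_step_eq_0: "t \<le> 0 \<Longrightarrow> smooth_step t = 0"
  and smooth_step_eq_1: "t \<ge> 1 \<Longrightarrow> smooth_step t = 1"
  and smooth_step_pos: "t > 0 \<Longrightarrow> smooth_step t > 0"
  and smooth_step_nonneg: "smooth_step t \<ge> 0"
  and smooth_step_le_1: "smooth_step t \<le> 1"
  using smooth_step_denom_pos[of t] flat_exp_nonneg[of 0 t] flat_exp_nonneg[of 0 "1 - t"] flat_exp_pos[of t 0]
  by (auto simp: smooth_step_def flat_exp_eq_0)

text \<open>After clearing denominators the common product
  \<open>flat_exp 0 s * flat_exp 0 t\<close> cancels, and what remains compares two products factor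
  by factor.\<close>

lemma mono_smooth_step: "mono smooth_step"
proof (rule monoI)
  fix s t :: real assume st: "s \<le> t"
  have flat_exp_mono: "flat_exp 0 x \<le> flat_exp 0 y" if "x \<le> y" for x y
    using that by (auto simp: flat_exp_def field_simps)
  have "flat_exp 0 s * flat_exp 0 (1 - t) \<le> flat_exp 0 t * flat_exp 0 (1 - s)"
    using st by (intro mult_mono flat_exp_mono flat_exp_nonneg) auto
  then show "smooth_step s \<le> smooth_step t"
    using smooth_step_denom_pos[of t] smooth_step_denom_pos[of s]
    by (simp add: smooth_step_def field_simps)
qed

text \<open>The derivative is continuous and vanishes off the unit interval, hence is bounded. The
  step is locally constant only away from 0 and 1, so the values at these two points come from
  one-sided limits. Sign and bound are what the cutoff estimates rely on.\<close>

lemma smooth_step_deriv: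
  obtains st' M where
    "\<And>t. (smooth_step has_real_derivative st' t) (at t)" "smooth st'" "\<And>t. st' t \<ge> 0"
    "\<And>t. t \<le> 0 \<Longrightarrow> st' t = 0" "\<And>t. t \<ge> 1 \<Longrightarrow> st' t = 0" "\<And>t. st' t \<le> M" "M > 0"
proof -
  obtain st' where st': "\<And>t. (smooth_step has_real_derivative st' t) (at t)" "smooth st'"
    using smooth_DERIV[OF smooth_smooth_step] by blast
  have nn: "st' t \<ge> 0" for t
    by (rule mono_on_imp_deriv_nonneg[of UNIV smooth_step]) (use st' mono_smooth_step in auto)
  have cont: "isCont st' t" for t
    using smooth_continuous[OF st'(2), of UNIV] by (simp add: continuous_on_eq_continuous_at)
  have 0: "st' t = 0" if "t < 0" for t
  proof -
    have "\<forall>\<^sub>F s in nhds t. smooth_step s = 0"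
      by (rule eventually_mono[OF eventually_nhds_in_open[of "{..<0}" t]])
        (use that in \<open>auto simp: smooth_step_eq_0\<close>)
    from DERIV_cong_ev[OF refl this refl] st'(1)[of t] show ?thesis
      by (metis DERIV_const DERIV_unique)
  qed
  have 1: "st' t = 0" if "t > 1" for t
  proof -
    have "\<forall>\<^sub>F s in nhds t. smooth_step s = 1"
      by (rule eventually_mono[OF eventually_nhds_in_open[of "{1<..}" t]])
        (use that in \<open>auto simp: smooth_step_eq_1\<close>)
    from DERIV_cong_ev[OF refl this refl] st'(1)[of t] show ?thesis
      by (metis DERIV_const DERIV_unique)
  qed
  have "st' 0 = 0"
  proof (rule tendsto_unique[of "at_left 0"])
    show "(st' \<longlongrightarrow> st' 0) (at_left 0)" using cont[of 0] by (simp add: isCont_def filterlim_at_split)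
    show "(st' \<longlongrightarrow> 0) (at_left 0)"
      by (rule Lim_transform_eventually[OF tendsto_const[of 0]]) (auto simp: 0 eventually_at_filter)
  qed simp
  moreover have "st' 1 = 0"
  proof (rule tendsto_unique[of "at_right 1"])
    show "(st' \<longlongrightarrow> st' 1) (at_right 1)" using cont[of 1] by (simp add: isCont_def filterlim_at_split)
    show "(st' \<longlongrightarrow> 0) (at_right 1)"
      by (rule Lim_transform_eventually[OF tendsto_const[of 0]]) (auto simp: 1 eventually_at_filter)
  qed simp
  ultimately have z: "t \<le> 0 \<Longrightarrow> st' t = 0" "t \<ge> 1 \<Longrightarrow> st' t = 0" for t
    using 0 1 by (metis less_eq_real_def)+
  have "\<exists>x\<in>{0..1}. \<forall>y\<in>{0..1}. st' y \<le> st' x"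
    by (rule continuous_attains_sup) (auto intro: smooth_continuous st'(2))
  then obtain M where M: "\<And>t. t \<in> {0..1} \<Longrightarrow> st' t \<le> M" by blast
  have "st' t \<le> max M 1" for t
    using M[of t] z[of t] by (cases "t \<in> {0..1}") auto
  then show ?thesis using st' nn z by (intro that[of st' "max M 1"]) auto
qed

section \<open>Test functions and their supports\<close>

lemma smooth_test_function:
  assumes "smooth \<phi>" "\<And>x. norm x > R \<Longrightarrow> \<phi> x = 0"
  shows "test_function \<phi>"
proof -
  have "{x. \<phi> x \<noteq> 0} \<subseteq> cball 0 R" using assms(2) by (force simp: not_less[symmetric])
  then have "bounded (closure {x. \<phi> x \<noteq> 0})"
    by (meson bounded_cball bounded_closure bounded_subset)
  then show ?thesis using assms(1) by (auto simp: test_function_def smooth_def compact_eq_bounded_closed)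
qed

lemma test_function_smooth: "test_function \<phi> \<Longrightarrow> smooth \<phi>"
  by (simp add: test_function_def smooth_def)

lemma test_function_support:
  assumes "test_function \<phi>"
  obtains R where "R > 0" "\<And>x. norm x > R \<Longrightarrow> \<phi> x = 0"
proof -
  have "bounded (closure {x. \<phi> x \<noteq> 0})" using assms by (auto simp: test_function_def compact_imp_bounded)
  then obtain R where "R > 0" "\<forall>x\<in>closure {x. \<phi> x \<noteq> 0}. norm x \<le> R"
    unfolding bounded_pos by blast
  moreover have "{x. \<phi> x \<noteq> 0} \<subseteq> closure {x. \<phi> x \<noteq> 0}" by (rule closure_subset)
  ultimately have "\<phi> x = 0" if "norm x > R" for x
    using that \<open>\<forall>x\<in>closure {x. \<phi> x \<noteq> 0}. norm x \<le> R\<close> by fastforce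
  with \<open>R > 0\<close> show ?thesis by (rule that)
qed

section \<open>Integration by parts\<close>

lemma lborel_distr_minus:
  fixes t :: "'a::euclidean_space"
  shows "distr lborel borel (\<lambda>x. t - x) = lborel"
  using lborel_affine[of "-1" t] by (simp add: density_1 flip: one_ennreal_def)

lemma
  fixes f :: "'a::euclidean_space \<Rightarrow> 'b::{banach, second_countable_topology}"
  shows lborel_integrable_minus: "integrable lborel f \<Longrightarrow> integrable lborel (\<lambda>x. f (t - x))"
    and lborel_integral_minus: "f \<in> borel_measurable borel \<Longrightarrow> (\<integral>x. f (t - x) \<partial>lborel) = (\<integral>x. f x \<partial>lborel)"
proof -
  have t[measurable]: "(\<lambda>x. t - x) \<in> measurable lborel borel" by simp
  show "integrable lborel (\<lambda>x. f (t - x))" if "integrable lborel f"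
    using integrable_distr[OF t, of f] that by (simp add: lborel_distr_minus)
  show "(\<integral>x. f (t - x) \<partial>lborel) = (\<integral>x. f x \<partial>lborel)" if "f \<in> borel_measurable borel"
    using integral_distr[OF t that] by (simp add: lborel_distr_minus)
qed

lemma lborel_integral_translate:
  fixes f :: "'a::euclidean_space \<Rightarrow> 'b::{banach, second_countable_topology}"
  assumes "f \<in> borel_measurable borel"
  shows "(\<integral>x. f (x + t) \<partial>lborel) = (\<integral>x. f x \<partial>lborel)"
  using integral_distr[of "(+) t" lborel borel f] assms by (simp add: lborel_distr_plus add.commute)

lemma lborel_integrable_translate:
  fixes f :: "'a::euclidean_space \<Rightarrow> 'b::{banach, second_countable_topology}"
  assumes "integrable lborel f"
  shows "integrable lborel (\<lambda>x. f (x + t))"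
  using integrable_distr[of "(+) t" lborel borel f] assms by (simp add: lborel_distr_plus add.commute)

lemma
  fixes f :: "'a::euclidean_space \<Rightarrow> real"
  assumes "continuous_on UNIV f" "\<And>x. norm x > R \<Longrightarrow> f x = 0"
  shows continuous_compact_support_integrable: "integrable lborel f"
    and continuous_compact_support_bounded: "\<exists>M>0. \<forall>x. \<bar>f x\<bar> \<le> M"
proof -
  have "(\<lambda>x. indicator (cball 0 R) x *\<^sub>R f x) = f"
    using assms(2) by (auto simp: fun_eq_iff indicator_def)
  then show "integrable lborel f"
    using borel_integrable_compact[of "cball 0 R" f] assms(1) by (auto intro: continuous_on_subset)
  have "bounded (f ` cball 0 R)"
    using assms(1) by (intro compact_imp_bounded compact_continuous_image) (auto intro: continuous_on_subset)
  then obtain M where "M > 0" "\<forall>x\<in>cball 0 R. \<bar>f x\<bar> \<le> M" by (auto simp: bounded_pos)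
  then show "\<exists>M>0. \<forall>x. \<bar>f x\<bar> \<le> M"
    using assms(2) by (intro exI[of _ M]) (force simp: not_less[symmetric])
qed

lemma frechet_derivative_eq_0:
  assumes "\<And>x. norm x > R \<Longrightarrow> \<phi> x = 0" "norm x > R"
  shows "frechet_derivative \<phi> (at x) i = 0"
proof -
  have "(\<phi> has_derivative (\<lambda>_. 0)) (at x)"
    by (rule has_derivative_transform_within_open[of "\<lambda>_. 0" _ _ _ "- cball 0 R"]) (use assms in auto)
  then show ?thesis using frechet_derivative_at by metis
qed

text \<open>By translation invariance every difference quotient in direction \<open>i\<close> has
  integral zero. The mean value theorem bounds the quotients by the supremum of the derivative on a
  fixed ball, so dominated convergence carries this over to the limit.\<close>

lemma integral_partial_derivative_eq_0:
  fixes f :: "'a::euclidean_space \<Rightarrow> real"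
  assumes "test_function f" and i: "i \<in> Basis"
  shows "(\<integral>x. frechet_derivative f (at x) i \<partial>lborel) = 0"
proof -
  note sm = test_function_smooth[OF assms(1)]
  obtain R where R: "R > 0" "\<And>x. norm x > R \<Longrightarrow> f x = 0" using test_function_support[OF assms(1)] by blast
  let ?D = "\<lambda>x. frechet_derivative f (at x) i"
  have contD: "continuous_on UNIV ?D" using smooth_continuous smooth_frechet_derivative[OF sm i] by blast
  have contf: "continuous_on UNIV f" using smooth_continuous[OF sm] .
  have [measurable]: "f \<in> borel_measurable borel" "?D \<in> borel_measurable borel"
    using contf contD by (auto intro: borel_measurable_continuous_onI)
  have intf: "integrable lborel f" using continuous_compact_support_integrable[OF contf R(2)] .
  have "\<exists>M>0. \<forall>x. \<bar>?D x\<bar> \<le> M"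
    by (rule continuous_compact_support_bounded[OF contD]) (rule frechet_derivative_eq_0[OF R(2)])
  then obtain M where M: "M > 0" "\<And>x. \<bar>?D x\<bar> \<le> M" by blast
  define d where "d n x = (f (x + (1 / real (Suc n)) *\<^sub>R i) - f x) * real (Suc n)" for n x
  have line: "((\<lambda>t. f (x + t *\<^sub>R i)) has_real_derivative ?D (x + t *\<^sub>R i)) (at t)" for x t
  proof -
    have "((\<lambda>t. f (x + t *\<^sub>R i)) has_derivative (\<lambda>h. frechet_derivative f (at (x + t *\<^sub>R i)) (h *\<^sub>R i))) (at t)"
      by (rule has_derivative_compose[OF _ smooth_has_derivative[OF sm]]) (auto intro!: derivative_eq_intros)
    moreover have "frechet_derivative f (at (x + t *\<^sub>R i)) (h *\<^sub>R i) = ?D (x + t *\<^sub>R i) * h" for h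
      using linear_cmul[OF has_derivative_linear[OF smooth_has_derivative[OF sm]]] by simp
    ultimately show ?thesis by (simp add: has_field_derivative_def)
  qed
  \<comment> \<open>The step lengths \<open>1 / real (Suc n)\<close> are at most 1, so beyond radius
    \<open>R + 1\<close> both values of \<open>f\<close> in the quotient vanish.\<close>
  have bd: "\<bar>d n x\<bar> \<le> M * indicator (cball 0 (R + 1)) x" for n x
  proof (cases "norm x > R + 1")
    case True
    have "norm x \<le> norm (x + (1 / real (Suc n)) *\<^sub>R i) + norm ((1 / real (Suc n)) *\<^sub>R i)"
      by (metis add_diff_cancel_right' norm_triangle_ineq4)
    also have "norm ((1 / real (Suc n)) *\<^sub>R i) \<le> 1" using i by simp
    finally have "f (x + (1 / real (Suc n)) *\<^sub>R i) = 0" using True by (intro R) auto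
    then show ?thesis using R True by (simp add: d_def)
  next
    case False
    obtain z where "f (x + (1 / real (Suc n)) *\<^sub>R i) - f (x + 0 *\<^sub>R i) = (1 / real (Suc n) - 0) * ?D (x + z *\<^sub>R i)"
      using MVT2[of 0 "1 / real (Suc n)" "\<lambda>t. f (x + t *\<^sub>R i)" "\<lambda>t. ?D (x + t *\<^sub>R i)"] line by auto
    then have "d n x = ?D (x + z *\<^sub>R i)" by (simp add: d_def)
    then show ?thesis using M False by simp
  qed
  have "(\<lambda>n. \<integral>x. d n x \<partial>lborel) \<longlonglongrightarrow> (\<integral>x. ?D x \<partial>lborel)"
  proof (rule integral_dominated_convergence[where w="\<lambda>x. M * indicator (cball 0 (R + 1)) x"])
    show "integrable lborel (\<lambda>x. M * indicator (cball 0 (R + 1)) x)"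
      using emeasure_lborel_cball_finite[of 0 "R+1"] by auto
    show "AE x in lborel. (\<lambda>n. d n x) \<longlonglongrightarrow> ?D x"
    proof (intro AE_I2)
      fix x :: 'a
      have "((\<lambda>h. (f (x + h *\<^sub>R i) - f x) / h) \<longlongrightarrow> ?D x) (at 0)"
        using line[of x 0] by (simp add: DERIV_def)
      moreover have "filterlim (\<lambda>n. 1 / real (Suc n)) (at 0) sequentially"
        using LIMSEQ_Suc[OF lim_1_over_n] by (auto simp: filterlim_at)
      ultimately have "(\<lambda>n. (f (x + (1 / real (Suc n)) *\<^sub>R i) - f x) / (1 / real (Suc n))) \<longlonglongrightarrow> ?D x"
        by (rule filterlim_compose)
      then show "(\<lambda>n. d n x) \<longlonglongrightarrow> ?D x" by (simp add: d_def)
    qed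
    show "AE x in lborel. norm (d n x) \<le> M * indicator (cball 0 (R + 1)) x" for n using bd by simp
  qed (simp_all add: d_def)
  moreover have "(\<integral>x. d n x \<partial>lborel) = 0" for n
    using lborel_integrable_translate[OF intf] intf by (simp add: d_def lborel_integral_translate)
  ultimately show ?thesis by (simp add: LIMSEQ_const_iff)
qed

lemma frechet_derivative_mult:
  fixes f g :: "'a::euclidean_space \<Rightarrow> real"
  assumes "smooth f" "smooth g"
  shows "frechet_derivative (\<lambda>x. f x * g x) (at x) i =
    f x * frechet_derivative g (at x) i + frechet_derivative f (at x) i * g x"
  by (simp add: frechet_derivative_at[OF has_derivative_mult[OF smooth_has_derivative[OF assms(1)]
      smooth_has_derivative[OF assms(2)]], symmetric])

lemma test_function_mult:
  assumes "test_function f" "smooth g"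
  shows "test_function (\<lambda>x. f x * g x)"
proof -
  obtain R where "\<And>x. norm x > R \<Longrightarrow> f x = 0" using test_function_support[OF assms(1)] by blast
  then show ?thesis
    using test_function_smooth[OF assms(1)] assms(2)
    by (intro smooth_test_function[of _ R] smooth_mult) auto
qed

lemma continuous_locally_integrable:
  "continuous_on UNIV f \<Longrightarrow> locally_integrable f"
  unfolding locally_integrable_def set_integrable_def
  by (auto intro!: borel_integrable_compact intro: continuous_on_subset)

definition grad :: "('a::euclidean_space \<Rightarrow> real) \<Rightarrow> 'a \<Rightarrow> 'a" where
  "grad f x = (\<Sum>i\<in>Basis. frechet_derivative f (at x) i *\<^sub>R i)"

lemma grad_inner_Basis: "i \<in> Basis \<Longrightarrow> grad f x \<bullet> i = frechet_derivative f (at x) i"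
  by (simp add: grad_def inner_sum_left inner_Basis if_distrib sum.delta cong: if_cong)

lemma continuous_grad: "smooth f \<Longrightarrow> continuous_on UNIV (grad f)"
  unfolding grad_def
  by (intro continuous_intros smooth_continuous smooth_frechet_derivative)

text \<open>The product with a test function is again a test function, and its partial derivatives
  integrate to zero. This is what admits the trial functions of the optimality proof to
  \<open>H1\<close>.\<close>

lemma weak_gradient_test_function:
  fixes u :: "'a::euclidean_space \<Rightarrow> real"
  assumes u: "test_function u"
  shows "weak_gradient u (grad u)"
  unfolding weak_gradient_def
proof (intro conjI allI impI ballI)
  note sm = test_function_smooth[OF u]
  show "locally_integrable u" "locally_integrable (grad u)"
    using smooth_continuous[OF sm] continuous_grad[OF sm] by (auto intro: continuous_locally_integrable)
  fix \<phi> :: "'a \<Rightarrow> real" and i :: 'a assume \<phi>: "test_function \<phi>" and i: "i \<in> Basis"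
  note sm' = test_function_smooth[OF \<phi>]
  obtain R where R: "\<And>x. norm x > R \<Longrightarrow> u x = 0" using test_function_support[OF u] by blast
  have 1: "integrable lborel (\<lambda>x. u x * frechet_derivative \<phi> (at x) i)"
    using R i by (intro continuous_compact_support_integrable[where R=R] continuous_intros smooth_continuous
        sm sm' smooth_frechet_derivative) auto
  have 2: "integrable lborel (\<lambda>x. frechet_derivative u (at x) i * \<phi> x)"
    using R i by (intro continuous_compact_support_integrable[where R=R] continuous_intros smooth_continuous
        sm sm' smooth_frechet_derivative) (auto simp: frechet_derivative_eq_0[of R u])
  have "0 = (\<integral>x. frechet_derivative (\<lambda>x. u x * \<phi> x) (at x) i \<partial>lborel)"
    using integral_partial_derivative_eq_0[OF test_function_mult[OF u sm'] i] by simp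
  also have "\<dots> = (\<integral>x. u x * frechet_derivative \<phi> (at x) i \<partial>lborel) + (\<integral>x. frechet_derivative u (at x) i * \<phi> x \<partial>lborel)"
    unfolding frechet_derivative_mult[OF sm sm'] using 1 2 by simp
  finally show "(\<integral>x. u x * frechet_derivative \<phi> (at x) i \<partial>lborel) = - (\<integral>x. (grad u x \<bullet> i) * \<phi> x \<partial>lborel)"
    using i by (simp add: grad_inner_Basis)
qed

section \<open>Convolution pairings and density of continuous functions in \<open>L\<^sup>2\<close>\<close>

text \<open>For fixed \<open>x\<close> the factor \<open>k (x - y)\<close> is a reflected translate
  of \<open>k\<close>, so its integral over \<open>y\<close> does not depend on \<open>x\<close> and
  Fubini factors the double integral.\<close>

lemma
  fixes p k :: "'a::euclidean_space \<Rightarrow> real"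
  assumes p: "integrable lborel p" and k: "integrable lborel k"
  shows integrable_pair_convolution: "integrable (lborel \<Otimes>\<^sub>M lborel) (\<lambda>(x, y). p x * k (x - y))"
    and integral_pair_convolution:
      "(\<integral>(x, y). p x * k (x - y) \<partial>(lborel \<Otimes>\<^sub>M lborel)) = (\<integral>x. p x \<partial>lborel) * (\<integral>x. k x \<partial>lborel)"
proof -
  have [measurable]: "p \<in> borel_measurable borel" "k \<in> borel_measurable borel"
    using p k by auto
  show *: "integrable (lborel \<Otimes>\<^sub>M lborel) (\<lambda>(x, y). p x * k (x - y))"
  proof (rule lborel_pair.Fubini_integrable)
    show "AE x in lborel. integrable lborel (\<lambda>y. case (x, y) of (x, y) \<Rightarrow> p x * k (x - y))"
      using lborel_integrable_minus[OF k] by simp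
    have "(\<lambda>x. \<integral>y. norm (case (x, y) of (x, y) \<Rightarrow> p x * k (x - y)) \<partial>lborel)
        = (\<lambda>x. \<bar>p x\<bar> * (\<integral>y. \<bar>k y\<bar> \<partial>lborel))"
      by (simp add: abs_mult lborel_integral_minus[of "\<lambda>y. \<bar>k y\<bar>"])
    then show "integrable lborel (\<lambda>x. \<integral>y. norm (case (x, y) of (x, y) \<Rightarrow> p x * k (x - y)) \<partial>lborel)"
      using p by simp
  qed measurable
  show "(\<integral>(x, y). p x * k (x - y) \<partial>(lborel \<Otimes>\<^sub>M lborel)) = (\<integral>x. p x \<partial>lborel) * (\<integral>x. k x \<partial>lborel)"
    using lborel_pair.integral_fst'[OF *] by (simp add: lborel_integral_minus)
qed

text \<open>With \<open>p\<close> on the second variable, exchanging the variables and reflecting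
  \<open>k\<close> leads back to the preceding case.\<close>

lemma
  fixes p k :: "'a::euclidean_space \<Rightarrow> real"
  assumes p: "integrable lborel p" and k: "integrable lborel k"
  shows integrable_pair_convolution': "integrable (lborel \<Otimes>\<^sub>M lborel) (\<lambda>(x, y). p y * k (x - y))"
    and integral_pair_convolution':
      "(\<integral>(x, y). p y * k (x - y) \<partial>(lborel \<Otimes>\<^sub>M lborel)) = (\<integral>x. p x \<partial>lborel) * (\<integral>x. k x \<partial>lborel)"
proof -
  have [measurable]: "p \<in> borel_measurable borel" "k \<in> borel_measurable borel"
    using p k by auto
  have k': "integrable lborel (\<lambda>z. k (- z))" "(\<integral>z. k (- z) \<partial>lborel) = (\<integral>z. k z \<partial>lborel)"
    using lborel_integrable_minus[OF k, of 0] lborel_integral_minus[of k 0] by simp_all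
  show "integrable (lborel \<Otimes>\<^sub>M lborel) (\<lambda>(x, y). p y * k (x - y))"
    using lborel_pair.integrable_product_swap[OF integrable_pair_convolution[OF p k'(1)]]
    by (simp add: case_prod_unfold)
  show "(\<integral>(x, y). p y * k (x - y) \<partial>(lborel \<Otimes>\<^sub>M lborel)) = (\<integral>x. p x \<partial>lborel) * (\<integral>x. k x \<partial>lborel)"
    using integral_pair_convolution[OF p k'(1)]
      lborel_pair.integral_product_swap[of "\<lambda>(x, y). p x * k (- (x - y))"]
    by (simp add: case_prod_unfold k'(2))
qed

text \<open>The free parameter \<open>t\<close> gives this the strength of the Cauchy-Schwarz
  inequality: a small \<open>t\<close> makes the first square negligible, and the second factor is
  then approximated well enough to compensate for \<open>1 / t\<close>.\<close>

lemma weighted_AM_GM: "\<bar>a * b\<bar> \<le> (t * a\<^sup>2 + b\<^sup>2 / t) / 2" if "t > 0" for a b t :: real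
proof -
  have "0 \<le> (t * \<bar>a\<bar> - \<bar>b\<bar>)\<^sup>2 / t" using that by simp
  also have "\<dots> = t * a\<^sup>2 + b\<^sup>2 / t - 2 * \<bar>a * b\<bar>"
    using that by (simp add: power2_eq_square algebra_simps abs_mult add_divide_distrib diff_divide_distrib)
  finally show ?thesis by simp
qed

text \<open>This is the inner product of \<open>f\<close> with the convolution of \<open>k\<close>
  and \<open>v\<close>. It is written as one integral over the product space so that either variable
  can be integrated first.\<close>

definition conv_pairing :: "('a::euclidean_space \<Rightarrow> real) \<Rightarrow> ('a \<Rightarrow> real) \<Rightarrow> ('a \<Rightarrow> real) \<Rightarrow> real" where
  "conv_pairing k f v = (\<integral>(x, y). f x * v y * k (x - y) \<partial>(lborel \<Otimes>\<^sub>M lborel))"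

definition square_integrable :: "('a::euclidean_space \<Rightarrow> real) \<Rightarrow> bool" where
  "square_integrable f \<longleftrightarrow> f \<in> borel_measurable borel \<and> integrable lborel (\<lambda>x. (f x)\<^sup>2)"

text \<open>The case of Young's convolution inequality with two square integrable factors and an
  integrable kernel, in additive form: \<open>weighted_AM_GM\<close> splits the product, and each
  square is then integrated against the modulus of \<open>k\<close> by the two preceding
  lemmas.\<close>

lemma
  fixes f v k :: "'a::euclidean_space \<Rightarrow> real"
  assumes f: "square_integrable f" and v: "square_integrable v" and k: "integrable lborel k"
  shows integrable_conv_pairing: "integrable (lborel \<Otimes>\<^sub>M lborel) (\<lambda>(x, y). f x * v y * k (x - y))"
    and conv_pairing_bound: "t > 0 \<Longrightarrow> \<bar>conv_pairing k f v\<bar>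
      \<le> (t * (\<integral>x. (f x)\<^sup>2 \<partial>lborel) + (\<integral>x. (v x)\<^sup>2 \<partial>lborel) / t) / 2 * (\<integral>x. \<bar>k x\<bar> \<partial>lborel)"
proof -
  have [measurable]: "f \<in> borel_measurable borel" "v \<in> borel_measurable borel" "k \<in> borel_measurable borel"
    using f v k by (auto simp: square_integrable_def)
  have ka: "integrable lborel (\<lambda>x. \<bar>k x\<bar>)" using k by simp
  have f2: "integrable lborel (\<lambda>x. (f x)\<^sup>2)" and v2: "integrable lborel (\<lambda>x. (v x)\<^sup>2)"
    using f v by (auto simp: square_integrable_def)
  define B where "B t = (\<lambda>(x, y). t / 2 * ((f x)\<^sup>2 * \<bar>k (x - y)\<bar>) + 1 / (2 * t) * ((v y)\<^sup>2 * \<bar>k (x - y)\<bar>))" for t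
  have i1: "integrable (lborel \<Otimes>\<^sub>M lborel) (\<lambda>z. (f (fst z))\<^sup>2 * \<bar>k (fst z - snd z)\<bar>)"
    using integrable_pair_convolution[OF f2 ka] by (simp add: case_prod_unfold)
  have i2: "integrable (lborel \<Otimes>\<^sub>M lborel) (\<lambda>z. (v (snd z))\<^sup>2 * \<bar>k (fst z - snd z)\<bar>)"
    using integrable_pair_convolution'[OF v2 ka] by (simp add: case_prod_unfold)
  have B: "integrable (lborel \<Otimes>\<^sub>M lborel) (B t)" for t
    unfolding B_def case_prod_unfold using i1 i2 by (intro Bochner_Integration.integrable_add integrable_mult_right)
  have le: "\<bar>f x * v y * k (x - y)\<bar> \<le> B t (x, y)" if "t > 0" for x y t
    using mult_right_mono[OF weighted_AM_GM[OF that, of "f x" "v y"], of "\<bar>k (x - y)\<bar>"]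
    by (simp add: B_def abs_mult algebra_simps add_divide_distrib)
  show *: "integrable (lborel \<Otimes>\<^sub>M lborel) (\<lambda>(x, y). f x * v y * k (x - y))"
  proof (rule Bochner_Integration.integrable_bound[OF B[of 1]])
    show "AE z in lborel \<Otimes>\<^sub>M lborel. norm (case z of (x, y) \<Rightarrow> f x * v y * k (x - y)) \<le> norm (B 1 z)"
      using le[of 1] by (intro AE_I2) (auto intro: order_trans[OF _ abs_ge_self])
  qed measurable
  assume t: "t > 0"
  have "\<bar>conv_pairing k f v\<bar> \<le> (\<integral>z. norm (case z of (x, y) \<Rightarrow> f x * v y * k (x - y)) \<partial>(lborel \<Otimes>\<^sub>M lborel))"
    unfolding conv_pairing_def using integral_norm_bound[of _ "\<lambda>z. case z of (x, y) \<Rightarrow> f x * v y * k (x - y)"] by simp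
  also have "\<dots> \<le> (\<integral>z. B t z \<partial>(lborel \<Otimes>\<^sub>M lborel))"
    using le[OF t] by (intro integral_mono integrable_norm * B) auto
  also have "\<dots> = t / 2 * ((\<integral>x. (f x)\<^sup>2 \<partial>lborel) * (\<integral>x. \<bar>k x\<bar> \<partial>lborel))
      + 1 / (2 * t) * ((\<integral>x. (v x)\<^sup>2 \<partial>lborel) * (\<integral>x. \<bar>k x\<bar> \<partial>lborel))"
    unfolding B_def case_prod_unfold
    using i1 i2 integral_pair_convolution[OF f2 ka] integral_pair_convolution'[OF v2 ka]
    by (simp add: case_prod_unfold)
  also have "\<dots> = (t * (\<integral>x. (f x)\<^sup>2 \<partial>lborel) + (\<integral>x. (v x)\<^sup>2 \<partial>lborel) / t) / 2 * (\<integral>x. \<bar>k x\<bar> \<partial>lborel)"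
    using t by (simp add: field_simps)
  finally show "\<bar>conv_pairing k f v\<bar>
      \<le> (t * (\<integral>x. (f x)\<^sup>2 \<partial>lborel) + (\<integral>x. (v x)\<^sup>2 \<partial>lborel) / t) / 2 * (\<integral>x. \<bar>k x\<bar> \<partial>lborel)" .
qed

lemma
  fixes f v :: "'a::euclidean_space \<Rightarrow> real"
  assumes f: "square_integrable f" and v: "square_integrable v"
  shows square_integrable_mult: "integrable lborel (\<lambda>x. f x * v x)"
    and square_integrable_mult_bound: "t > 0 \<Longrightarrow> \<bar>\<integral>x. f x * v x \<partial>lborel\<bar>
      \<le> (t * (\<integral>x. (f x)\<^sup>2 \<partial>lborel) + (\<integral>x. (v x)\<^sup>2 \<partial>lborel) / t) / 2"
    and square_integrable_diff: "square_integrable (\<lambda>x. f x - v x)"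
proof -
  have [measurable]: "f \<in> borel_measurable borel" "v \<in> borel_measurable borel"
    and i: "integrable lborel (\<lambda>x. (f x)\<^sup>2)" "integrable lborel (\<lambda>x. (v x)\<^sup>2)"
    using f v by (auto simp: square_integrable_def)
  have B: "integrable lborel (\<lambda>x. (t * (f x)\<^sup>2 + (v x)\<^sup>2 / t) / 2)" for t using i by simp
  show *: "integrable lborel (\<lambda>x. f x * v x)"
    by (rule Bochner_Integration.integrable_bound[OF B[of 1]])
      (use weighted_AM_GM[of 1] in \<open>auto intro!: AE_I2 intro: order_trans[OF _ abs_ge_self]\<close>)
  have "integrable lborel (\<lambda>x. (f x)\<^sup>2 + (v x)\<^sup>2 - 2 * (f x * v x))" using i * by simp
  then show "square_integrable (\<lambda>x. f x - v x)"
    by (simp add: square_integrable_def power2_diff mult.assoc)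
  assume t: "t > 0"
  have "\<bar>\<integral>x. f x * v x \<partial>lborel\<bar> \<le> (\<integral>x. norm (f x * v x) \<partial>lborel)"
    using integral_norm_bound[of lborel "\<lambda>x. f x * v x"] by simp
  also have "\<dots> \<le> (\<integral>x. (t * (f x)\<^sup>2 + (v x)\<^sup>2 / t) / 2 \<partial>lborel)"
    using weighted_AM_GM[OF t] by (intro integral_mono integrable_norm * B) auto
  also have "\<dots> = (t * (\<integral>x. (f x)\<^sup>2 \<partial>lborel) + (\<integral>x. (v x)\<^sup>2 \<partial>lborel) / t) / 2"
    using i by simp
  finally show "\<bar>\<integral>x. f x * v x \<partial>lborel\<bar> \<le> (t * (\<integral>x. (f x)\<^sup>2 \<partial>lborel) + (\<integral>x. (v x)\<^sup>2 \<partial>lborel) / t) / 2" .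
qed

lemma conv_pairing_diff_right:
  fixes f v w k :: "'a::euclidean_space \<Rightarrow> real"
  assumes "square_integrable f" "square_integrable v" "square_integrable w" "integrable lborel k"
  shows "conv_pairing k f (\<lambda>x. v x - w x) = conv_pairing k f v - conv_pairing k f w"
proof -
  have "conv_pairing k f v - conv_pairing k f w
    = (\<integral>z. (case z of (x, y) \<Rightarrow> f x * v y * k (x - y)) - (case z of (x, y) \<Rightarrow> f x * w y * k (x - y)) \<partial>(lborel \<Otimes>\<^sub>M lborel))"
    unfolding conv_pairing_def using assms
    by (intro Bochner_Integration.integral_diff[symmetric] integrable_conv_pairing)
  then show ?thesis by (simp add: conv_pairing_def case_prod_unfold algebra_simps)
qed

lemma tendsto_integral_square_diff_0:
  fixes f :: "nat \<Rightarrow> 'a \<Rightarrow> real"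
  assumes "integrable M w" "\<And>n. (\<lambda>x. (f n x - g x)\<^sup>2) \<in> borel_measurable M"
    "AE x in M. (\<lambda>n. f n x) \<longlonglongrightarrow> g x" "\<And>n x. (f n x - g x)\<^sup>2 \<le> w x"
  shows "(\<lambda>n. \<integral>x. (f n x - g x)\<^sup>2 \<partial>M) \<longlonglongrightarrow> 0"
proof -
  have "(\<lambda>n. \<integral>x. (f n x - g x)\<^sup>2 \<partial>M) \<longlonglongrightarrow> (\<integral>x. 0 \<partial>M)"
  proof (rule integral_dominated_convergence[OF _ _ assms(1)])
    show "AE x in M. (\<lambda>n. (f n x - g x)\<^sup>2) \<longlonglongrightarrow> 0"
      using assms(3) by eventually_elim (auto simp: LIM_zero_iff intro!: tendsto_eq_intros)
  qed (use assms in auto)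
  then show ?thesis by simp
qed

text \<open>Truncation in space and in value reduces the claim to a bounded function supported in a
  ball. That function is an almost everywhere limit of continuous functions, and dominated
  convergence turns this into convergence in mean square.\<close>

lemma square_integrable_approx:
  fixes v :: "'a::euclidean_space \<Rightarrow> real"
  assumes v: "square_integrable v" and e: "e > 0"
  obtains w R where "continuous_on UNIV w" "\<And>x. norm x > R \<Longrightarrow> w x = 0"
    "(\<integral>x. (v x - w x)\<^sup>2 \<partial>lborel) < e"
proof -
  have [measurable]: "v \<in> borel_measurable borel" and v2: "integrable lborel (\<lambda>x. (v x)\<^sup>2)"
    using v by (auto simp: square_integrable_def)
  define cl where "cl r y = max (- r) (min r y)" for r y :: real
  define V where "V n x = indicator (cball 0 (real n)) x * cl (real n) (v x)" for n x
  have [measurable]: "V n \<in> borel_measurable borel" for n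
    unfolding V_def[abs_def] cl_def
    by (intro borel_measurable_times borel_measurable_max borel_measurable_min borel_measurable_const
        borel_measurable_indicator) auto
  have "(\<lambda>n. \<integral>x. (V n x - v x)\<^sup>2 \<partial>lborel) \<longlonglongrightarrow> 0"
  proof (rule tendsto_integral_square_diff_0[OF v2])
    show "(V n x - v x)\<^sup>2 \<le> (v x)\<^sup>2" for n x
      by (auto simp: V_def cl_def indicator_def abs_le_square_iff[symmetric])
    have "(\<lambda>n. V n x) \<longlonglongrightarrow> v x" for x
    proof (rule tendsto_eventually)
      obtain N where N: "real N \<ge> max (norm x) \<bar>v x\<bar>" using real_arch_simple by blast
      show "\<forall>\<^sub>F n in sequentially. V n x = v x"
        using eventually_ge_at_top[of N]
      proof eventually_elim
        case (elim n)
        then have "real N \<le> real n" by simp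
        then have "norm x \<le> real n" "\<bar>v x\<bar> \<le> real n" using N by auto
        then show ?case by (auto simp: V_def cl_def)
      qed
    qed
    then show "AE x in lborel. (\<lambda>n. V n x) \<longlonglongrightarrow> v x" by simp
  qed measurable
  then have "\<forall>\<^sub>F n in sequentially. (\<integral>x. (V n x - v x)\<^sup>2 \<partial>lborel) < e / 4"
    using e by (intro order_tendstoD) auto
  then obtain n where n: "(\<integral>x. (V n x - v x)\<^sup>2 \<partial>lborel) < e / 4"
    by (auto simp: eventually_sequentially)
  have "V n measurable_on UNIV"
    by (rule lebesgue_measurable_imp_measurable_on_real) (auto intro: measurable_completion)
  then obtain N g where N: "negligible N" and g: "\<And>k. continuous_on UNIV (g k)"
    "\<And>x. x \<notin> N \<Longrightarrow> (\<lambda>k. g k x) \<longlonglongrightarrow> V n x"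
    unfolding measurable_on_def by auto
  \<comment> \<open>The functions \<open>g k\<close> converge pointwise but carry neither a bound
    nor compact support. Clamping the values and multiplying by a continuous cutoff that equals 1 on
    the support of \<open>V n\<close> supplies both without changing the limit.\<close>
  define cut where "cut x = max 0 (min 1 (real n + 1 - norm x))" for x :: 'a
  define w where "w k x = cut x * cl (real n) (g k x)" for k x
  have cw: "continuous_on UNIV (w k)" for k
    unfolding w_def cut_def cl_def by (intro continuous_intros g)
  have [measurable]: "w k \<in> borel_measurable borel" for k
    using cw by (rule borel_measurable_continuous_onI)
  have w0: "w k x = 0" if "norm x > real n + 1" for k x using that by (simp add: w_def cut_def)
  have "(\<lambda>k. \<integral>x. (w k x - V n x)\<^sup>2 \<partial>lborel) \<longlonglongrightarrow> 0"
  proof (rule tendsto_integral_square_diff_0)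
    show "integrable lborel (\<lambda>x. (2 * real n)\<^sup>2 * indicator (cball 0 (real n + 1)) x :: real)"
      using emeasure_lborel_cball_finite[of 0 "real n+1"] by auto
    show "(w k x - V n x)\<^sup>2 \<le> (2 * real n)\<^sup>2 * indicator (cball 0 (real n + 1)) x" for k x
    proof (cases "norm x > real n + 1")
      case True
      then show ?thesis by (simp add: w0 V_def)
    next
      case False
      have "\<bar>cl (real n) y\<bar> \<le> real n" for y by (auto simp: cl_def)
      moreover have "0 \<le> cut x" "cut x \<le> 1" by (auto simp: cut_def)
      ultimately have "\<bar>w k x\<bar> \<le> real n" "\<bar>V n x\<bar> \<le> real n"
        by (auto simp: w_def V_def abs_mult indicator_def intro!: mult_left_le_one_le order_trans[OF mult_left_le_one_le])
      then have "\<bar>w k x - V n x\<bar> \<le> \<bar>2 * real n\<bar>" by linarith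
      then show ?thesis using False unfolding abs_le_square_iff by simp
    qed
    have "AE x in lebesgue. x \<notin> N"
      using N by (intro AE_not_in) (simp add: negligible_iff_null_sets)
    then have "AE x in lborel. x \<notin> N" by (simp add: AE_completion_iff)
    then show "AE x in lborel. (\<lambda>k. w k x) \<longlonglongrightarrow> V n x"
    proof eventually_elim
      case (elim x)
      have "(\<lambda>k. w k x) \<longlonglongrightarrow> cut x * cl (real n) (V n x)"
        unfolding w_def cl_def by (intro tendsto_intros g elim)
      moreover have "cut x * cl (real n) (V n x) = V n x"
        by (auto simp: V_def cut_def cl_def indicator_def)
      ultimately show ?case by simp
    qed
  qed measurable
  then have "\<forall>\<^sub>F k in sequentially. (\<integral>x. (w k x - V n x)\<^sup>2 \<partial>lborel) < e / 4"
    using e by (intro order_tendstoD) auto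
  then obtain k where k: "(\<integral>x. (w k x - V n x)\<^sup>2 \<partial>lborel) < e / 4"
    by (auto simp: eventually_sequentially)
  have sw: "square_integrable (w k)"
    unfolding square_integrable_def
    by (intro conjI continuous_compact_support_integrable[where R="real n + 1"])
      (auto intro!: continuous_intros cw w0)
  have sV: "square_integrable (V n)"
    unfolding square_integrable_def
  proof
    show "integrable lborel (\<lambda>x. (V n x)\<^sup>2)"
      by (rule Bochner_Integration.integrable_bound[OF v2])
        (auto simp: V_def cl_def indicator_def abs_le_square_iff[symmetric] intro!: AE_I2)
  qed measurable
  \<comment> \<open>Parallelogram law: the difference of the two sides is the square of
    \<open>v x - 2 * V n x + w k x\<close>. The factor 2 is the reason for \<open>e / 4\<close>
    above.\<close>
  have "(v x - w k x)\<^sup>2 \<le> 2 * (V n x - v x)\<^sup>2 + 2 * (w k x - V n x)\<^sup>2" for x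
    using sum_squares_ge_zero[of "v x - 2 * V n x + w k x" 0] by (simp add: power2_eq_square algebra_simps)
  then have "(\<integral>x. (v x - w k x)\<^sup>2 \<partial>lborel) \<le> (\<integral>x. 2 * (V n x - v x)\<^sup>2 + 2 * (w k x - V n x)\<^sup>2 \<partial>lborel)"
    using square_integrable_diff[OF v sw] square_integrable_diff[OF sV v] square_integrable_diff[OF sw sV]
    by (intro integral_mono) (auto simp: square_integrable_def)
  also have "\<dots> = 2 * (\<integral>x. (V n x - v x)\<^sup>2 \<partial>lborel) + 2 * (\<integral>x. (w k x - V n x)\<^sup>2 \<partial>lborel)"
    using square_integrable_diff[OF sV v] square_integrable_diff[OF sw sV] by (simp add: square_integrable_def)
  also have "\<dots> < e" using n k by simp
  finally show ?thesis using that[OF cw w0] by blast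
qed

section \<open>The weak gradient of a square\<close>

text \<open>Since \<open>k n\<close> has mass one, the limit integral is the same double integral
  with \<open>w x\<close> in place of \<open>w y\<close>. The kernel only sees pairs at distance
  below \<open>1 / real (Suc n)\<close>, where uniform continuity makes the difference of these
  values small.\<close>

lemma conv_pairing_tendsto_continuous:
  fixes f w :: "'a::euclidean_space \<Rightarrow> real" and k :: "nat \<Rightarrow> 'a \<Rightarrow> real"
  assumes f: "integrable lborel f"
    and w: "continuous_on UNIV w" "\<And>x. norm x > R \<Longrightarrow> w x = 0"
    and k: "\<And>n. integrable lborel (k n)" "\<And>n x. k n x \<ge> 0" "\<And>n. (\<integral>x. k n x \<partial>lborel) = 1"
      "\<And>n x. norm x \<ge> 1 / real (Suc n) \<Longrightarrow> k n x = 0"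
  shows "(\<lambda>n. conv_pairing (k n) f w) \<longlonglongrightarrow> (\<integral>x. f x * w x \<partial>lborel)"
proof (rule LIMSEQ_I)
  have [measurable]: "f \<in> borel_measurable borel" "w \<in> borel_measurable borel" "k n \<in> borel_measurable borel" for n
    using f k w(1) by (auto intro: borel_measurable_continuous_onI)
  obtain M where M: "M > 0" "\<And>x. \<bar>w x\<bar> \<le> M"
    using continuous_compact_support_bounded[OF w] by blast
  have fw: "integrable lborel (\<lambda>x. f x * w x)"
    by (rule Bochner_Integration.integrable_bound[OF integrable_mult_right[OF f, of M]])
      (use M in \<open>auto simp: abs_mult mult.commute[of M] intro!: AE_I2 mult_left_mono\<close>)
  fix e :: real assume e: "e > 0"
  define J where "J = (\<integral>x. \<bar>f x\<bar> \<partial>lborel)"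
  \<comment> \<open>The final estimate is \<open>d * J\<close>; the summand 1 keeps the denominator
    positive when \<open>J = 0\<close>.\<close>
  define d where "d = e / (1 + J)"
  have J: "J \<ge> 0" by (simp add: J_def)
  have d: "d > 0" using e J by (simp add: d_def)
  have "uniformly_continuous_on (cball 0 (R + 1)) w"
    using w(1) by (intro compact_uniformly_continuous) (auto intro: continuous_on_subset)
  then obtain r where r: "r > 0" "\<And>x y. x \<in> cball 0 (R + 1) \<Longrightarrow> y \<in> cball 0 (R + 1) \<Longrightarrow> dist y x < r \<Longrightarrow> dist (w y) (w x) < d"
    using d unfolding uniformly_continuous_on_def by blast
  \<comment> \<open>Two points at distance below 1 either both lie in the ball of radius
    \<open>R + 1\<close>, where uniform continuity applies, or both lie outside the ball of radius
    \<open>R\<close>, where \<open>w\<close> vanishes.\<close>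
  have uc: "\<bar>w y - w x\<bar> \<le> d" if "norm (x - y) < min r 1" for x y
  proof (cases "norm x \<le> R + 1 \<and> norm y \<le> R + 1")
    case True
    then show ?thesis using r(2)[of x y] that by (simp add: dist_norm norm_minus_commute)
  next
    case False
    have "norm x \<le> norm y + norm (x - y)" "norm y \<le> norm x + norm (x - y)"
      using norm_triangle_sub[of x y] norm_triangle_sub[of y x] by (simp_all add: norm_minus_commute)
    then have "w x = 0" "w y = 0" using False that by (auto intro!: w(2))
    then show ?thesis using d by simp
  qed
  obtain N where N: "1 / real (Suc N) < min r 1" using r(1) nat_approx_posE[of "min r 1"] by auto
  show "\<exists>no. \<forall>n\<ge>no. norm (conv_pairing (k n) f w - (\<integral>x. f x * w x \<partial>lborel)) < e"
  proof (intro exI[of _ N] allI impI)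
    fix n assume n: "n \<ge> N"
    have "1 / real (Suc n) \<le> 1 / real (Suc N)" using n by (intro divide_left_mono) auto
    then have n': "1 / real (Suc n) < min r 1" using N by (rule le_less_trans)
    have le: "\<bar>f x * w y * k n (x - y) - f x * w x * k n (x - y)\<bar> \<le> d * (\<bar>f x\<bar> * k n (x - y))" for x y
    proof (cases "norm (x - y) < 1 / real (Suc n)")
      case True
      have "\<bar>f x * w y * k n (x - y) - f x * w x * k n (x - y)\<bar> = \<bar>w y - w x\<bar> * (\<bar>f x\<bar> * k n (x - y))"
      proof -
        have "f x * w y * k n (x - y) - f x * w x * k n (x - y) = (w y - w x) * (f x * k n (x - y))"
          by (simp add: algebra_simps)
        then show ?thesis using k(2)[of n "x - y"] by (simp only: abs_mult abs_of_nonneg)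
      qed
      also have "\<dots> \<le> d * (\<bar>f x\<bar> * k n (x - y))"
        using less_trans[OF True n'] k(2) by (intro mult_right_mono uc) simp_all
      finally show ?thesis .
    qed (simp add: k(4))
    have fa: "integrable lborel (\<lambda>x. \<bar>f x\<bar>)" using f by simp
    have i1: "integrable (lborel \<Otimes>\<^sub>M lborel) (\<lambda>(x, y). f x * w x * k n (x - y))"
      using integrable_pair_convolution[OF fw k(1)] .
    have i2: "integrable (lborel \<Otimes>\<^sub>M lborel) (\<lambda>(x, y). \<bar>f x\<bar> * k n (x - y))"
      using integrable_pair_convolution[OF fa k(1)] .
    have i3: "integrable (lborel \<Otimes>\<^sub>M lborel) (\<lambda>(x, y). f x * w y * k n (x - y))"
    proof (rule Bochner_Integration.integrable_bound[OF integrable_mult_right[OF i2, of M]])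
      show "AE z in lborel \<Otimes>\<^sub>M lborel. norm (case z of (x, y) \<Rightarrow> f x * w y * k n (x - y))
          \<le> norm (M * (case z of (x, y) \<Rightarrow> \<bar>f x\<bar> * k n (x - y)))"
      proof (intro AE_I2)
        fix z :: "'a \<times> 'a"
        obtain x y where z: "z = (x, y)" by (cases z)
        have "\<bar>w y\<bar> * (\<bar>f x\<bar> * \<bar>k n (x - y)\<bar>) \<le> M * (\<bar>f x\<bar> * \<bar>k n (x - y)\<bar>)"
          by (intro mult_right_mono M) auto
        then show "norm (case z of (x, y) \<Rightarrow> f x * w y * k n (x - y))
          \<le> norm (M * (case z of (x, y) \<Rightarrow> \<bar>f x\<bar> * k n (x - y)))"
          using M(1) by (simp add: z abs_mult ac_simps)
      qed
    qed measurable
    have "conv_pairing (k n) f w - (\<integral>x. f x * w x \<partial>lborel)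
      = (\<integral>z. (case z of (x, y) \<Rightarrow> f x * w y * k n (x - y)) - (case z of (x, y) \<Rightarrow> f x * w x * k n (x - y)) \<partial>(lborel \<Otimes>\<^sub>M lborel))"
      using integral_pair_convolution[OF fw k(1)[of n]] k(3)[of n]
      by (subst Bochner_Integration.integral_diff[OF i3 i1]) (simp add: conv_pairing_def)
    also have "norm \<dots> \<le> (\<integral>z. norm ((case z of (x, y) \<Rightarrow> f x * w y * k n (x - y)) - (case z of (x, y) \<Rightarrow> f x * w x * k n (x - y))) \<partial>(lborel \<Otimes>\<^sub>M lborel))"
      by (rule integral_norm_bound)
    also have "\<dots> \<le> (\<integral>z. d * (case z of (x, y) \<Rightarrow> \<bar>f x\<bar> * k n (x - y)) \<partial>(lborel \<Otimes>\<^sub>M lborel))"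
      using le by (intro integral_mono integrable_norm Bochner_Integration.integrable_diff i1 i3 integrable_mult_right i2) auto
    also have "\<dots> = d * J"
      using integral_pair_convolution[OF fa k(1)[of n]] k(3)[of n] i2 by (simp add: J_def)
    also have "\<dots> < e"
      using e J by (simp add: d_def field_simps)
    finally show "norm (conv_pairing (k n) f w - (\<integral>x. f x * w x \<partial>lborel)) < e" .
  qed
qed

text \<open>A three-epsilon argument: \<open>v\<close> is replaced by a continuous \<open>w\<close>
  of compact support, and the bounds on the pairing and on the limit integral control the
  replacement uniformly in \<open>n\<close>, because all kernels have mass one.\<close>

lemma conv_pairing_tendsto:
  fixes f v :: "'a::euclidean_space \<Rightarrow> real" and k :: "nat \<Rightarrow> 'a \<Rightarrow> real"
  assumes f: "integrable lborel f" "square_integrable f" and v: "square_integrable v"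
    and k: "\<And>n. integrable lborel (k n)" "\<And>n x. k n x \<ge> 0" "\<And>n. (\<integral>x. k n x \<partial>lborel) = 1"
      "\<And>n x. norm x \<ge> 1 / real (Suc n) \<Longrightarrow> k n x = 0"
  shows "(\<lambda>n. conv_pairing (k n) f v) \<longlonglongrightarrow> (\<integral>x. f x * v x \<partial>lborel)"
proof (rule LIMSEQ_I)
  fix e :: real assume e: "e > 0"
  define A where "A = (\<integral>x. (f x)\<^sup>2 \<partial>lborel)"
  have A: "A \<ge> 0" by (simp add: A_def)
  \<comment> \<open>\<open>t\<close> is fixed before \<open>w\<close>: it makes \<open>t * A\<close>
    small, and the accuracy demanded of \<open>w\<close> then includes the factor \<open>t\<close>,
    so that the second term of the bound is small as well.\<close>
  define t where "t = e / (3 * (1 + A))"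
  have t: "t > 0" "t * A < e / 3" using e A by (simp_all add: t_def field_simps)
  obtain w R where w: "continuous_on UNIV w" "\<And>x. norm x > R \<Longrightarrow> w x = 0"
    and B: "(\<integral>x. (v x - w x)\<^sup>2 \<partial>lborel) < t * (e / 3)"
    using square_integrable_approx[OF v, of "t * (e / 3)"] t e by auto
  have sw: "square_integrable w"
    unfolding square_integrable_def
    by (intro conjI continuous_compact_support_integrable[where R=R] borel_measurable_continuous_onI)
      (auto intro!: continuous_intros w)
  let ?B = "\<integral>x. (v x - w x)\<^sup>2 \<partial>lborel"
  have B': "?B / t < e / 3" using B t by (simp add: field_simps)
  have s: "(t * A + ?B / t) / 2 < e / 3" using t B' by simp
  from conv_pairing_tendsto_continuous[OF f(1) w k]
  have "\<exists>N. \<forall>n\<ge>N. norm (conv_pairing (k n) f w - (\<integral>x. f x * w x \<partial>lborel)) < e / 3"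
    by (rule LIMSEQ_D) (use e in auto)
  then obtain N where N: "\<And>n. n \<ge> N \<Longrightarrow> norm (conv_pairing (k n) f w - (\<integral>x. f x * w x \<partial>lborel)) < e / 3"
    by blast
  have 2: "\<bar>(\<integral>x. f x * v x \<partial>lborel) - (\<integral>x. f x * w x \<partial>lborel)\<bar> < e / 3"
  proof -
    have "(\<integral>x. f x * v x \<partial>lborel) - (\<integral>x. f x * w x \<partial>lborel) = (\<integral>x. f x * (v x - w x) \<partial>lborel)"
      using square_integrable_mult[OF f(2) v] square_integrable_mult[OF f(2) sw]
      by (simp add: right_diff_distrib)
    then show ?thesis
      using square_integrable_mult_bound[OF f(2) square_integrable_diff[OF v sw] t(1), folded A_def] s
      by linarith
  qed
  show "\<exists>no. \<forall>n\<ge>no. norm (conv_pairing (k n) f v - (\<integral>x. f x * v x \<partial>lborel)) < e"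
  proof (intro exI[of _ N] allI impI)
    fix n assume "n \<ge> N"
    have ka: "(\<integral>x. \<bar>k n x\<bar> \<partial>lborel) = 1" using k(2,3) by simp
    have "\<bar>conv_pairing (k n) f v - conv_pairing (k n) f w\<bar> < e / 3"
      using conv_pairing_bound[OF f(2) square_integrable_diff[OF v sw] k(1) t(1), of n, folded A_def] s
      unfolding conv_pairing_diff_right[OF f(2) v sw k(1)] ka by linarith
    then show "norm (conv_pairing (k n) f v - (\<integral>x. f x * v x \<partial>lborel)) < e"
      using 2 N[OF \<open>n \<ge> N\<close>] unfolding real_norm_def by linarith
  qed
qed

section \<open>Affine changes of variable and mollifiers\<close>

lemma Ck_affine:
  "Ck k f \<Longrightarrow> Ck k (\<lambda>x. f (s *\<^sub>R x + c))"
proof (induction k arbitrary: f)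
  case 0
  then show ?case by (auto intro!: continuous_on_compose2[of UNIV f] continuous_intros)
next
  case (Suc k)
  have "((\<lambda>x. f (s *\<^sub>R x + c)) has_derivative (\<lambda>h. frechet_derivative f (at (s *\<^sub>R x + c)) (s *\<^sub>R h))) (at x)" for x
    by (rule has_derivative_compose[OF _ Ck_Suc_has_derivative[OF Suc.prems]]) (auto intro!: derivative_eq_intros)
  then have "((\<lambda>x. f (s *\<^sub>R x + c)) has_derivative (\<lambda>h. s * frechet_derivative f (at (s *\<^sub>R x + c)) h)) (at x)" for x
    using linear_cmul[OF has_derivative_linear[OF Ck_Suc_has_derivative[OF Suc.prems]]] by simp
  moreover have "Ck k (\<lambda>x. s * frechet_derivative f (at (s *\<^sub>R x + c)) i)" if "i \<in> Basis" for i
    using that Suc.prems by (intro Ck_mult[OF Ck_const] Suc.IH[of "\<lambda>x. frechet_derivative f (at x) i"]) auto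
  ultimately show ?case by (intro Ck_SucI) auto
qed

lemma
  assumes "smooth f"
  shows smooth_affine: "smooth (\<lambda>x. f (s *\<^sub>R x + c))"
    and frechet_derivative_affine:
      "frechet_derivative (\<lambda>x. f (s *\<^sub>R x + c)) (at x) i = s * frechet_derivative f (at (s *\<^sub>R x + c)) i"
proof -
  show "smooth (\<lambda>x. f (s *\<^sub>R x + c))" using assms Ck_affine[of _ f s c] by (simp add: smooth_def)
  have "((\<lambda>x. f (s *\<^sub>R x + c)) has_derivative (\<lambda>h. frechet_derivative f (at (s *\<^sub>R x + c)) (s *\<^sub>R h))) (at x)"
    by (rule has_derivative_compose[OF _ smooth_has_derivative[OF assms]]) (auto intro!: derivative_eq_intros)
  then show "frechet_derivative (\<lambda>x. f (s *\<^sub>R x + c)) (at x) i = s * frechet_derivative f (at (s *\<^sub>R x + c)) i"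
    using linear_cmul[OF has_derivative_linear[OF smooth_has_derivative[OF assms]]]
    by (simp add: frechet_derivative_at[symmetric])
qed

text \<open>The bump \<open>b n\<close> is a flat function of \<open>1 - (Suc n)^2 |x|^2\<close>,
  smooth because it depends on the squared norm. Each bump is divided by its own integral, which is
  positive since the bump is positive on a ball of positive volume.\<close>

lemma mollifier_exists:
  obtains k :: "nat \<Rightarrow> 'a::euclidean_space \<Rightarrow> real" where "\<And>n. smooth (k n)" "\<And>n x. k n x \<ge> 0"
    "\<And>n. (\<integral>x. k n x \<partial>lborel) = 1" "\<And>n x. norm x \<ge> 1 / real (Suc n) \<Longrightarrow> k n x = 0"
proof -
  define b where "b n x = flat_exp 0 (1 - (real (Suc n))\<^sup>2 * (x \<bullet> x))" for n and x :: 'a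
  have sb: "smooth (b n)" for n
    unfolding b_def by (intro smooth_compose[OF smooth_flat_exp] smooth_diff smooth_mult smooth_const smooth_inner_self)
  have b0: "b n x = 0" if "norm x \<ge> 1 / real (Suc n)" for n x
  proof -
    have "1 \<le> real (Suc n) * norm x" using that by (simp add: field_simps)
    then have "1 \<le> (real (Suc n) * norm x)\<^sup>2" by simp
    then show ?thesis by (simp add: b_def flat_exp_eq_0 power_mult_distrib power2_norm_eq_inner)
  qed
  have nn: "b n x \<ge> 0" for n x by (simp add: b_def flat_exp_nonneg)
  have ib: "integrable lborel (b n)" for n
    by (rule continuous_compact_support_integrable[OF smooth_continuous[OF sb], where R="1 / real (Suc n)"])
      (rule b0, simp)
  have "(\<integral>x. b n x \<partial>lborel) \<noteq> 0" for n
  proof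
    assume "(\<integral>x. b n x \<partial>lborel) = 0"
    then have ae: "AE x in lborel. b n x = 0"
      using integral_nonneg_eq_0_iff_AE[OF ib] nn by simp
    have nz: "b n x \<noteq> 0" if "x \<in> ball 0 (1 / real (Suc n))" for x
    proof -
      have "real (Suc n) * norm x < 1" using that by (simp add: field_simps)
      then have "(real (Suc n) * norm x)\<^sup>2 < 1" by (simp add: power_less_one_iff abs_square_less_1)
      then have "b n x > 0" unfolding b_def by (intro flat_exp_pos) (simp add: power_mult_distrib power2_norm_eq_inner)
      then show ?thesis by simp
    qed
    from ae have "AE x in lborel. x \<notin> ball (0::'a) (1 / real (Suc n))"
      by eventually_elim (use nz in blast)
    then have "emeasure lborel (ball (0::'a) (1 / real (Suc n))) = 0"
      using AE_iff_null_sets[of "ball (0::'a) (1 / real (Suc n))" lborel] by (auto simp: null_sets_def)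
    then show False
      using emeasure_ball[of "1 / real (Suc n)" "0::'a"] unit_ball_vol_pos[of "DIM('a)"] by simp
  qed
  moreover have "(\<integral>x. b n x \<partial>lborel) \<ge> 0" for n using nn by simp
  ultimately have pos: "(\<integral>x. b n x \<partial>lborel) > 0" for n by (metis less_eq_real_def)
  show ?thesis
  proof (rule that[of "\<lambda>n x. inverse (\<integral>x. b n x \<partial>lborel) * b n x"])
    show "smooth (\<lambda>x. inverse (\<integral>x. b n x \<partial>lborel) * b n x)" for n
      by (intro smooth_mult smooth_const sb)
    show "(\<integral>x. inverse (\<integral>x. b n x \<partial>lborel) * b n x \<partial>lborel) = 1" for n
      using pos[of n] by simp
  qed (use nn pos b0 in \<open>auto simp: less_imp_le\<close>)
qed

lemma
  fixes p q :: "'a::euclidean_space \<Rightarrow> real"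
  assumes q: "q \<in> borel_measurable borel" "\<And>x. \<bar>q x\<bar> \<le> K"
  shows integrable_mult_bounded: "integrable lborel p \<Longrightarrow> integrable lborel (\<lambda>x. p x * q x)"
    and square_integrable_mult_bounded: "square_integrable p \<Longrightarrow> square_integrable (\<lambda>x. p x * q x)"
proof -
  show *: "integrable lborel (\<lambda>x. p x * q x)" if p: "integrable lborel p" for p
  proof (rule Bochner_Integration.integrable_bound[OF integrable_mult_right[OF p, of K]])
    show "AE x in lborel. norm (p x * q x) \<le> norm (K * p x)"
      using order_trans[OF q(2) abs_ge_self]
      by (auto simp: abs_mult mult.commute[of "\<bar>K\<bar>"] intro!: AE_I2 mult_left_mono)
    show "(\<lambda>x. p x * q x) \<in> borel_measurable lborel" using borel_measurable_integrable[OF p] q(1) by simp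
  qed
  assume p: "square_integrable p"
  have "integrable lborel (\<lambda>x. (p x)\<^sup>2 * q x * q x)"
    using p by (intro *) (simp add: square_integrable_def)
  then show "square_integrable (\<lambda>x. p x * q x)"
    using p q by (auto simp: square_integrable_def power_mult_distrib power2_eq_square mult_ac)
qed

text \<open>The cancellation leaves three pairings with kernels of mass one, whose limits are the
  integral of \<open>u^2\<close> against the derivative of \<phi> and twice that of
  \<open>u (g \<bullet> i) \<phi>\<close>. Square integrability of both \<open>u\<close> and
  \<open>g\<close> is available only on balls, so everything is first truncated to a ball that the
  supports of \<phi> and of the kernels cannot leave.\<close>

lemma weak_gradient_square:
  fixes u :: "'a::euclidean_space \<Rightarrow> real"
  assumes wg: "weak_gradient u g"
    and um: "u \<in> borel_measurable borel" and gm: "g \<in> borel_measurable borel"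
    and u2: "\<And>R. set_integrable lborel (cball 0 R) (\<lambda>x. (u x)\<^sup>2)"
    and g2: "\<And>R. set_integrable lborel (cball 0 R) (\<lambda>x. (norm (g x))\<^sup>2)"
    and \<phi>: "test_function \<phi>" and i: "i \<in> Basis"
  shows "(\<integral>x. (u x)\<^sup>2 * frechet_derivative \<phi> (at x) i \<partial>lborel) = - 2 * (\<integral>x. u x * (g x \<bullet> i) * \<phi> x \<partial>lborel)"
proof -
  note sm = test_function_smooth[OF \<phi>]
  let ?D = "\<lambda>\<phi> x. frechet_derivative \<phi> (at x) i"
  obtain R where R: "R > 0" "\<And>x. norm x > R \<Longrightarrow> \<phi> x = 0" using test_function_support[OF \<phi>] by blast
  have D0: "?D \<phi> x = 0" if "norm x > R" for x using frechet_derivative_eq_0[OF R(2) that] .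
  \<comment> \<open>\<phi> vanishes beyond radius \<open>R\<close> and the kernels vanish beyond
    distance 1, so only points of norm at most \<open>R + 1\<close> interact; \<open>R + 2\<close>
    leaves a margin.\<close>
  define B where "B = cball (0::'a) (R + 2)"
  define U where "U x = indicator B x * u x" for x
  define G where "G x = indicator B x * (g x \<bullet> i)" for x
  have B[measurable]: "B \<in> sets borel" by (simp add: B_def)
  note [measurable] = um gm
  have Um[measurable]: "U \<in> borel_measurable borel" unfolding U_def[abs_def] by measurable
  have Gm[measurable]: "G \<in> borel_measurable borel" unfolding G_def[abs_def] by measurable
  have li: "set_integrable lborel B u" "set_integrable lborel B g"
    using wg by (auto simp: weak_gradient_def locally_integrable_def B_def)
  have iU: "integrable lborel U" using li(1) by (simp add: set_integrable_def U_def[abs_def])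
  have iG: "integrable lborel G"
    using integrable_inner_left[of i lborel "\<lambda>x. indicator B x *\<^sub>R g x"] li(2)
    by (simp add: set_integrable_def G_def[abs_def])
  have sU: "square_integrable U"
  proof -
    have "(U x)\<^sup>2 = indicator (cball 0 (R + 2)) x *\<^sub>R (u x)\<^sup>2" for x
      by (simp add: U_def B_def indicator_def)
    then show ?thesis using u2[of "R + 2"] by (simp add: square_integrable_def set_integrable_def Um)
  qed
  have sG: "square_integrable G"
    unfolding square_integrable_def
  proof
    show "integrable lborel (\<lambda>x. (G x)\<^sup>2)"
    proof (rule Bochner_Integration.integrable_bound[OF g2[of "R + 2", unfolded set_integrable_def]])
      show "AE x in lborel. norm ((G x)\<^sup>2) \<le> norm (indicat_real (cball 0 (R + 2)) x *\<^sub>R (norm (g x))\<^sup>2)"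
      proof (intro AE_I2)
        fix x
        have "\<bar>g x \<bullet> i\<bar> \<le> norm (g x)" using Basis_le_norm[OF i] .
        then have "(g x \<bullet> i)\<^sup>2 \<le> (norm (g x))\<^sup>2" using abs_le_square_iff[of "g x \<bullet> i" "norm (g x)"] by simp
        then show "norm ((G x)\<^sup>2) \<le> norm (indicat_real (cball 0 (R + 2)) x *\<^sub>R (norm (g x))\<^sup>2)"
          by (simp add: G_def B_def indicator_def)
      qed
    qed measurable
  qed (rule Gm)
  have c\<phi>: "continuous_on UNIV \<phi>" and cD: "continuous_on UNIV (?D \<phi>)"
    using smooth_continuous[OF sm] smooth_continuous[OF smooth_frechet_derivative[OF sm i]] .
  have [measurable]: "\<phi> \<in> borel_measurable borel" "?D \<phi> \<in> borel_measurable borel"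
    using borel_measurable_continuous_onI[OF c\<phi>] borel_measurable_continuous_onI[OF cD] .
  have "\<exists>K>0. \<forall>x. \<bar>\<phi> x\<bar> \<le> K" by (rule continuous_compact_support_bounded[OF c\<phi> R(2)])
  then obtain K1 where K1: "\<And>x. \<bar>\<phi> x\<bar> \<le> K1" by blast
  have "\<exists>K>0. \<forall>x. \<bar>?D \<phi> x\<bar> \<le> K" by (rule continuous_compact_support_bounded[OF cD D0])
  then obtain K2 where K2: "\<And>x. \<bar>?D \<phi> x\<bar> \<le> K2" by blast
  define K where "K = max K1 K2"
  have K: "\<bar>\<phi> x\<bar> \<le> K" "\<bar>?D \<phi> x\<bar> \<le> K" for x using K1[of x] K2[of x] by (auto simp: K_def)
  \<comment> \<open>The three terms produced by testing with the product of \<phi> and the kernel: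
    the derivative falls on \<phi> (\<open>f1\<close>), on the kernel (\<open>f2\<close>), or has
    been moved to \<open>u\<close> (\<open>f3\<close>).\<close>
  define f1 where "f1 x = U x * ?D \<phi> x" for x
  define f2 where "f2 x = U x * \<phi> x" for x
  define f3 where "f3 x = G x * \<phi> x" for x
  have f_eq: "f1 x = u x * ?D \<phi> x" "f2 x = u x * \<phi> x" "f3 x = (g x \<bullet> i) * \<phi> x" for x
    using R(1) R(2)[of x] D0[of x] by (auto simp: f1_def f2_def f3_def U_def G_def B_def indicator_def)
  have f: "integrable lborel f1" "integrable lborel f2" "integrable lborel f3"
    unfolding f1_def f2_def f3_def
    by (auto intro!: integrable_mult_bounded[where K=K] iU iG K)
  have sf: "square_integrable f1" "square_integrable f2" "square_integrable f3"
    unfolding f1_def f2_def f3_def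
    by (auto intro!: square_integrable_mult_bounded[where K=K] sU sG K)
  obtain k :: "nat \<Rightarrow> 'a \<Rightarrow> real" where k: "\<And>n. smooth (k n)" "\<And>n x. k n x \<ge> 0"
    "\<And>n. (\<integral>x. k n x \<partial>lborel) = 1" "\<And>n x. norm x \<ge> 1 / real (Suc n) \<Longrightarrow> k n x = 0"
    using mollifier_exists by blast
  have k0: "k n x = 0" if "norm x > 1" for n x
  proof -
    have "1 / real (Suc n) \<le> 1" by simp
    then show ?thesis using that by (intro k(4)) linarith
  qed
  have Dk0: "?D (k n) x = 0" if "norm x > 1" for n x using frechet_derivative_eq_0[OF k0 that] .
  have ck: "continuous_on UNIV (k n)" and cDk: "continuous_on UNIV (?D (k n))" for n
    using smooth_continuous[OF k(1)] smooth_continuous[OF smooth_frechet_derivative[OF k(1) i]] .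
  have [measurable]: "k n \<in> borel_measurable borel" "?D (k n) \<in> borel_measurable borel" for n
    using borel_measurable_continuous_onI[OF ck] borel_measurable_continuous_onI[OF cDk] .
  have ik: "integrable lborel (k n)" and iDk: "integrable lborel (?D (k n))" for n
    using continuous_compact_support_integrable[OF ck, where R=1] k0
      continuous_compact_support_integrable[OF cDk, where R=1] Dk0 by auto
  have bk: "\<exists>K. \<forall>x. \<bar>k n x\<bar> \<le> K" and bDk: "\<exists>K. \<forall>x. \<bar>?D (k n) x\<bar> \<le> K" for n
    using continuous_compact_support_bounded[OF ck, where R=1, OF k0]
      continuous_compact_support_bounded[OF cDk, where R=1, OF Dk0] by blast+
  have minus: "(\<lambda>y. k n (x - y)) = (\<lambda>y. k n ((-1) *\<^sub>R y + x))" "(\<lambda>x. k n (x - y)) = (\<lambda>x. k n (1 *\<^sub>R x + - y))" for n x y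
    by simp_all
  have smk: "smooth (\<lambda>y. k n (x - y))" "smooth (\<lambda>x. k n (x - y))" for n x y
    unfolding minus by (rule smooth_affine[OF k(1)])+
  have Dmk: "?D (\<lambda>y. k n (x - y)) y = - ?D (k n) (x - y)" "?D (\<lambda>x. k n (x - y)) x = ?D (k n) (x - y)" for n x y
    unfolding minus by (subst frechet_derivative_affine[OF k(1)], simp)+
  have W: "(\<integral>x. u x * ?D \<psi> x \<partial>lborel) = - (\<integral>x. (g x \<bullet> i) * \<psi> x \<partial>lborel)" if "test_function \<psi>" for \<psi>
    using wg that i by (simp add: weak_gradient_def)
  \<comment> \<open>No sign remains: the minus of the weak gradient cancels against the one from
    differentiating \<open>k n (x - y)\<close> in \<open>y\<close>.\<close>
  have 1: "(\<integral>y. u y * ?D (k n) (x - y) \<partial>lborel) = (\<integral>y. (g y \<bullet> i) * k n (x - y) \<partial>lborel)" for n x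
  proof -
    have "test_function (\<lambda>y. k n (x - y))"
    proof (rule smooth_test_function[OF smk(1), of "norm x + 1"])
      fix y :: 'a assume "norm y > norm x + 1"
      then show "k n (x - y) = 0"
        using norm_triangle_ineq3[of x y] by (intro k0) auto
    qed
    from W[OF this] show ?thesis by (simp add: Dmk)
  qed
  have 2: "(\<integral>x. f2 x * ?D (k n) (x - y) \<partial>lborel) =
      - (\<integral>x. f1 x * k n (x - y) \<partial>lborel) - (\<integral>x. f3 x * k n (x - y) \<partial>lborel)" for n y
  proof -
    have m: "(\<lambda>x. k n (x - y)) \<in> borel_measurable borel" "(\<lambda>x. ?D (k n) (x - y)) \<in> borel_measurable borel"
      by measurable
    obtain K3 K4 where K: "\<And>x. \<bar>k n x\<bar> \<le> K3" "\<And>x. \<bar>?D (k n) x\<bar> \<le> K4" using bk bDk by metis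
    have ii: "integrable lborel (\<lambda>x. f1 x * k n (x - y))" "integrable lborel (\<lambda>x. f2 x * ?D (k n) (x - y))"
      by (intro integrable_mult_bounded[OF m(1) K(1)] integrable_mult_bounded[OF m(2) K(2)] f)+
    have "(\<integral>x. f2 x * ?D (k n) (x - y) \<partial>lborel) + (\<integral>x. f1 x * k n (x - y) \<partial>lborel)
       = (\<integral>x. f2 x * ?D (k n) (x - y) + f1 x * k n (x - y) \<partial>lborel)" using ii by simp
    also have "\<dots> = (\<integral>x. u x * ?D (\<lambda>x. \<phi> x * k n (x - y)) x \<partial>lborel)"
      unfolding frechet_derivative_mult[OF sm smk(2)] Dmk f_eq by (simp add: algebra_simps)
    also have "\<dots> = - (\<integral>x. f3 x * k n (x - y) \<partial>lborel)"
      using W[OF test_function_mult[OF \<phi> smk(2)]] by (simp add: f_eq mult.assoc)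
    finally show ?thesis by simp
  qed
  \<comment> \<open>For \<open>x\<close> in the ball of radius \<open>R\<close> the kernel reaches
    only points of \<open>B\<close>, so \<open>U\<close> and \<open>G\<close> may be replaced by the
    untruncated functions, to which the weak gradient applies; for other \<open>x\<close> the factor
    \<open>f2 x\<close> is zero.\<close>
  have A: "conv_pairing (?D (k n)) f2 U = conv_pairing (k n) f2 G" for n
  proof -
    have "conv_pairing (?D (k n)) f2 U = (\<integral>x. (\<integral>y. f2 x * U y * ?D (k n) (x - y) \<partial>lborel) \<partial>lborel)"
      unfolding conv_pairing_def by (rule lborel_pair.integral_fst[OF integrable_conv_pairing[OF sf(2) sU iDk], symmetric])
    also have "\<dots> = (\<integral>x. (\<integral>y. f2 x * G y * k n (x - y) \<partial>lborel) \<partial>lborel)"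
    proof (rule Bochner_Integration.integral_cong[OF refl])
      fix x
      show "(\<integral>y. f2 x * U y * ?D (k n) (x - y) \<partial>lborel) = (\<integral>y. f2 x * G y * k n (x - y) \<partial>lborel)"
      proof (cases "norm x > R")
        case True
        then show ?thesis by (simp add: f2_def R)
      next
        case False
        have "y \<in> B \<or> norm (x - y) > 1" for y
          using False norm_triangle_ineq3[of y x] by (auto simp: B_def norm_minus_commute)
        then have eq: "f2 x * U y * ?D (k n) (x - y) = f2 x * (u y * ?D (k n) (x - y))"
          "f2 x * G y * k n (x - y) = f2 x * ((g y \<bullet> i) * k n (x - y))" for y
          using Dk0[of "x - y" n] k0[of "x - y" n] by (auto simp: U_def G_def indicator_def)
        show ?thesis unfolding eq using 1[of n x] by simp
      qed
    qed
    also have "\<dots> = conv_pairing (k n) f2 G"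
      unfolding conv_pairing_def by (rule lborel_pair.integral_fst[OF integrable_conv_pairing[OF sf(2) sG ik]])
    finally show ?thesis .
  qed
  \<comment> \<open>Here \<open>U y\<close> is a passive factor: integrating over \<open>x\<close>
    first allows the identity \<open>2\<close> to be used for each fixed \<open>y\<close>.\<close>
  have A': "conv_pairing (?D (k n)) f2 U = - conv_pairing (k n) f1 U - conv_pairing (k n) f3 U" for n
  proof -
    have snd: "conv_pairing k f U = (\<integral>y. U y * (\<integral>x. f x * k (x - y) \<partial>lborel) \<partial>lborel)"
      and isnd: "integrable lborel (\<lambda>y. U y * (\<integral>x. f x * k (x - y) \<partial>lborel))"
      if "square_integrable f" "integrable lborel k" for f k
    proof -
      have eq: "(\<integral>x. f x * U y * k (x - y) \<partial>lborel) = U y * (\<integral>x. f x * k (x - y) \<partial>lborel)" for y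
        by (subst integral_mult_right_zero[symmetric]) (simp add: ac_simps)
      show "conv_pairing k f U = (\<integral>y. U y * (\<integral>x. f x * k (x - y) \<partial>lborel) \<partial>lborel)"
        unfolding conv_pairing_def eq[symmetric]
        by (rule lborel_pair.integral_snd[OF integrable_conv_pairing[OF that(1) sU that(2)], symmetric])
      show "integrable lborel (\<lambda>y. U y * (\<integral>x. f x * k (x - y) \<partial>lborel))"
        using lborel_pair.integrable_snd[OF integrable_conv_pairing[OF that(1) sU that(2)]] by (simp add: eq)
    qed
    show ?thesis
      unfolding snd[OF sf(2) iDk] snd[OF sf(1) ik] snd[OF sf(3) ik] 2
      using isnd[OF sf(1) ik] isnd[OF sf(3) ik] by (simp add: right_diff_distrib)
  qed
  \<comment> \<open>Equating the two evaluations removes the derivative of the kernel, which has no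
    limit; all remaining pairings converge.\<close>
  have 0: "conv_pairing (k n) f1 U + conv_pairing (k n) f3 U + conv_pairing (k n) f2 G = 0" for n
    using A[of n] A'[of n] by linarith
  have "(\<lambda>n. conv_pairing (k n) f1 U + conv_pairing (k n) f3 U + conv_pairing (k n) f2 G) \<longlonglongrightarrow>
     (\<integral>x. f1 x * U x \<partial>lborel) + (\<integral>x. f3 x * U x \<partial>lborel) + (\<integral>x. f2 x * G x \<partial>lborel)"
    by (intro tendsto_add conv_pairing_tendsto f sf sU sG ik k)
  then have "(\<integral>x. f1 x * U x \<partial>lborel) + (\<integral>x. f3 x * U x \<partial>lborel) + (\<integral>x. f2 x * G x \<partial>lborel) = 0"
    unfolding 0 by (simp add: LIMSEQ_const_iff)
  moreover have "f1 x * U x = (u x)\<^sup>2 * ?D \<phi> x" "f3 x * U x = u x * (g x \<bullet> i) * \<phi> x"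
    "f2 x * G x = u x * (g x \<bullet> i) * \<phi> x" for x
    using R(1) R(2)[of x] D0[of x]
    by (auto simp: f1_def f2_def f3_def U_def G_def B_def indicator_def power2_eq_square)
  ultimately show ?thesis by simp
qed

section \<open>A radial multiplier\<close>

text \<open>A smooth positive modification of the identity, so that real powers of \<open>s > 1 / n\<close> extend to
  smooth functions on the whole line.\<close>

definition pos_id :: "nat \<Rightarrow> real \<Rightarrow> real" where
  "pos_id n s = smooth_step (2 * real n * s - 1) * s + (1 - smooth_step (2 * real n * s - 1))"

lemma smooth_pos_id: "smooth (pos_id n)"
  unfolding pos_id_def[abs_def]
  by (intro smooth_add smooth_mult smooth_diff smooth_const smooth_id smooth_compose[OF smooth_smooth_step])

lemma pos_id_pos: "n > 0 \<Longrightarrow> pos_id n s > 0"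
proof (cases "2 * real n * s - 1 \<le> 0")
  case True
  then show ?thesis by (simp add: pos_id_def smooth_step_eq_0)
next
  case False
  assume n: "n > 0"
  from False have "2 * real n * s > 0" by linarith
  then have "s > 0" using n by (simp add: zero_less_mult_iff)
  then have "smooth_step (2 * real n * s - 1) * s > 0" using False by (simp add: smooth_step_pos)
  then show ?thesis using smooth_step_le_1[of "2 * real n * s - 1"] by (simp add: pos_id_def)
qed

text \<open>The condition is exactly the range where the cutoff
  \<open>smooth_step (real n * s - 1)\<close> is nonzero. Hence writing \<open>pos_id n s\<close>
  for \<open>s\<close> inside powers never changes a product with that cutoff.\<close>

lemma pos_id_eq: "real n * s - 1 > 0 \<Longrightarrow> pos_id n s = s"
  by (simp add: pos_id_def smooth_step_eq_1)

lemma powr_minus_1: "s > 0 \<Longrightarrow> s powr (p - 1) = s powr p / (s::real)"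
  by (simp add: powr_diff)

text \<open>Here \<open>2 * a + 2\<close> stands for the dimension and \<open>p\<close> for
  \<open>m / 2\<close>. The point of the quantifier order is that \<open>s0\<close> and
  \<open>C\<close> are independent of the inner cutoff \<open>n\<close>, so that the cutoff can be
  removed later. The unperturbed profile \<open>A\<close> alone settles the range up to
  \<open>s0\<close>; beyond it the profile is switched off and a bounded loss is accepted.\<close>

lemma hardy_weight_exists:
  fixes a b p :: real
  assumes a: "a > 0" and b: "b \<ge> 0" and p: "p > 0"
  obtains s0 C where "s0 > 0" "C \<ge> 0"
    "\<And>n. n > 0 \<Longrightarrow> 2 / real n \<le> s0 \<Longrightarrow> \<exists>h h'. smooth h \<and> (\<forall>s. (h has_real_derivative h' s) (at s)) \<and>
      (\<forall>s>2 * s0. h s = 0) \<and>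
      (\<forall>s>0. (2 * a + 2) * h s + 2 * s * h' s - s * (h s)\<^sup>2 / exp (- b * s powr p)
        \<ge> exp (- b * s powr p) * (a\<^sup>2 / s * indicator {2 / real n..s0} s - C))"
proof -
  obtain st' M where st': "\<And>t. (smooth_step has_real_derivative st' t) (at t)" "smooth st'" "\<And>t. st' t \<ge> 0"
    "\<And>t. t \<le> 0 \<Longrightarrow> st' t = 0" "\<And>t. t \<ge> 1 \<Longrightarrow> st' t = 0" "\<And>t. st' t \<le> M" "M > 0"
    using smooth_step_deriv by blast
  \<comment> \<open>With this value the coefficient \<open>2 * p * (k - a * b)\<close> of the linear
    gain is \<open>2 * p\<close>.\<close>
  define k where "k = a * b + 1"
  have k: "k > 0" using a b by (simp add: k_def add_nonneg_pos)
  \<comment> \<open>The positive root of \<open>2 p y - (2 b p k + k^2) y^2\<close>, which is what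
    the uncut expression adds to \<open>a^2\<close> at \<open>y = s powr p\<close>. Up to
    \<open>s0\<close>, the value of \<open>s\<close> with \<open>s powr p = y0\<close>, this
    addition is nonnegative.\<close>
  define y0 where "y0 = 2 * p / (2 * b * p * k + k\<^sup>2)"
  have den: "2 * b * p * k + k\<^sup>2 > 0" using k p b by (simp add: add_nonneg_pos)
  have y0: "y0 > 0" using den p by (simp add: y0_def)
  define s0 where "s0 = y0 powr (1 / p)"
  have s0: "s0 > 0" using y0 by (simp add: s0_def)
  have s0p: "s0 powr p = y0" using y0 p by (simp add: s0_def powr_powr)
  define A where "A s = a + k * s powr p" for s
  define Y where "Y = (2 * s0) powr p"
  define A1 where "A1 = a + k * Y"
  \<comment> \<open>Bounds the loss between \<open>s0\<close> and \<open>2 * s0\<close>: the three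
    summands come from the slope of the outer cutoff, from the derivative of the weight and from the
    squared profile. \<open>Y\<close> bounds \<open>s powr p\<close> and \<open>A1\<close> bounds
    \<open>A s\<close> there.\<close>
  define C1 where "C1 = 4 * M * A1 + 2 * b * p * Y * A1 + A1\<^sup>2"
  have Y: "Y \<ge> 0" by (simp add: Y_def)
  have A1: "A1 > 0" using Y a k by (simp add: A1_def add_pos_nonneg)
  have C1: "C1 \<ge> 0" using A1 Y b p st'(7) by (simp add: C1_def)
  have Apos: "A s > 0" for s using a k by (simp add: A_def add_pos_nonneg)
  define \<rho> where "\<rho> s = exp (- b * s powr p)" for s
  show ?thesis
  \<comment> \<open>The loss \<open>C1\<close> occurs only for \<open>s > s0\<close>, where it is at
    most \<open>C1 / s0 * s\<close>; after multiplication by \<open>\<rho> s / s\<close> this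
    becomes a constant multiple of the weight.\<close>
  proof (rule that[of s0 "C1 / s0"])
    fix n :: nat assume n: "n > 0" "2 / real n \<le> s0"
    \<comment> \<open>\<kappa> rises from 0 to 1 between \<open>1 / n\<close> and
      \<open>2 / n\<close>; \<theta> falls from 1 to 0 between \<open>s0\<close> and
      \<open>2 * s0\<close>.\<close>
    define \<kappa> where "\<kappa> s = smooth_step (real n * s - 1)" for s
    define \<theta> where "\<theta> s = smooth_step (2 - s / s0)" for s
    define \<sigma> where "\<sigma> = pos_id n"
    define h where "h s = \<kappa> s * \<theta> s * (a + k * \<sigma> s powr p) * exp (- b * \<sigma> s powr p) / \<sigma> s" for s
    define \<alpha> where "\<alpha> s = \<kappa> s * \<theta> s * A s" for s
    define \<alpha>' where "\<alpha>' s = (real n * st' (real n * s - 1) * \<theta> s - \<kappa> s * st' (2 - s / s0) / s0) * A s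
      + \<kappa> s * \<theta> s * (k * p * (s powr p / s))" for s
    have \<sigma>_pos: "\<sigma> s > 0" for s using pos_id_pos[OF n(1)] by (simp add: \<sigma>_def)
    have sm\<sigma>: "smooth \<sigma>" by (simp add: \<sigma>_def smooth_pos_id)
    have smh: "smooth h"
      unfolding h_def \<kappa>_def \<theta>_def
      by (intro smooth_add smooth_mult smooth_diff smooth_const smooth_id smooth_compose[OF smooth_smooth_step]
          smooth_compose[OF smooth_exp] smooth_powr smooth_divide sm\<sigma> \<sigma>_pos less_imp_neq[symmetric]) (use s0 \<sigma>_pos in \<open>auto simp: less_imp_neq[symmetric]\<close>)
    have h_eq: "h s = \<alpha> s * \<rho> s / s" if "s > 0" for s
    proof (cases "real n * s - 1 \<le> 0")
      case True
      then show ?thesis by (simp add: h_def \<alpha>_def \<kappa>_def smooth_step_eq_0)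
    next
      case False
      then have "\<sigma> s = s" by (simp add: \<sigma>_def pos_id_eq)
      then show ?thesis by (simp add: h_def \<alpha>_def A_def \<rho>_def)
    qed
    have h0: "h s = 0" if "s > 2 * s0" for s
    proof -
      have "2 - s / s0 \<le> 0" using that s0 by (simp add: field_simps)
      then show ?thesis by (simp add: h_def \<theta>_def smooth_step_eq_0)
    qed
    obtain h' where h': "\<And>s. (h has_real_derivative h' s) (at s)" using smooth_DERIV[OF smh] by blast
    have d\<alpha>: "(\<alpha> has_real_derivative \<alpha>' s) (at s)" if s: "s > 0" for s
    proof -
      have 1: "(\<kappa> has_real_derivative st' (real n * s - 1) * real n) (at s)"
        unfolding \<kappa>_def by (rule DERIV_chain2[OF st'(1)]) (auto intro!: derivative_eq_intros)
      have 2: "(\<theta> has_real_derivative st' (2 - s / s0) * (- 1 / s0)) (at s)"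
        unfolding \<theta>_def by (rule DERIV_chain2[OF st'(1)]) (use s0 in \<open>auto intro!: derivative_eq_intros\<close>)
      have 3: "(A has_real_derivative k * (p * (s powr p / s))) (at s)"
        unfolding A_def using has_real_derivative_powr[OF s, of p] s
        by (auto intro!: derivative_eq_intros simp: powr_minus_1)
      show ?thesis unfolding \<alpha>_def
        by (rule DERIV_cong[OF DERIV_mult[OF DERIV_mult[OF 1 2] 3]]) (simp add: \<alpha>'_def algebra_simps)
    qed
    have d\<rho>: "(\<rho> has_real_derivative (- b * (p * (s powr p / s))) * \<rho> s) (at s)" if s: "s > 0" for s
      unfolding \<rho>_def using has_real_derivative_powr[OF s, of p] s
      by (auto intro!: derivative_eq_intros simp: powr_minus_1)
    have h'_eq: "h' s = (\<alpha>' s * \<rho> s + \<alpha> s * (- b * (p * (s powr p / s)) * \<rho> s)) / s - \<alpha> s * \<rho> s / s\<^sup>2"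
      if s: "s > 0" for s
    proof -
      have ev: "\<forall>\<^sub>F t in nhds s. \<alpha> t * \<rho> t / t = h t"
        by (rule eventually_mono[OF eventually_nhds_in_open[of "{0<..}" s]]) (use s h_eq in auto)
      have "((\<lambda>t. \<alpha> t * \<rho> t / t) has_real_derivative
          ((\<alpha>' s * \<rho> s + \<alpha> s * (- b * (p * (s powr p / s)) * \<rho> s)) / s - \<alpha> s * \<rho> s / s\<^sup>2)) (at s)"
        by (rule DERIV_cong[OF DERIV_divide[OF DERIV_mult[OF d\<alpha>[OF s] d\<rho>[OF s]] DERIV_ident]])
          (use s in \<open>auto simp: field_simps power2_eq_square\<close>)
      then have "(h has_real_derivative
          ((\<alpha>' s * \<rho> s + \<alpha> s * (- b * (p * (s powr p / s)) * \<rho> s)) / s - \<alpha> s * \<rho> s / s\<^sup>2)) (at s)"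
        by (subst (asm) DERIV_cong_ev[OF refl ev refl])
      then show ?thesis using h' DERIV_unique by blast
    qed
    define E where "E s = 2 * a * \<alpha> s + 2 * s * \<alpha>' s - 2 * b * p * s powr p * \<alpha> s - (\<alpha> s)\<^sup>2" for s
    have \<rho>pos: "\<rho> s > 0" for s by (simp add: \<rho>_def)
    have main: "(2 * a + 2) * h s + 2 * s * h' s - s * (h s)\<^sup>2 / \<rho> s = \<rho> s / s * E s" if s: "s > 0" for s
    proof -
      have e1: "s * (h s)\<^sup>2 / \<rho> s = \<rho> s / s * (\<alpha> s)\<^sup>2"
        using s \<rho>pos[of s] by (simp add: h_eq[OF s] power2_eq_square divide_simps)
      have e2: "2 * s * h' s = \<rho> s / s * (2 * s * \<alpha>' s - 2 * b * p * s powr p * \<alpha> s - 2 * \<alpha> s)"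
        using s by (simp add: h'_eq[OF s] field_simps power2_eq_square)
      show ?thesis unfolding e1 e2 E_def unfolding h_eq[OF s] by (simp add: algebra_simps add_divide_distrib diff_divide_distrib)
    qed
    have \<kappa>01: "0 \<le> \<kappa> s" "\<kappa> s \<le> 1" and \<theta>01: "0 \<le> \<theta> s" "\<theta> s \<le> 1" for s
      by (simp_all add: \<kappa>_def \<theta>_def smooth_step_nonneg smooth_step_le_1)
    have E: "E s \<ge> a\<^sup>2 * indicator {2 / real n..s0} s - C1 / s0 * s" if s: "s > 0" for s
    proof (cases "s \<le> s0")
      case True
      define y where "y = s powr p"
      have y: "0 \<le> y" "y \<le> y0" using True s p s0p powr_mono2[of p s s0] by (auto simp: y_def)
      have th: "\<theta> s = 1" "st' (2 - s / s0) = 0"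
        using True s0 by (auto simp: \<theta>_def smooth_step_eq_1 st'(5))
      have al: "\<alpha> s = \<kappa> s * A s" "s * \<alpha>' s = s * (real n * st' (real n * s - 1)) * A s + \<kappa> s * (k * p * y)"
        using s by (simp_all add: \<alpha>_def \<alpha>'_def th y_def algebra_simps)
      have "y * (2 * b * p * k + k\<^sup>2) \<le> 2 * p"
        using y(2) den by (simp add: y0_def pos_le_divide_eq)
      then have "y * (y * (2 * b * p * k + k\<^sup>2)) \<le> y * (2 * p)"
        using y(1) by (rule mult_left_mono)
      moreover have "2 * a * A s + 2 * (k * p * y) - 2 * b * p * y * A s - (A s)\<^sup>2
          = a\<^sup>2 + (y * (2 * p) - y * (y * (2 * b * p * k + k\<^sup>2)))"
        by (simp add: A_def k_def y_def algebra_simps power2_eq_square)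
      ultimately have inner: "a\<^sup>2 \<le> 2 * a * A s + 2 * (k * p * y) - 2 * b * p * y * A s - (A s)\<^sup>2" by linarith
      have "(\<kappa> s)\<^sup>2 * (A s)\<^sup>2 \<le> \<kappa> s * (A s)\<^sup>2"
        using \<kappa>01[of s] by (intro mult_right_mono) (auto simp: power2_eq_square mult_left_le_one_le)
      moreover have "0 \<le> 2 * (s * (real n * st' (real n * s - 1)) * A s)"
        using s st'(3) Apos[of s] by simp
      moreover have "E s = 2 * a * (\<kappa> s * A s) + 2 * (s * \<alpha>' s) - 2 * b * p * y * (\<kappa> s * A s) - (\<kappa> s)\<^sup>2 * (A s)\<^sup>2"
        by (simp add: E_def al(1) y_def power_mult_distrib)
      ultimately have "E s \<ge> \<kappa> s * (2 * a * A s + 2 * (k * p * y) - 2 * b * p * y * A s - (A s)\<^sup>2)"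
        unfolding al(2) by (simp add: algebra_simps)
      moreover have "\<kappa> s * (2 * a * A s + 2 * (k * p * y) - 2 * b * p * y * A s - (A s)\<^sup>2) \<ge> \<kappa> s * a\<^sup>2"
        using \<kappa>01 by (intro mult_left_mono inner)
      moreover have "\<kappa> s * a\<^sup>2 \<ge> a\<^sup>2 * indicator {2 / real n..s0} s"
      proof (cases "2 / real n \<le> s")
        case True
        then have "\<kappa> s = 1" using n by (simp add: \<kappa>_def field_simps smooth_step_eq_1)
        then show ?thesis by (simp add: indicator_def)
      next
        case False
        then show ?thesis using \<kappa>01 by simp
      qed
      moreover have "C1 / s0 * s \<ge> 0" using C1 s0 s by simp
      ultimately show ?thesis by linarith
    next
      case False
      then have ind: "indicator {2 / real n..s0} s = (0::real)" by simp
      have "2 / real n \<le> s" using False n by linarith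
      then have ch: "\<kappa> s = 1" "st' (real n * s - 1) = 0"
        using n by (auto simp: \<kappa>_def field_simps intro!: smooth_step_eq_1 st'(5))
      have "C1 / s0 * s \<ge> C1" using False s0 C1 by (simp add: field_simps mult_left_mono)
      moreover have "E s \<ge> - C1"
      proof (cases "s \<ge> 2 * s0")
        case True
        then have "2 - s / s0 \<le> 0" using s0 by (simp add: field_simps)
        then have "\<theta> s = 0" "st' (2 - s / s0) = 0" by (simp_all add: \<theta>_def smooth_step_eq_0 st'(4))
        then show ?thesis using C1 by (simp add: E_def \<alpha>_def \<alpha>'_def)
      next
        case s2: False
        define y where "y = s powr p"
        have y: "0 \<le> y" "y \<le> Y" using s2 s p powr_mono2[of p s "2 * s0"] by (auto simp: y_def Y_def)
        have AA: "A s \<le> A1" using y k by (simp add: A_def A1_def y_def)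
        have al: "\<alpha> s = \<theta> s * A s" "s * \<alpha>' s = - (s / s0 * st' (2 - s / s0) * A s) + \<theta> s * (k * p * y)"
          unfolding \<alpha>_def \<alpha>'_def ch y_def using s by (simp_all add: algebra_simps)
        have "s / s0 * st' (2 - s / s0) \<le> 2 * M"
          using s2 s0 s st'(3,6) by (intro mult_mono) (auto simp: field_simps)
        then have 1: "s / s0 * st' (2 - s / s0) * A s \<le> 2 * M * A1"
          by (rule mult_mono) (use AA Apos[of s] st'(7) in auto)
        have "y * (\<theta> s * A s) \<le> Y * (1 * A1)"
          using y Y \<theta>01[of s] AA Apos[of s] by (intro mult_mono) auto
        then have "2 * b * p * (y * (\<theta> s * A s)) \<le> 2 * b * p * (Y * (1 * A1))"
          using b p by (intro mult_left_mono) auto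
        then have 2: "2 * b * p * y * (\<theta> s * A s) \<le> 2 * b * p * Y * A1" by (simp add: mult.assoc)
        have "\<theta> s * A s \<le> 1 * A1" using \<theta>01[of s] AA Apos[of s] by (intro mult_mono) auto
        then have 3: "(\<theta> s * A s)\<^sup>2 \<le> A1\<^sup>2" using \<theta>01[of s] Apos[of s] by (intro power_mono) auto
        have 4: "0 \<le> 2 * a * (\<theta> s * A s)" "0 \<le> 2 * (\<theta> s * (k * p * y))"
          using \<theta>01[of s] Apos[of s] a k p y by simp_all
        have "E s = 2 * a * (\<theta> s * A s) + 2 * (s * \<alpha>' s) - 2 * b * p * y * (\<theta> s * A s) - (\<theta> s * A s)\<^sup>2"
          by (simp add: E_def al(1) y_def)
        then have "E s = 2 * a * (\<theta> s * A s) - 2 * (s / s0 * st' (2 - s / s0) * A s)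
            + 2 * (\<theta> s * (k * p * y)) - 2 * b * p * y * (\<theta> s * A s) - (\<theta> s * A s)\<^sup>2"
          unfolding al(2) by (simp only: right_diff_distrib distrib_left)
        moreover have "2 * (s / s0 * st' (2 - s / s0) * A s) \<le> 4 * M * A1" using 1 by simp
        ultimately show ?thesis using 2 3 4 unfolding C1_def by linarith
      qed
      ultimately show ?thesis using ind by simp
    qed
    have "(2 * a + 2) * h s + 2 * s * h' s - s * (h s)\<^sup>2 / \<rho> s
        \<ge> \<rho> s * (a\<^sup>2 / s * indicator {2 / real n..s0} s - C1 / s0)" if s: "s > 0" for s
    proof -
      have "\<rho> s / s * (a\<^sup>2 * indicator {2 / real n..s0} s - C1 / s0 * s) \<le> \<rho> s / s * E s"
        using s \<rho>pos[of s] by (intro mult_left_mono E[OF s]) simp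
      also have "\<rho> s / s * (a\<^sup>2 * indicator {2 / real n..s0} s - C1 / s0 * s)
          = \<rho> s * (a\<^sup>2 / s * indicator {2 / real n..s0} s - C1 / s0)"
        using s by (simp add: field_simps)
      finally show ?thesis unfolding main[OF s] .
    qed
    then show "\<exists>h h'. smooth h \<and> (\<forall>s. (h has_real_derivative h' s) (at s)) \<and>
      (\<forall>s>2 * s0. h s = 0) \<and>
      (\<forall>s>0. (2 * a + 2) * h s + 2 * s * h' s - s * (h s)\<^sup>2 / exp (- b * s powr p)
        \<ge> exp (- b * s powr p) * (a\<^sup>2 / s * indicator {2 / real n..s0} s - C1 / s0))"
      using smh h' h0 unfolding \<rho>_def by blast
  qed (use s0 C1 in auto)
qed

section \<open>Hardy's inequality\<close>

text \<open>A norm above 1 is smaller than its square. The radius \<open>1 + \<bar>S\<bar>\<close>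
  is generous but serves for every real \<open>S\<close>, and converts support conditions in the
  squared norm into conditions in the norm.\<close>

lemma inner_self_gt_of_norm_gt:
  fixes x :: "'a::real_inner"
  assumes "norm x > 1 + \<bar>S\<bar>"
  shows "x \<bullet> x > S"
proof -
  have "1 * \<bar>S\<bar> \<le> norm x * norm x" using assms by (intro mult_mono) auto
  moreover have "norm x * norm x > norm x * 1" using assms by (intro mult_strict_left_mono) auto
  ultimately show ?thesis using assms by (simp add: power2_norm_eq_inner[symmetric] power2_eq_square)
qed

lemma set_integrable_mult_compact_support:
  fixes f q :: "'a::euclidean_space \<Rightarrow> real"
  assumes "set_integrable lborel (cball 0 R) f" "continuous_on UNIV q" "\<And>x. norm x > R \<Longrightarrow> q x = 0"
  shows "integrable lborel (\<lambda>x. f x * q x)"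
proof -
  have "\<exists>K>0. \<forall>x. \<bar>q x\<bar> \<le> K" by (rule continuous_compact_support_bounded[OF assms(2,3)])
  then obtain K where K: "\<And>x. \<bar>q x\<bar> \<le> K" by blast
  have "integrable lborel (\<lambda>x. (indicator (cball 0 R) x * f x) * q x)"
    using assms(1) K borel_measurable_continuous_onI[OF assms(2)]
    by (intro integrable_mult_bounded[where K=K and p="\<lambda>x. indicator (cball 0 R) x * f x"])
      (auto simp: set_integrable_def)
  moreover have "(\<lambda>x. (indicator (cball 0 R) x * f x) * q x) = (\<lambda>x. f x * q x)"
    using assms(3) by (fastforce simp: indicator_def fun_eq_iff)
  ultimately show ?thesis by simp
qed

lemma set_integrable_mult_inner:
  fixes u :: "'a::euclidean_space \<Rightarrow> real" and g :: "'a \<Rightarrow> 'a"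
  assumes [measurable]: "u \<in> borel_measurable borel" "g \<in> borel_measurable borel"
    and u2: "set_integrable lborel (cball 0 R) (\<lambda>x. (u x)\<^sup>2)"
    and g2: "set_integrable lborel (cball 0 R) (\<lambda>x. (norm (g x))\<^sup>2)" and i: "i \<in> Basis"
  shows "set_integrable lborel (cball 0 R) (\<lambda>x. u x * (g x \<bullet> i))"
  unfolding set_integrable_def
proof (rule Bochner_Integration.integrable_bound)
  show "integrable lborel (\<lambda>x. indicator (cball 0 R) x *\<^sub>R (u x)\<^sup>2 + indicator (cball 0 R) x *\<^sub>R (norm (g x))\<^sup>2)"
    using u2 g2 by (simp add: set_integrable_def)
  show "AE x in lborel. norm (indicat_real (cball 0 R) x *\<^sub>R (u x * (g x \<bullet> i)))
      \<le> norm (indicator (cball 0 R) x *\<^sub>R (u x)\<^sup>2 + indicator (cball 0 R) x *\<^sub>R (norm (g x))\<^sup>2)"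
  proof (intro AE_I2)
    fix x
    have "\<bar>u x * (g x \<bullet> i)\<bar> \<le> ((u x)\<^sup>2 + (g x \<bullet> i)\<^sup>2) / 2" using weighted_AM_GM[of 1 "u x" "g x \<bullet> i"] by simp
    moreover have "(g x \<bullet> i)\<^sup>2 \<le> (norm (g x))\<^sup>2"
      using Basis_le_norm[OF i, of "g x"] abs_le_square_iff[of "g x \<bullet> i" "norm (g x)"] by simp
    ultimately have "\<bar>u x * (g x \<bullet> i)\<bar> \<le> ((u x)\<^sup>2 + (norm (g x))\<^sup>2) / 2" by argo
    then have "\<bar>u x * (g x \<bullet> i)\<bar> \<le> (u x)\<^sup>2 + (norm (g x))\<^sup>2" by (rule order_trans) simp
    then show "norm (indicat_real (cball 0 R) x *\<^sub>R (u x * (g x \<bullet> i)))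
      \<le> norm (indicator (cball 0 R) x *\<^sub>R (u x)\<^sup>2 + indicator (cball 0 R) x *\<^sub>R (norm (g x))\<^sup>2)"
      by (simp add: indicator_def)
  qed
  show "(\<lambda>x. indicat_real (cball 0 R) x *\<^sub>R (u x * (g x \<bullet> i))) \<in> borel_measurable lborel"
    using assms(1,2)
    by (intro borel_measurable_scaleR borel_measurable_indicator borel_measurable_times borel_measurable_inner) auto
qed

text \<open>The components of the field \<open>h (x \<bullet> x) x\<close> are test functions, since
  \<open>h\<close> vanishes beyond \<open>S\<close>. Summing \<open>weak_gradient_square\<close>
  over them produces the divergence \<open>N h + 2 s h'\<close> on one side and the radial part of
  \<open>g\<close> on the other.\<close>

lemma
  fixes u :: "'a::euclidean_space \<Rightarrow> real"
  assumes wg: "weak_gradient u g"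
    and um: "u \<in> borel_measurable borel" and gm: "g \<in> borel_measurable borel"
    and u2: "\<And>R. set_integrable lborel (cball 0 R) (\<lambda>x. (u x)\<^sup>2)"
    and g2: "\<And>R. set_integrable lborel (cball 0 R) (\<lambda>x. (norm (g x))\<^sup>2)"
    and h: "smooth h" "\<And>s. (h has_real_derivative h' s) (at s)" "\<And>s. s > S \<Longrightarrow> h s = 0"
  shows integrable_radial_divergence:
      "integrable lborel (\<lambda>x. (u x)\<^sup>2 * (real DIM('a) * h (x \<bullet> x) + 2 * (x \<bullet> x) * h' (x \<bullet> x)))"
    and integrable_radial_gradient: "integrable lborel (\<lambda>x. u x * (g x \<bullet> x) * h (x \<bullet> x))"
    and radial_divergence_identity:
      "(\<integral>x. (u x)\<^sup>2 * (real DIM('a) * h (x \<bullet> x) + 2 * (x \<bullet> x) * h' (x \<bullet> x)) \<partial>lborel)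
        = - 2 * (\<integral>x. u x * (g x \<bullet> x) * h (x \<bullet> x) \<partial>lborel)"
proof -
  define \<phi> where "\<phi> i x = (x \<bullet> i) * h (x \<bullet> x)" for i x :: 'a
  define R where "R = 1 + \<bar>S\<bar>"
  have big: "x \<bullet> x > S" if "norm x > R" for x :: 'a
    using inner_self_gt_of_norm_gt[of S x] that by (simp add: R_def)
  have sm: "smooth (\<phi> i)" for i
    unfolding \<phi>_def by (intro smooth_mult smooth_inner smooth_compose[OF h(1)] smooth_inner_self)
  have 0: "\<phi> i x = 0" if "norm x > R" for i x using h(3)[OF big[OF that]] by (simp add: \<phi>_def)
  have test: "test_function (\<phi> i)" for i by (rule smooth_test_function[OF sm 0])
  have D: "frechet_derivative (\<phi> i) (at x) i = h (x \<bullet> x) + 2 * (x \<bullet> i)\<^sup>2 * h' (x \<bullet> x)" if i: "i \<in> Basis" for i x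
  proof -
    have "((\<lambda>x. h (x \<bullet> x)) has_derivative (\<lambda>d. h' (x \<bullet> x) * (x \<bullet> d + d \<bullet> x))) (at x)"
      by (rule has_derivative_compose[OF _ h(2)[unfolded has_field_derivative_def]])
        (auto intro!: derivative_eq_intros)
    from has_derivative_mult[OF has_derivative_inner_left[OF has_derivative_ident, of i] this]
    have "(\<phi> i has_derivative (\<lambda>d. (x \<bullet> i) * (h' (x \<bullet> x) * (x \<bullet> d + d \<bullet> x)) + (d \<bullet> i) * h (x \<bullet> x))) (at x)"
      by (simp add: \<phi>_def[abs_def])
    then show ?thesis
      using i by (simp add: frechet_derivative_at[symmetric] inner_commute power2_eq_square)
  qed
  have i1: "integrable lborel (\<lambda>x. (u x)\<^sup>2 * frechet_derivative (\<phi> i) (at x) i)" if i: "i \<in> Basis" for i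
    by (rule set_integrable_mult_compact_support[OF u2[of R] smooth_continuous[OF smooth_frechet_derivative[OF sm i]]])
      (rule frechet_derivative_eq_0[OF 0])
  have i2: "integrable lborel (\<lambda>x. u x * (g x \<bullet> i) * \<phi> i x)" if i: "i \<in> Basis" for i
    by (rule set_integrable_mult_compact_support[OF set_integrable_mult_inner[OF um gm u2[of R] g2[of R] i] smooth_continuous[OF sm] 0])
  have s1: "(\<Sum>i\<in>Basis. (u x)\<^sup>2 * frechet_derivative (\<phi> i) (at x) i)
     = (u x)\<^sup>2 * (real DIM('a) * h (x \<bullet> x) + 2 * (x \<bullet> x) * h' (x \<bullet> x))" for x
  proof -
    have "(\<Sum>i\<in>Basis. (x \<bullet> i)\<^sup>2) = x \<bullet> x" by (simp add: power2_eq_square flip: euclidean_inner)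
    then have "(\<Sum>i\<in>Basis. h (x \<bullet> x) + 2 * (x \<bullet> i)\<^sup>2 * h' (x \<bullet> x)) = real DIM('a) * h (x \<bullet> x) + 2 * (x \<bullet> x) * h' (x \<bullet> x)"
      by (simp add: sum.distrib flip: sum_distrib_left sum_distrib_right)
    then show ?thesis by (simp add: D flip: sum_distrib_left)
  qed
  have s2: "(\<Sum>i\<in>Basis. u x * (g x \<bullet> i) * \<phi> i x) = u x * (g x \<bullet> x) * h (x \<bullet> x)" for x
  proof -
    have "(\<Sum>i\<in>Basis. u x * (g x \<bullet> i) * \<phi> i x) = (\<Sum>i\<in>Basis. u x * ((g x \<bullet> i) * (x \<bullet> i)) * h (x \<bullet> x))"
      by (simp add: \<phi>_def mult_ac)
    also have "\<dots> = u x * (\<Sum>i\<in>Basis. (g x \<bullet> i) * (x \<bullet> i)) * h (x \<bullet> x)"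
      by (simp add: sum_distrib_left sum_distrib_right)
    finally show ?thesis by (simp flip: euclidean_inner)
  qed
  show "integrable lborel (\<lambda>x. (u x)\<^sup>2 * (real DIM('a) * h (x \<bullet> x) + 2 * (x \<bullet> x) * h' (x \<bullet> x)))"
    unfolding s1[symmetric] by (intro Bochner_Integration.integrable_sum i1)
  show "integrable lborel (\<lambda>x. u x * (g x \<bullet> x) * h (x \<bullet> x))"
    unfolding s2[symmetric] by (intro Bochner_Integration.integrable_sum i2)
  have "(\<integral>x. (\<Sum>i\<in>Basis. (u x)\<^sup>2 * frechet_derivative (\<phi> i) (at x) i) \<partial>lborel)
      = (\<Sum>i\<in>Basis. (\<integral>x. (u x)\<^sup>2 * frechet_derivative (\<phi> i) (at x) i \<partial>lborel))"
    by (intro Bochner_Integration.integral_sum i1)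
  also have "\<dots> = (\<Sum>i\<in>Basis. - 2 * (\<integral>x. u x * (g x \<bullet> i) * \<phi> i x \<partial>lborel))"
    by (intro sum.cong refl weak_gradient_square[OF wg um gm u2 g2 test])
  also have "\<dots> = - 2 * (\<integral>x. (\<Sum>i\<in>Basis. u x * (g x \<bullet> i) * \<phi> i x) \<partial>lborel)"
    by (subst Bochner_Integration.integral_sum) (auto simp: sum_distrib_left intro: i2)
  finally show "(\<integral>x. (u x)\<^sup>2 * (real DIM('a) * h (x \<bullet> x) + 2 * (x \<bullet> x) * h' (x \<bullet> x)) \<partial>lborel)
        = - 2 * (\<integral>x. u x * (g x \<bullet> x) * h (x \<bullet> x) \<partial>lborel)"
    unfolding s1 s2 .
qed

section \<open>The weight, and the inequality for a single cut-off field\<close>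

lemma norm_powr_eq_inner_powr: "norm x powr m = (x \<bullet> x) powr (m / 2)"
  by (cases "x = 0") (simp_all add: powr_powr powr_half_sqrt norm_eq_sqrt_inner flip: powr_half_sqrt)

lemma nn_integral_weighted_measure:
  assumes "f \<in> borel_measurable borel" "\<And>x. f x \<ge> 0"
  shows "(\<integral>\<^sup>+x. ennreal (f x) \<partial>weighted_measure b m)
    = (\<integral>\<^sup>+x. ennreal (exp (- b * norm x powr m) * f x) \<partial>lborel)"
  unfolding weighted_measure_def using assms
  by (subst nn_integral_density) (auto simp: ennreal_mult)

lemma integrable_weighted_measure_iff:
  fixes f :: "'a::euclidean_space \<Rightarrow> real"
  assumes "f \<in> borel_measurable borel"
  shows "integrable (weighted_measure b m) f \<longleftrightarrow> integrable lborel (\<lambda>x. exp (- b * norm x powr m) * f x)"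
  unfolding weighted_measure_def using assms
  by (subst integrable_density) auto

text \<open>The lower bound makes the weighted measure comparable with Lebesgue measure on balls, so
  weighted square integrability gives the local square integrability required for
  \<open>weak_gradient_square\<close>. The upper bound serves the trial functions.\<close>

lemma weight_bounds:
  fixes x :: "'a::euclidean_space"
  assumes "b \<ge> 0" "m > 0"
  shows "exp (- b * norm x powr m) \<le> 1" "norm x \<le> R \<Longrightarrow> exp (- b * norm x powr m) \<ge> exp (- b * R powr m)"
  using assms powr_mono2[of m "norm x" R] by (auto intro!: mult_left_mono)

text \<open>The yield of one admissible \<open>h\<close>. All quantities are Bochner integrals, so
  each part must be shown integrable before the integrals are split: the truncated quotient because
  \<open>1 / s\<close> is at most \<open>n / 2\<close> on the shell, the terms with \<open>h\<close>
  because of its bounded support.\<close>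

lemma hardy_truncated:
  fixes u :: "'a::euclidean_space \<Rightarrow> real" and b m :: real
  defines "a \<equiv> (real DIM('a) - 2) / 2" and "\<rho> \<equiv> \<lambda>x. exp (- b * norm x powr m)"
  assumes m: "m > 0" and b: "b \<ge> 0" 
    and wg: "weak_gradient u g" and um: "u \<in> borel_measurable borel" and gm: "g \<in> borel_measurable borel"
    and ui: "integrable lborel (\<lambda>x. \<rho> x * (u x)\<^sup>2)" and gi: "integrable lborel (\<lambda>x. \<rho> x * (norm (g x))\<^sup>2)"
    and h: "smooth h" "\<And>s. (h has_real_derivative h' s) (at s)" "\<And>s. s > S \<Longrightarrow> h s = 0"
    and n: "n > 0"
    and hbound: "\<And>s. s > 0 \<Longrightarrow> (2 * a + 2) * h s + 2 * s * h' s - s * (h s)\<^sup>2 / exp (- b * s powr (m / 2))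
        \<ge> exp (- b * s powr (m / 2)) * (a\<^sup>2 / s * indicator {2 / real n..s0} s - C)"
  shows "integrable lborel (\<lambda>x. \<rho> x * (u x)\<^sup>2 * (1 / (x \<bullet> x) * indicator {2 / real n..s0} (x \<bullet> x)))"
    and "a\<^sup>2 * (\<integral>x. \<rho> x * (u x)\<^sup>2 * (1 / (x \<bullet> x) * indicator {2 / real n..s0} (x \<bullet> x)) \<partial>lborel)
      \<le> (\<integral>x. \<rho> x * (norm (g x))\<^sup>2 \<partial>lborel) + C * (\<integral>x. \<rho> x * (u x)\<^sup>2 \<partial>lborel)"
proof -
  have \<rho>pos: "\<rho> x > 0" for x by (simp add: \<rho>_def)
  have \<rho>_eq: "\<rho> x = exp (- b * (x \<bullet> x) powr (m / 2))" for x by (simp add: \<rho>_def norm_powr_eq_inner_powr)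
  have \<rho>m[measurable]: "\<rho> \<in> borel_measurable borel" unfolding \<rho>_def by measurable
  note [measurable] = um gm
  \<comment> \<open>On a ball the weight is at least its value at the boundary, so dividing by that
    value dominates the unweighted function.\<close>
  have loc: "set_integrable lborel (cball 0 R) f" 
    if "integrable lborel (\<lambda>x. \<rho> x * f x)" "f \<in> borel_measurable borel" for f :: "'a \<Rightarrow> real" and R
    unfolding set_integrable_def
  proof (rule Bochner_Integration.integrable_bound[OF integrable_mult_right[OF that(1), of "1 / exp (- b * R powr m)"]])
    show "AE x in lborel. norm (indicat_real (cball 0 R) x *\<^sub>R f x) \<le> norm (1 / exp (- b * R powr m) * (\<rho> x * f x))"
    proof (intro AE_I2)
      fix x :: 'a
      have "\<bar>f x\<bar> * exp (- b * R powr m) \<le> \<bar>f x\<bar> * \<rho> x" if "norm x \<le> R"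
        using weight_bounds(2)[OF b m that] by (intro mult_left_mono) (auto simp: \<rho>_def)
      then show "norm (indicat_real (cball 0 R) x *\<^sub>R f x) \<le> norm (1 / exp (- b * R powr m) * (\<rho> x * f x))"
        using \<rho>pos[of x] by (auto simp: indicator_def abs_mult field_simps)
    qed
    show "(\<lambda>x. indicat_real (cball 0 R) x *\<^sub>R f x) \<in> borel_measurable lborel" 
      using that(2) by (intro borel_measurable_scaleR borel_measurable_indicator) auto
  qed
  have u2: "set_integrable lborel (cball 0 R) (\<lambda>x. (u x)\<^sup>2)" for R using ui by (intro loc) auto
  have g2: "set_integrable lborel (cball 0 R) (\<lambda>x. (norm (g x))\<^sup>2)" for R using gi by (intro loc) auto
  have N: "2 * a + 2 = real DIM('a)" by (simp add: a_def field_simps)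
  let ?s = "\<lambda>x::'a. x \<bullet> x"
  let ?I = "\<lambda>x::'a. indicator {2 / real n..s0} (?s x) :: real"
  show iI: "integrable lborel (\<lambda>x. \<rho> x * (u x)\<^sup>2 * (1 / ?s x * ?I x))"
  proof (rule Bochner_Integration.integrable_bound[OF integrable_mult_right[OF ui, of "real n / 2"]])
    show "AE x in lborel. norm (\<rho> x * (u x)\<^sup>2 * (1 / ?s x * ?I x)) \<le> norm (real n / 2 * (\<rho> x * (u x)\<^sup>2))"
    proof (intro AE_I2)
      fix x :: 'a
      have "1 / ?s x * ?I x \<le> real n / 2"
      proof (cases "2 / real n \<le> ?s x")
        case True
        moreover from this have "?s x > 0" using n by (meson divide_pos_pos less_le_trans of_nat_0_less_iff zero_less_numeral)
        ultimately have "1 / ?s x \<le> 1 / (2 / real n)" using n by (intro divide_left_mono) auto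
        then show ?thesis by (simp add: indicator_def)
      qed simp
      then have "\<rho> x * (u x)\<^sup>2 * (1 / ?s x * ?I x) \<le> \<rho> x * (u x)\<^sup>2 * (real n / 2)"
        using \<rho>pos[of x] by (intro mult_left_mono) auto
      moreover have "0 \<le> \<rho> x * (u x)\<^sup>2 * (1 / ?s x * ?I x)" using \<rho>pos[of x] by simp
      ultimately show "norm (\<rho> x * (u x)\<^sup>2 * (1 / ?s x * ?I x)) \<le> norm (real n / 2 * (\<rho> x * (u x)\<^sup>2))"
        unfolding real_norm_def mult.commute[of "real n / 2"] by (simp only: abs_of_nonneg)
    qed
  qed measurable
  have d1: "integrable lborel (\<lambda>x. (u x)\<^sup>2 * (real DIM('a) * h (?s x) + 2 * ?s x * h' (?s x)))"
    by (rule integrable_radial_divergence[OF wg um gm u2 g2 h(1,2)]) (rule h(3))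
  have d2: "integrable lborel (\<lambda>x. u x * (g x \<bullet> x) * h (?s x))"
    by (rule integrable_radial_gradient[OF wg um gm u2 g2 h(1,2)]) (rule h(3))
  have d3: "(\<integral>x. (u x)\<^sup>2 * (real DIM('a) * h (?s x) + 2 * ?s x * h' (?s x)) \<partial>lborel)
        = - 2 * (\<integral>x. u x * (g x \<bullet> x) * h (?s x) \<partial>lborel)"
    by (rule radial_divergence_identity[OF wg um gm u2 g2 h(1,2)]) (rule h(3))
  have i3: "integrable lborel (\<lambda>x. (u x)\<^sup>2 * (?s x * (h (?s x))\<^sup>2 / \<rho> x))"
  proof (rule set_integrable_mult_compact_support[OF u2[of "1 + \<bar>S\<bar>"]])
    show "continuous_on UNIV (\<lambda>x. ?s x * (h (?s x))\<^sup>2 / \<rho> x)"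
      unfolding \<rho>_def using m by (intro continuous_intros continuous_on_powr' continuous_on_compose2[OF smooth_continuous[OF h(1), of UNIV]]) auto
    show "?s x * (h (?s x))\<^sup>2 / \<rho> x = 0" if "norm x > 1 + \<bar>S\<bar>" for x
      using h(3)[OF inner_self_gt_of_norm_gt[OF that]] by simp
  qed
  \<comment> \<open>The coefficient \<open>h / \<rho>\<close> is chosen so that, after
    multiplication by \<rho>, the cross term is free of the weight and coincides with the integrand
    of the divergence identity.\<close>
  have sq: "- 2 * (u x * (g x \<bullet> x) * h (?s x)) - (u x)\<^sup>2 * (?s x * (h (?s x))\<^sup>2 / \<rho> x) \<le> \<rho> x * (norm (g x))\<^sup>2" for x
  proof -
    have "0 \<le> \<rho> x * (norm (g x + (h (?s x) / \<rho> x * u x) *\<^sub>R x))\<^sup>2" using \<rho>pos[of x] by simp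
    also have "\<dots> = \<rho> x * ((norm (g x))\<^sup>2 + 2 * (h (?s x) / \<rho> x * u x) * (g x \<bullet> x) + (h (?s x) / \<rho> x * u x)\<^sup>2 * ?s x)"
    proof -
      have "(norm (y + t *\<^sub>R x))\<^sup>2 = (norm y)\<^sup>2 + 2 * t * (y \<bullet> x) + t\<^sup>2 * (x \<bullet> x)" for y and t :: real
        unfolding power2_norm_eq_inner
        by (simp add: inner_add_left inner_add_right inner_commute[of x y] power2_eq_square algebra_simps)
      then show ?thesis by simp
    qed
    also have "\<dots> = \<rho> x * (norm (g x))\<^sup>2 + 2 * (u x * (g x \<bullet> x) * h (?s x)) + (u x)\<^sup>2 * (?s x * (h (?s x))\<^sup>2 / \<rho> x)"
      using \<rho>pos[of x] by (simp add: field_simps power2_eq_square)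
    finally show ?thesis by simp
  qed
  have "a\<^sup>2 * (\<integral>x. \<rho> x * (u x)\<^sup>2 * (1 / ?s x * ?I x) \<partial>lborel) - C * (\<integral>x. \<rho> x * (u x)\<^sup>2 \<partial>lborel)
    = (\<integral>x. a\<^sup>2 * (\<rho> x * (u x)\<^sup>2 * (1 / ?s x * ?I x)) - C * (\<rho> x * (u x)\<^sup>2) \<partial>lborel)"
    using Bochner_Integration.integral_diff[OF integrable_mult_right[OF iI, of "a\<^sup>2"] integrable_mult_right[OF ui, of C]]
    by (simp only: integral_mult_right_zero)
  also have "\<dots> \<le> (\<integral>x. (u x)\<^sup>2 * (real DIM('a) * h (?s x) + 2 * ?s x * h' (?s x)) - (u x)\<^sup>2 * (?s x * (h (?s x))\<^sup>2 / \<rho> x) \<partial>lborel)"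
  proof (rule integral_mono_AE)
    show "AE x in lborel. a\<^sup>2 * (\<rho> x * (u x)\<^sup>2 * (1 / ?s x * ?I x)) - C * (\<rho> x * (u x)\<^sup>2)
      \<le> (u x)\<^sup>2 * (real DIM('a) * h (?s x) + 2 * ?s x * h' (?s x)) - (u x)\<^sup>2 * (?s x * (h (?s x))\<^sup>2 / \<rho> x)"
      using AE_lborel_singleton[of "0::'a"]
    proof eventually_elim
      case (elim x)
      have "(u x)\<^sup>2 * (\<rho> x * (a\<^sup>2 / ?s x * ?I x - C)) \<le> (u x)\<^sup>2 * (real DIM('a) * h (?s x) + 2 * ?s x * h' (?s x) - ?s x * (h (?s x))\<^sup>2 / \<rho> x)"
        using hbound[of "?s x"] elim unfolding \<rho>_eq N by (intro mult_left_mono) auto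
      then show ?case by (simp add: algebra_simps)
    qed
  qed (intro Bochner_Integration.integrable_diff integrable_mult_right iI ui i3 d1)+
  also have "\<dots> = (\<integral>x. - 2 * (u x * (g x \<bullet> x) * h (?s x)) - (u x)\<^sup>2 * (?s x * (h (?s x))\<^sup>2 / \<rho> x) \<partial>lborel)"
    unfolding Bochner_Integration.integral_diff[OF d1 i3] d3
      Bochner_Integration.integral_diff[OF integrable_mult_right[OF d2] i3] integral_mult_right_zero ..
  also have "\<dots> \<le> (\<integral>x. \<rho> x * (norm (g x))\<^sup>2 \<partial>lborel)"
    by (rule integral_mono[OF _ gi sq]) (intro Bochner_Integration.integrable_diff integrable_mult_right d2 i3)
  finally show "a\<^sup>2 * (\<integral>x. \<rho> x * (u x)\<^sup>2 * (1 / ?s x * ?I x) \<partial>lborel)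
      \<le> (\<integral>x. \<rho> x * (norm (g x))\<^sup>2 \<partial>lborel) + C * (\<integral>x. \<rho> x * (u x)\<^sup>2 \<partial>lborel)" by simp
qed

text \<open>The weak gradient in \<open>hardy_inequality\<close> is an arbitrary one, so its
  measurability has to be extracted from local integrability: it is the pointwise limit of its
  restrictions to growing balls.\<close>

lemma locally_integrable_borel_measurable:
  fixes f :: "'a::euclidean_space \<Rightarrow> 'b::{banach, second_countable_topology}"
  assumes "locally_integrable f"
  shows "f \<in> borel_measurable borel"
proof (rule borel_measurable_LIMSEQ_metric)
  show "(\<lambda>x. indicat_real (cball 0 (real n)) x *\<^sub>R f x) \<in> borel_measurable borel" for n
  proof -
    have "integrable lborel (\<lambda>x. indicat_real (cball 0 (real n)) x *\<^sub>R f x)"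
      using assms compact_cball[of "0::'a" "real n"] unfolding locally_integrable_def set_integrable_def by blast
    from borel_measurable_integrable[OF this] show ?thesis by simp
  qed
  show "(\<lambda>n. indicat_real (cball 0 (real n)) x *\<^sub>R f x) \<longlonglongrightarrow> f x" for x
  proof (rule tendsto_eventually)
    obtain N where "norm x \<le> real N" using real_arch_simple by blast
    then show "\<forall>\<^sub>F n in sequentially. indicat_real (cball 0 (real n)) x *\<^sub>R f x = f x"
      by (intro eventually_sequentiallyI[of N]) (auto simp: indicator_def)
  qed
qed

text \<open>The constant is \<open>C + a^2 / s0\<close>: the first part is the loss from the cut-off
  fields, the second bounds \<open>a^2 / |x|^2\<close> outside the ball of squared radius
  \<open>s0\<close>. Inside the ball the truncated inequalities are passed to the limit by monotone
  convergence, which also yields finiteness of the left-hand side.\<close>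

lemma hardy_inequality_weighted:
  fixes b m :: real
  assumes N: "DIM('a::euclidean_space) \<ge> 3" and m: "m > 0" and b: "b \<ge> 0"
  shows "\<exists>C>0. hardy_inequality (weighted_measure b m :: 'a measure) (((real DIM('a) - 2) / 2)\<^sup>2) C"
proof -
  define a where "a = (real DIM('a) - 2) / 2"
  have a: "a > 0" using N by (simp add: a_def)
  obtain s0 C where s0: "s0 > 0" and C: "C \<ge> 0" and W:
    "\<And>n. n > 0 \<Longrightarrow> 2 / real n \<le> s0 \<Longrightarrow> \<exists>h h'. smooth h \<and> (\<forall>s. (h has_real_derivative h' s) (at s)) \<and>
      (\<forall>s>2 * s0. h s = 0) \<and>
      (\<forall>s>0. (2 * a + 2) * h s + 2 * s * h' s - s * (h s)\<^sup>2 / exp (- b * s powr (m / 2))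
        \<ge> exp (- b * s powr (m / 2)) * (a\<^sup>2 / s * indicator {2 / real n..s0} s - C))"
    by (rule hardy_weight_exists[OF a b half_gt_zero[OF m]]) (rule that)
  define \<rho> where "\<rho> x = exp (- b * norm x powr m)" for x :: 'a
  have \<rho>pos: "\<rho> x > 0" for x by (simp add: \<rho>_def)
  have \<rho>m[measurable]: "\<rho> \<in> borel_measurable borel" unfolding \<rho>_def by measurable
  have "hardy_inequality (weighted_measure b m :: 'a measure) (a\<^sup>2) (C + a\<^sup>2 / s0)"
    unfolding hardy_inequality_def
  proof (intro ballI allI impI)
    fix u :: "'a \<Rightarrow> real" and g :: "'a \<Rightarrow> 'a"
    assume u: "u \<in> H1 (weighted_measure b m)" and wg: "weak_gradient u g"
    let ?\<mu> = "weighted_measure b m :: 'a measure"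
    have nnw: "(\<integral>\<^sup>+x. ennreal (f x) \<partial>?\<mu>) = (\<integral>\<^sup>+x. ennreal (\<rho> x * f x) \<partial>lborel)"
      if "f \<in> borel_measurable borel" "\<And>x. f x \<ge> 0" for f
      using nn_integral_weighted_measure[OF that] by (simp only: \<rho>_def)
    have gm[measurable]: "g \<in> borel_measurable borel"
      using wg by (intro locally_integrable_borel_measurable) (simp add: weak_gradient_def)
    have um[measurable]: "u \<in> borel_measurable borel"
      using u by (simp add: H1_def L2_def weighted_measure_def)
    have ui: "integrable lborel (\<lambda>x. \<rho> x * (u x)\<^sup>2)"
      using u by (simp add: H1_def L2_def integrable_weighted_measure_iff \<rho>_def)
    show "ennreal (a\<^sup>2) * (\<integral>\<^sup>+x. ennreal ((u x)\<^sup>2 / (norm x)\<^sup>2) \<partial>?\<mu>)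
       \<le> (\<integral>\<^sup>+x. ennreal ((norm (g x))\<^sup>2) \<partial>?\<mu>) + ennreal (C + a\<^sup>2 / s0) * (\<integral>\<^sup>+x. ennreal ((u x)\<^sup>2) \<partial>?\<mu>)"
    \<comment> \<open>\<open>g\<close> is any weak gradient of \<open>u\<close>, not the one whose
      square integrability \<open>H1\<close> provides. If its weighted energy is infinite, so is the
      right-hand side.\<close>
    proof (cases "integrable lborel (\<lambda>x. \<rho> x * (norm (g x))\<^sup>2)")
      case False
      have "(\<integral>\<^sup>+x. ennreal (\<rho> x * (norm (g x))\<^sup>2) \<partial>lborel) = \<infinity>"
      proof (rule ccontr)
        assume "(\<integral>\<^sup>+x. ennreal (\<rho> x * (norm (g x))\<^sup>2) \<partial>lborel) \<noteq> \<infinity>"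
        then have "integrable lborel (\<lambda>x. \<rho> x * (norm (g x))\<^sup>2)"
          using \<rho>pos by (intro integrableI_nonneg) (auto simp: less_top less_imp_le intro!: AE_I2)
        then show False using False by simp
      qed
      then have "(\<integral>\<^sup>+x. ennreal ((norm (g x))\<^sup>2) \<partial>?\<mu>) = \<infinity>" by (subst nnw) auto
      then show ?thesis by simp
    next
      case gi: True
      define K where "K = (\<integral>x. \<rho> x * (norm (g x))\<^sup>2 \<partial>lborel) + C * (\<integral>x. \<rho> x * (u x)\<^sup>2 \<partial>lborel)"
      obtain n0 where n0: "n0 > 0" "2 / real n0 \<le> s0"
        using reals_Archimedean3[OF s0] ex_less_of_nat_mult[OF s0, of 2] s0
        by (metis divide_le_eq less_eq_real_def mult.commute mult_zero_left not_gr0 of_nat_0 of_nat_0_less_iff order.asym zero_less_numeral)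
      \<comment> \<open>Starting the shells at \<open>n0\<close> ensures that
        \<open>2 / real (n0 + n) \<le> s0\<close>, so an admissible weight exists for every
        index.\<close>
      define F where "F n x = a\<^sup>2 * (\<rho> x * (u x)\<^sup>2 * (1 / (x \<bullet> x) * indicator {2 / real (n0 + n)..s0} (x \<bullet> x)))" for n x
      have F0: "F n x \<ge> 0" for n x using \<rho>pos[of x] by (simp add: F_def)
      have FK: "(\<integral>\<^sup>+x. ennreal (F n x) \<partial>lborel) \<le> ennreal K" for n
      proof -
        have n: "n0 + n > 0" using n0 by simp
        have "2 / real (n0 + n) \<le> 2 / real n0" using n0 by (intro divide_left_mono) auto
        then have n': "2 / real (n0 + n) \<le> s0" using n0 by linarith
        obtain h h' where h: "smooth h" "\<And>s. (h has_real_derivative h' s) (at s)" "\<And>s. s > 2 * s0 \<Longrightarrow> h s = 0"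
          "\<And>s. s > 0 \<Longrightarrow> (2 * a + 2) * h s + 2 * s * h' s - s * (h s)\<^sup>2 / exp (- b * s powr (m / 2))
        \<ge> exp (- b * s powr (m / 2)) * (a\<^sup>2 / s * indicator {2 / real (n0 + n)..s0} s - C)"
          using W[OF n n'] by blast
        note T = hardy_truncated[OF m b wg um gm ui[unfolded \<rho>_def] gi[unfolded \<rho>_def] h(1,2) _ n, of "2 * s0" s0 C, folded a_def, folded \<rho>_def]
        have T1: "integrable lborel (\<lambda>x. \<rho> x * (u x)\<^sup>2 * (1 / (x \<bullet> x) * indicator {2 / real (n0 + n)..s0} (x \<bullet> x)))"
          by (rule T(1); fact h)
        have T2: "a\<^sup>2 * (\<integral>x. \<rho> x * (u x)\<^sup>2 * (1 / (x \<bullet> x) * indicator {2 / real (n0 + n)..s0} (x \<bullet> x)) \<partial>lborel) \<le> K"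
          unfolding K_def by (rule T(2); fact h)
        have "integrable lborel (F n)" unfolding F_def by (intro integrable_mult_right T1)
        then have "(\<integral>\<^sup>+x. ennreal (F n x) \<partial>lborel) = ennreal (\<integral>x. F n x \<partial>lborel)"
          using F0 by (intro nn_integral_eq_integral AE_I2) auto
        also have "(\<integral>x. F n x \<partial>lborel) \<le> K" using T2 unfolding F_def integral_mult_right_zero .
        finally show ?thesis by (simp add: ennreal_leI)
      qed
      have Fm: "F n \<in> borel_measurable borel" for n unfolding F_def[abs_def] by measurable
      have incF: "incseq (\<lambda>n x. ennreal (F n x))"
      proof (intro incseq_SucI le_funI ennreal_leI)
        fix n and x :: 'a
        have "2 / real (n0 + Suc n) \<le> 2 / real (n0 + n)" using n0 by (intro divide_left_mono) auto
        then have "indicator {2 / real (n0 + n)..s0} (x \<bullet> x) \<le> (indicator {2 / real (n0 + Suc n)..s0} (x \<bullet> x) :: real)"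
          by (auto simp: indicator_def)
        then show "F n x \<le> F (Suc n) x"
          using \<rho>pos[of x] unfolding F_def by (intro mult_left_mono) auto
      qed
      \<comment> \<open>Within squared radius \<open>s0\<close> every nonzero point eventually lies
        in the shells, so the supremum attains the full integrand; beyond it the second summand
        alone suffices. At the origin the quotient is 0 by the convention for division.\<close>
      have pw: "ennreal (\<rho> x * (a\<^sup>2 * ((u x)\<^sup>2 / (norm x)\<^sup>2))) \<le> (SUP n. ennreal (F n x)) + ennreal (a\<^sup>2 / s0 * (\<rho> x * (u x)\<^sup>2))" for x
      proof (cases "x = 0")
        case False
        then have s: "x \<bullet> x > 0" by simp
        have nx: "(norm x)\<^sup>2 = x \<bullet> x" by (rule power2_norm_eq_inner)
        show ?thesis
        proof (cases "x \<bullet> x \<le> s0")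
          case True
          obtain n where n: "real n * (x \<bullet> x) > 2" using reals_Archimedean3[OF s] by blast
          then have "n > 0" by (cases n) auto
          moreover from this have "2 / real n \<le> x \<bullet> x" using n by (simp add: pos_divide_le_eq mult.commute)
          moreover from \<open>n > 0\<close> have "2 / real (n0 + n) \<le> 2 / real n" by (intro divide_left_mono) auto
          ultimately have "F n x = \<rho> x * (a\<^sup>2 * ((u x)\<^sup>2 / (norm x)\<^sup>2))"
            using True by (simp add: F_def nx)
          then have "ennreal (\<rho> x * (a\<^sup>2 * ((u x)\<^sup>2 / (norm x)\<^sup>2))) \<le> (SUP n. ennreal (F n x))"
            by (intro SUP_upper2[of n]) auto
          then show ?thesis by (rule order_trans) simp
        next
          case False
          have "\<rho> x * (a\<^sup>2 * ((u x)\<^sup>2 / (x \<bullet> x))) \<le> \<rho> x * (a\<^sup>2 * ((u x)\<^sup>2 / s0))"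
            using False s0 \<rho>pos[of x] s by (intro mult_left_mono divide_left_mono) auto
          then have "\<rho> x * (a\<^sup>2 * ((u x)\<^sup>2 / (norm x)\<^sup>2)) \<le> a\<^sup>2 / s0 * (\<rho> x * (u x)\<^sup>2)"
            unfolding nx by (simp add: mult_ac)
          then have "ennreal (\<rho> x * (a\<^sup>2 * ((u x)\<^sup>2 / (norm x)\<^sup>2))) \<le> ennreal (a\<^sup>2 / s0 * (\<rho> x * (u x)\<^sup>2))"
            by (rule ennreal_leI)
          then show ?thesis by (rule order_trans) simp
        qed
      qed simp
      have "ennreal (a\<^sup>2) * (\<integral>\<^sup>+x. ennreal ((u x)\<^sup>2 / (norm x)\<^sup>2) \<partial>?\<mu>)
        = (\<integral>\<^sup>+x. ennreal (\<rho> x * (a\<^sup>2 * ((u x)\<^sup>2 / (norm x)\<^sup>2))) \<partial>lborel)"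
      proof -
        have "ennreal (a\<^sup>2) * (\<integral>\<^sup>+x. ennreal ((u x)\<^sup>2 / (norm x)\<^sup>2) \<partial>?\<mu>)
          = (\<integral>\<^sup>+x. ennreal (a\<^sup>2) * ennreal (\<rho> x * ((u x)\<^sup>2 / (norm x)\<^sup>2)) \<partial>lborel)"
          by (subst nnw) (auto intro!: nn_integral_cmult[symmetric])
        then show ?thesis
          using \<rho>pos by (simp add: ennreal_mult'[symmetric] mult.left_commute less_imp_le)
      qed
      also have "\<dots> \<le> (\<integral>\<^sup>+x. (SUP n. ennreal (F n x)) + ennreal (a\<^sup>2 / s0 * (\<rho> x * (u x)\<^sup>2)) \<partial>lborel)"
        by (intro nn_integral_mono pw)
      also have "\<dots> = (\<integral>\<^sup>+x. (SUP n. ennreal (F n x)) \<partial>lborel) + (\<integral>\<^sup>+x. ennreal (a\<^sup>2 / s0 * (\<rho> x * (u x)\<^sup>2)) \<partial>lborel)"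
        using Fm by (intro nn_integral_add) auto
      also have "(\<integral>\<^sup>+x. (SUP n. ennreal (F n x)) \<partial>lborel) = (SUP n. (\<integral>\<^sup>+x. ennreal (F n x) \<partial>lborel))"
        using Fm incF by (intro nn_integral_monotone_convergence_SUP) auto
      also have "\<dots> \<le> ennreal K" by (intro SUP_least FK)
      also have "(\<integral>\<^sup>+x. ennreal (a\<^sup>2 / s0 * (\<rho> x * (u x)\<^sup>2)) \<partial>lborel) = ennreal (\<integral>x. a\<^sup>2 / s0 * (\<rho> x * (u x)\<^sup>2) \<partial>lborel)"
        using ui s0 \<rho>pos by (intro nn_integral_eq_integral) (auto simp: less_imp_le intro!: AE_I2)
      also have "ennreal K + ennreal (\<integral>x. a\<^sup>2 / s0 * (\<rho> x * (u x)\<^sup>2) \<partial>lborel)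
        = ennreal (\<integral>x. \<rho> x * (norm (g x))\<^sup>2 \<partial>lborel) + ennreal (C + a\<^sup>2 / s0) * ennreal (\<integral>x. \<rho> x * (u x)\<^sup>2 \<partial>lborel)"
      proof -
        have p: "0 \<le> (\<integral>x. \<rho> x * (norm (g x))\<^sup>2 \<partial>lborel)" "0 \<le> (\<integral>x. \<rho> x * (u x)\<^sup>2 \<partial>lborel)"
          using \<rho>pos by (auto simp: less_imp_le intro!: integral_nonneg)
        have "ennreal K + ennreal (\<integral>x. a\<^sup>2 / s0 * (\<rho> x * (u x)\<^sup>2) \<partial>lborel) = ennreal (K + a\<^sup>2 / s0 * (\<integral>x. \<rho> x * (u x)\<^sup>2 \<partial>lborel))"
          using p C s0 by (subst ennreal_plus) (auto simp: K_def)
        also have "K + a\<^sup>2 / s0 * (\<integral>x. \<rho> x * (u x)\<^sup>2 \<partial>lborel)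
          = (\<integral>x. \<rho> x * (norm (g x))\<^sup>2 \<partial>lborel) + (C + a\<^sup>2 / s0) * (\<integral>x. \<rho> x * (u x)\<^sup>2 \<partial>lborel)"
          by (simp add: K_def distrib_right)
        finally show ?thesis using p C s0 by (simp add: ennreal_plus ennreal_mult)
      qed
      also have "ennreal (\<integral>x. \<rho> x * (norm (g x))\<^sup>2 \<partial>lborel) = (\<integral>\<^sup>+x. ennreal ((norm (g x))\<^sup>2) \<partial>?\<mu>)"
        using gi \<rho>pos by (subst nnw) (auto simp: less_imp_le intro!: nn_integral_eq_integral[symmetric] AE_I2)
      also have "ennreal (\<integral>x. \<rho> x * (u x)\<^sup>2 \<partial>lborel) = (\<integral>\<^sup>+x. ennreal ((u x)\<^sup>2) \<partial>?\<mu>)"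
        using ui \<rho>pos by (subst nnw) (auto simp: less_imp_le intro!: nn_integral_eq_integral[symmetric] AE_I2)
      finally show ?thesis by (simp add: add_right_mono)
    qed
  qed
  then show ?thesis using C s0 a unfolding a_def[symmetric]
    by (intro exI[of _ "C + a\<^sup>2 / s0"]) (auto intro: add_nonneg_pos)
qed

section \<open>Optimality of the constant\<close>

lemma grad_radial:
  fixes x :: "'a::euclidean_space"
  assumes "(H has_real_derivative H') (at (x \<bullet> x))"
  shows "grad (\<lambda>x. H (x \<bullet> x)) x = (2 * H') *\<^sub>R x"
proof -
  have "((\<lambda>x. H (x \<bullet> x)) has_derivative (\<lambda>d. H' * (x \<bullet> d + d \<bullet> x))) (at x)"
    by (rule has_derivative_compose[where f="\<lambda>x. x \<bullet> x" and g=H, OF _ assms[unfolded has_field_derivative_def]])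
      (auto intro!: derivative_eq_intros)
  then have "frechet_derivative (\<lambda>x. H (x \<bullet> x)) (at x) i = 2 * H' * (x \<bullet> i)" for i
    by (simp add: frechet_derivative_at[symmetric] inner_commute)
  then have "grad (\<lambda>x. H (x \<bullet> x)) x = (\<Sum>i\<in>Basis. (2 * H') *\<^sub>R ((x \<bullet> i) *\<^sub>R i))"
    by (simp add: grad_def)
  also have "\<dots> = (2 * H') *\<^sub>R x"
    by (simp only: scaleR_sum_right[symmetric] euclidean_representation)
  finally show ?thesis .
qed

lemma test_function_radial:
  assumes "smooth H" "\<And>s. s > S \<Longrightarrow> H s = 0"
  shows "test_function (\<lambda>x::'a::euclidean_space. H (x \<bullet> x))"
proof (rule smooth_test_function)
  show "smooth (\<lambda>x::'a. H (x \<bullet> x))" by (intro smooth_compose[OF assms(1)] smooth_inner_self)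
  show "H (x \<bullet> x) = 0" if "norm x > 1 + \<bar>S\<bar>" for x :: 'a
    using inner_self_gt_of_norm_gt[OF that] by (rule assms(2))
qed

lemma continuous_weight: "m > 0 \<Longrightarrow> continuous_on UNIV (\<lambda>x::'a::euclidean_space. exp (- b * norm x powr m))"
  by (intro continuous_intros continuous_on_powr') auto

lemma test_function_H1:
  fixes u :: "'a::euclidean_space \<Rightarrow> real"
  assumes u: "test_function u" and m: "m > 0"
  shows "u \<in> H1 (weighted_measure b m)"
    and "integrable lborel (\<lambda>x. exp (- b * norm x powr m) * (u x)\<^sup>2)"
    and "integrable lborel (\<lambda>x. exp (- b * norm x powr m) * (norm (grad u x))\<^sup>2)"
proof -
  note sm = test_function_smooth[OF u]
  obtain R where R: "\<And>x. norm x > R \<Longrightarrow> u x = 0" using test_function_support[OF u] by blast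
  have R': "grad u x = 0" if "norm x > R" for x
    unfolding grad_def by (rule sum.neutral) (simp add: frechet_derivative_eq_0[OF R that])
  show iu: "integrable lborel (\<lambda>x. exp (- b * norm x powr m) * (u x)\<^sup>2)"
    by (rule continuous_compact_support_integrable[where R=R],
      intro continuous_on_mult continuous_weight[OF m] continuous_on_power smooth_continuous[OF sm], simp add: R)
  show ig: "integrable lborel (\<lambda>x. exp (- b * norm x powr m) * (norm (grad u x))\<^sup>2)"
    by (rule continuous_compact_support_integrable[where R=R],
      intro continuous_on_mult continuous_weight[OF m] continuous_on_power continuous_on_norm continuous_grad[OF sm],
      simp add: R')
  have um: "u \<in> borel_measurable borel" by (rule borel_measurable_continuous_onI[OF smooth_continuous[OF sm]])
  have gm: "grad u \<in> borel_measurable borel" by (rule borel_measurable_continuous_onI[OF continuous_grad[OF sm]])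
  have meas: "measurable (weighted_measure b m) borel = (measurable borel borel :: ('a \<Rightarrow> 'b::topological_space) set)"
    by (intro measurable_cong_sets) (auto simp: weighted_measure_def)
  have "u \<in> L2 (weighted_measure b m)"
    unfolding L2_def using um iu by (auto simp: meas integrable_weighted_measure_iff)
  moreover have "grad u \<in> L2 (weighted_measure b m)"
  proof -
    have "integrable (weighted_measure b m) (\<lambda>x. (norm (grad u x))\<^sup>2)"
      using ig gm by (subst integrable_weighted_measure_iff) auto
    then show ?thesis using gm by (simp add: L2_def meas)
  qed
  ultimately show "u \<in> H1 (weighted_measure b m)"
    using weak_gradient_test_function[OF u] by (auto simp: H1_def)
qed

text \<open>Scale invariance: on the shell the integrand is at most \<open>r powr (- N / 2)\<close>,
  and the ball containing the shell has volume proportional to \<open>(2 * r) powr (N / 2)\<close>.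
  The radius cancels, so layers shrinking to the origin cost no more than fixed ones.\<close>

lemma shell_integral_bound:
  fixes r :: real
  assumes r: "r > 0"
  defines "W \<equiv> \<lambda>x::'a::euclidean_space. (x \<bullet> x) powr (- real DIM('a) / 2) * indicator {r..2 * r} (x \<bullet> x)"
  shows "integrable lborel W" "(\<integral>x. W x \<partial>lborel) \<le> unit_ball_vol DIM('a) * 2 powr (real DIM('a) / 2)"
proof -
  define R where "R = sqrt (2 * r)"
  have R: "R > 0" using r by (simp add: R_def)
  have [measurable]: "W \<in> borel_measurable borel" unfolding W_def by measurable
  let ?c = "r powr (- real DIM('a) / 2)"
  have le: "W x \<le> ?c * indicator (cball 0 R) x" for x
  proof (cases "x \<bullet> x \<in> {r..2 * r}")
    case True
    have "norm x \<le> R" using True by (simp add: R_def norm_eq_sqrt_inner)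
    moreover have "(x \<bullet> x) powr (- real DIM('a) / 2) \<le> ?c" using True r by (intro powr_mono2') auto
    ultimately show ?thesis using True by (simp add: W_def)
  qed (simp add: W_def)
  have W0: "W x \<ge> 0" for x by (simp add: W_def)
  have iB: "integrable lborel (\<lambda>x::'a. ?c * indicator (cball 0 R) x)"
    using emeasure_lborel_cball_finite[of "0::'a" R] by auto
  show iW: "integrable lborel W"
    by (rule Bochner_Integration.integrable_bound[OF iB]) (use le W0 in \<open>auto intro!: AE_I2 simp: order_trans[OF _ abs_ge_self]\<close>)
  have "(\<integral>x. W x \<partial>lborel) \<le> (\<integral>x. ?c * indicator (cball (0::'a) R) x \<partial>lborel)"
    by (intro integral_mono iW iB le)
  also have "\<dots> = ?c * (unit_ball_vol DIM('a) * R ^ DIM('a))"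
    using content_cball[of R "0::'a"] R by simp
  also have "R ^ DIM('a) = (2 * r) powr (real DIM('a) / 2)"
    using r R by (simp add: R_def powr_half_sqrt[symmetric] powr_powr flip: powr_realpow)
  also have "?c * (unit_ball_vol DIM('a) * (2 * r) powr (real DIM('a) / 2)) = unit_ball_vol DIM('a) * 2 powr (real DIM('a) / 2)"
    using r by (simp add: powr_mult powr_minus field_simps)
  finally show "(\<integral>x. W x \<partial>lborel) \<le> unit_ball_vol DIM('a) * 2 powr (real DIM('a) / 2)" .
qed

text \<open>If the function were integrable, its integrals over balls shrinking to the origin would
  tend to zero by dominated convergence. But on the ball of squared radius \<open>t\<close> it is at
  least \<open>t powr (- N / 2)\<close> off the origin, and the factor \<open>t\<close> cancels
  against the volume, so each such integral is at least the volume of the unit ball.\<close>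

lemma not_integrable_inverse_power:
  fixes r :: real
  assumes r: "r > 0"
  shows "\<not> integrable lborel (\<lambda>x::'a::euclidean_space. (x \<bullet> x) powr (- real DIM('a) / 2) * indicator {..r} (x \<bullet> x))"
proof
  let ?w = "\<lambda>x::'a. (x \<bullet> x) powr (- real DIM('a) / 2) * indicator {..r} (x \<bullet> x)"
  assume i: "integrable lborel ?w"
  define F where "F k x = ?w x * indicator {..r / real (Suc k)} (x \<bullet> x)" for k and x :: 'a
  have "(\<lambda>k. \<integral>x. F k x \<partial>lborel) \<longlonglongrightarrow> (\<integral>x. 0 \<partial>(lborel :: 'a measure))"
  proof (rule integral_dominated_convergence[OF _ _ i])
    show "F k \<in> borel_measurable lborel" for k unfolding F_def[abs_def] by measurable
    show "AE x in lborel. norm (F k x) \<le> ?w x" for k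
      by (auto simp: F_def indicator_def)
    show "AE x in lborel. (\<lambda>k. F k x) \<longlonglongrightarrow> 0"
      using AE_lborel_singleton[of "0::'a"]
    proof eventually_elim
      case (elim x)
      then have s: "x \<bullet> x > 0" by simp
      obtain k0 where k0: "real k0 * (x \<bullet> x) > r" using reals_Archimedean3[OF s] by blast
      show ?case
      proof (rule tendsto_eventually, rule eventually_sequentiallyI[of k0])
        fix k assume "k0 \<le> k"
        then have "real k0 * (x \<bullet> x) \<le> real (Suc k) * (x \<bullet> x)" using s by (intro mult_right_mono) auto
        then have "r < real (Suc k) * (x \<bullet> x)" using k0 by linarith
        then have "\<not> x \<bullet> x \<le> r / real (Suc k)" by (simp add: pos_le_divide_eq mult.commute)
        then show "F k x = 0" by (simp add: F_def)
      qed
    qed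
  qed simp_all
  then have lim: "(\<lambda>k. \<integral>x. F k x \<partial>lborel) \<longlonglongrightarrow> 0" by simp
  have "unit_ball_vol DIM('a) \<le> (\<integral>x. F k x \<partial>lborel)" for k
  proof -
    define t where "t = r / real (Suc k)"
    have t: "0 < t" "t \<le> r" using r by (simp_all add: t_def divide_le_eq mult_left_mono)
    let ?c = "t powr (- real DIM('a) / 2)"
    have tt: "sqrt t ^ DIM('a) = t powr (real DIM('a) / 2)"
      using t by (simp add: powr_half_sqrt[symmetric] powr_powr flip: powr_realpow)
    have "unit_ball_vol DIM('a) = ?c * (unit_ball_vol DIM('a) * sqrt t ^ DIM('a))"
      unfolding tt using t by (simp add: powr_minus)
    also have "\<dots> = (\<integral>x. ?c * indicator (cball (0::'a) (sqrt t)) x \<partial>lborel)"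
      using content_cball[of "sqrt t" "0::'a"] t by simp
    also have "\<dots> \<le> (\<integral>x. F k x \<partial>lborel)"
    proof (rule integral_mono_AE)
      show "integrable lborel (\<lambda>x::'a. ?c * indicator (cball 0 (sqrt t)) x)"
        using emeasure_lborel_cball_finite[of "0::'a" "sqrt t"] by auto
      show "integrable lborel (F k)"
        by (rule Bochner_Integration.integrable_bound[OF i]) (auto simp: F_def[abs_def] indicator_def)
      show "AE x in lborel. ?c * indicator (cball 0 (sqrt t)) x \<le> F k x"
        using AE_lborel_singleton[of "0::'a"]
      proof eventually_elim
        case (elim x)
        then have s: "x \<bullet> x > 0" by simp
        show ?case
        proof (cases "x \<in> cball 0 (sqrt t)")
          case True
          then have xt: "x \<bullet> x \<le> t" by (simp add: norm_eq_sqrt_inner)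
          have "?c \<le> (x \<bullet> x) powr (- real DIM('a) / 2)" using xt s by (intro powr_mono2') auto
          moreover have "x \<bullet> x \<le> r / real (Suc k)" "x \<bullet> x \<le> r" using xt t by (simp_all add: t_def)
          ultimately show ?thesis using True by (simp add: F_def)
        qed (simp add: F_def)
      qed
    qed
    finally show ?thesis .
  qed
  from LIMSEQ_le_const[OF lim] this have "unit_ball_vol DIM('a) \<le> 0" by blast
  then show False using unit_ball_vol_pos[OF of_nat_0_le_iff, of "DIM('a)"] by linarith
qed

text \<open>For \<open>u x = H (x \<bullet> x)\<close> the squared gradient is
  \<open>4 s H'^2\<close>, and \<open>s powr (- a / 2)\<close> is \<open>|x|^-a\<close>. Writing
  \<open>H\<close> as this power times a cutoff \<open>v\<close> gives
  \<open>4 s H'^2 = s powr (- a - 1) (2 s v' - a v)^2\<close>: apart from the term with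
  \<open>a^2\<close>, everything contains \<open>s v'\<close>, which lives on the two layers. That
  \<open>B\<close> does not depend on \<open>n\<close> is essential.\<close>

lemma minimizing_profile:
  fixes a s1 :: real
  assumes a: "a > 0" and s1: "s1 > 0"
  obtains B where "B \<ge> 0" "\<And>n. n > 0 \<Longrightarrow> 2 / real n \<le> s1 / 2 \<Longrightarrow> \<exists>H H'. smooth H \<and>
    (\<forall>s. (H has_real_derivative H' s) (at s)) \<and> (\<forall>s\<ge>s1. H s = 0) \<and> (\<forall>s\<le>1 / real n. H s = 0) \<and>
    (\<forall>s\<in>{2 / real n..s1 / 2}. (H s)\<^sup>2 / s = s powr (- a - 1)) \<and>
    (\<forall>s>0. 4 * s * (H' s)\<^sup>2 \<le> a\<^sup>2 * ((H s)\<^sup>2 / s)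
      + B * (s powr (- a - 1) * indicator {1 / real n..2 / real n} s + s powr (- a - 1) * indicator {s1 / 2..s1} s))"
proof -
  obtain st' M where st': "\<And>t. (smooth_step has_real_derivative st' t) (at t)" "smooth st'" "\<And>t. st' t \<ge> 0"
    "\<And>t. t \<le> 0 \<Longrightarrow> st' t = 0" "\<And>t. t \<ge> 1 \<Longrightarrow> st' t = 0" "\<And>t. st' t \<le> M" "M > 0"
    using smooth_step_deriv by blast
  show ?thesis
  \<comment> \<open>From \<open>0 \<le> v \<le> 1\<close> and the bound \<open>2 * M\<close> for
    \<open>\<bar>s * v' s\<bar>\<close>: the square contributes \<open>16 M^2\<close>, the mixed
    term \<open>8 a M\<close>.\<close>
  proof (rule that[of "8 * a * M + 16 * M\<^sup>2"])
    show "8 * a * M + 16 * M\<^sup>2 \<ge> 0" using a st'(7) by simp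
    fix n :: nat assume n: "n > 0" "2 / real n \<le> s1 / 2"
    define \<kappa> where "\<kappa> s = smooth_step (real n * s - 1)" for s
    define \<theta> where "\<theta> s = smooth_step (2 - 2 * s / s1)" for s
    define v where "v s = \<kappa> s * \<theta> s" for s
    define v' where "v' s = real n * st' (real n * s - 1) * \<theta> s - \<kappa> s * (2 / s1 * st' (2 - 2 * s / s1))" for s
    define \<sigma> where "\<sigma> = pos_id n"
    define H where "H s = \<sigma> s powr (- a / 2) * v s" for s
    have \<sigma>_pos: "\<sigma> s > 0" for s using pos_id_pos[OF n(1)] by (simp add: \<sigma>_def)
    have sm\<sigma>: "smooth \<sigma>" by (simp add: \<sigma>_def smooth_pos_id)
    have smH: "smooth H"
      unfolding H_def v_def \<kappa>_def \<theta>_def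
      by (intro smooth_mult smooth_diff smooth_const smooth_id smooth_compose[OF smooth_smooth_step]
          smooth_powr smooth_divide sm\<sigma> \<sigma>_pos) (use s1 in auto)
    have v0: "v s = 0" if "s \<ge> s1 \<or> s \<le> 1 / real n" for s
    proof -
      have "2 - 2 * s / s1 \<le> 0 \<or> real n * s - 1 \<le> 0" using that s1 n by (auto simp: field_simps)
      then show ?thesis by (auto simp: v_def \<kappa>_def \<theta>_def smooth_step_eq_0)
    qed
    have H_eq: "H s = s powr (- a / 2) * v s" for s
    proof (cases "s \<le> 1 / real n")
      case True
      then show ?thesis by (simp add: H_def v0)
    next
      case False
      then have "real n * s - 1 > 0" using n by (simp add: field_simps)
      then have "\<sigma> s = s" by (simp add: \<sigma>_def pos_id_eq)
      then show ?thesis by (simp add: H_def)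
    qed
    obtain H' where H': "\<And>s. (H has_real_derivative H' s) (at s)" using smooth_DERIV[OF smH] by blast
    have Hsq: "(H s)\<^sup>2 / s = s powr (- a - 1) * (v s)\<^sup>2" if s: "s > 0" for s
    proof -
      have "(s powr (- a / 2))\<^sup>2 = s powr (- a)" by (simp add: power2_eq_square flip: powr_add)
      then show ?thesis using s by (simp add: H_eq power_mult_distrib powr_diff)
    qed
    have dv: "(v has_real_derivative v' s) (at s)" for s
    proof -
      have 1: "(\<kappa> has_real_derivative st' (real n * s - 1) * real n) (at s)"
        unfolding \<kappa>_def by (rule DERIV_chain2[OF st'(1)]) (auto intro!: derivative_eq_intros)
      have 2: "(\<theta> has_real_derivative st' (2 - 2 * s / s1) * (- 2 / s1)) (at s)"
        unfolding \<theta>_def by (rule DERIV_chain2[OF st'(1)]) (use s1 in \<open>auto intro!: derivative_eq_intros\<close>)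
      show ?thesis unfolding v_def
        by (rule DERIV_cong[OF DERIV_mult[OF 1 2]]) (simp add: v'_def algebra_simps)
    qed
    have H'_eq: "H' s = s powr (- a / 2) * (v' s - a / 2 * v s / s)" if s: "s > 0" for s
    proof -
      have "((\<lambda>s. s powr (- a / 2) * v s) has_real_derivative
          (- a / 2 * s powr (- a / 2 - 1)) * v s + v' s * s powr (- a / 2)) (at s)"
        by (rule DERIV_mult[OF has_real_derivative_powr[OF s] dv])
      then have "(H has_real_derivative (- a / 2 * s powr (- a / 2 - 1)) * v s + v' s * s powr (- a / 2)) (at s)"
        by (simp add: H_eq[abs_def])
      from DERIV_unique[OF H' this] show ?thesis
        using s by (simp add: powr_minus_1 algebra_simps)
    qed
    have v01: "0 \<le> v s" "v s \<le> 1" for s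
      by (auto simp: v_def \<kappa>_def \<theta>_def smooth_step_nonneg smooth_step_le_1 mult_le_one)
    have \<kappa>01: "0 \<le> \<kappa> s" "\<kappa> s \<le> 1" and \<theta>01: "0 \<le> \<theta> s" "\<theta> s \<le> 1" for s
      by (simp_all add: \<kappa>_def \<theta>_def smooth_step_nonneg smooth_step_le_1)
    have layers: "\<bar>s * v' s\<bar> \<le> 2 * M" "s \<notin> {1 / real n..2 / real n} \<Longrightarrow> s \<notin> {s1 / 2..s1} \<Longrightarrow> v' s = 0"
      if s: "s > 0" for s
    proof -
      have A: "st' (real n * s - 1) = 0" if "s \<notin> {1 / real n..2 / real n}"
      proof -
        have "real n * s - 1 \<le> 0 \<or> real n * s - 1 \<ge> 1" using that n by (auto simp: field_simps)
        then show ?thesis using st'(4,5) by blast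
      qed
      \<comment> \<open>The left endpoint may be excluded because the derivative of the step already
        vanishes there. This matters when the layers touch, at
        \<open>2 / n = s1 / 2\<close>.\<close>
      have B: "st' (2 - 2 * s / s1) = 0" if "s \<notin> {s1 / 2<..s1}"
      proof -
        have "2 - 2 * s / s1 \<le> 0 \<or> 2 - 2 * s / s1 \<ge> 1" using that s1 by (auto simp: field_simps)
        then show ?thesis using st'(4,5) by blast
      qed
      show "v' s = 0" if "s \<notin> {1 / real n..2 / real n}" "s \<notin> {s1 / 2..s1}"
        using A that B by (simp add: v'_def)
      \<comment> \<open>Each cutoff varies between a radius parameter and its double, with slope at
        most \<open>M\<close> divided by the left end; multiplied by \<open>s\<close> this is at
        most \<open>2 * M\<close>, whatever \<open>n\<close> is.\<close>
      show "\<bar>s * v' s\<bar> \<le> 2 * M"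
      proof (cases "s \<le> 2 / real n")
        case True
        then have "st' (2 - 2 * s / s1) = 0" using n by (intro B) auto
        then have "\<bar>s * v' s\<bar> = (real n * s) * (st' (real n * s - 1) * \<theta> s)"
          using s st'(3) \<theta>01[of s] by (simp add: v'_def abs_mult mult_ac)
        also have "\<dots> \<le> 2 * (M * 1)"
          using True n s st'(3,6,7) \<theta>01[of s] by (intro mult_mono) (auto simp: field_simps)
        finally show ?thesis by simp
      next
        case False
        show ?thesis
        proof (cases "s \<le> s1")
          case True
          have "\<bar>s * v' s\<bar> = (s * (2 / s1)) * (st' (2 - 2 * s / s1) * \<kappa> s)"
            using A False s s1 st'(3) \<kappa>01[of s] by (simp add: v'_def abs_mult mult_ac)
          also have "\<dots> \<le> 2 * (M * 1)"
            using True s1 s st'(3,6,7) \<kappa>01[of s] by (intro mult_mono) (auto simp: field_simps)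
          finally show ?thesis by simp
        next
          case s: False
          then show ?thesis using A B False st'(7) by (simp add: v'_def)
        qed
      qed
    qed
    have main: "4 * s * (H' s)\<^sup>2 \<le> a\<^sup>2 * ((H s)\<^sup>2 / s)
      + (8 * a * M + 16 * M\<^sup>2) * (s powr (- a - 1) * indicator {1 / real n..2 / real n} s + s powr (- a - 1) * indicator {s1 / 2..s1} s)"
      if s: "s > 0" for s
    proof -
      let ?I = "indicator {1 / real n..2 / real n} s + indicator {s1 / 2..s1} s :: real"
      have "(s powr (- a / 2))\<^sup>2 = s powr (- a)" by (simp add: power2_eq_square flip: powr_add)
      then have "4 * s * (H' s)\<^sup>2 = s powr (- a - 1) * (2 * (s * v' s) - a * v s)\<^sup>2"
        using s by (simp add: H'_eq power_mult_distrib powr_diff) (simp add: field_simps power2_eq_square)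
      also have "\<dots> = s powr (- a - 1) * (a\<^sup>2 * (v s)\<^sup>2 + (4 * (s * v' s)\<^sup>2 - 4 * a * (v s * (s * v' s))))"
        by (simp add: power2_eq_square algebra_simps)
      also have "\<dots> \<le> s powr (- a - 1) * (a\<^sup>2 * (v s)\<^sup>2 + (8 * a * M + 16 * M\<^sup>2) * ?I)"
      proof (intro mult_left_mono add_left_mono)
        show "4 * (s * v' s)\<^sup>2 - 4 * a * (v s * (s * v' s)) \<le> (8 * a * M + 16 * M\<^sup>2) * ?I"
        proof (cases "s \<in> {1 / real n..2 / real n} \<or> s \<in> {s1 / 2..s1}")
          case False
          then show ?thesis using layers(2)[OF s] by simp
        next
          case True
          then have I: "?I \<ge> 1" by (auto simp: indicator_def)
          have P: "(s * v' s)\<^sup>2 \<le> 4 * M\<^sup>2" using layers(1)[OF s] st'(7) abs_le_square_iff[of "s * v' s" "2 * M"] by simp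
          have "\<bar>v s * (s * v' s)\<bar> \<le> 1 * (2 * M)"
            unfolding abs_mult[of "v s"] using layers(1)[OF s] v01[of s] by (intro mult_mono) auto
          then have "- (v s * (s * v' s)) \<le> 2 * M" by linarith
          then have "4 * a * (- (v s * (s * v' s))) \<le> 4 * a * (2 * M)" using a by (intro mult_left_mono) auto
          then have "- (4 * a * (v s * (s * v' s))) \<le> 8 * a * M"
            by simp
          with P have "4 * (s * v' s)\<^sup>2 - 4 * a * (v s * (s * v' s)) \<le> 8 * a * M + 16 * M\<^sup>2"
            by linarith
          also have "\<dots> \<le> (8 * a * M + 16 * M\<^sup>2) * ?I"
            using mult_left_mono[OF I, of "8 * a * M + 16 * M\<^sup>2"] a st'(7) by simp
          finally show ?thesis .
        qed
      qed simp
      finally show ?thesis unfolding Hsq[OF s] by (simp add: algebra_simps)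
    qed
    have v1: "v s = 1" if "s \<in> {2 / real n..s1 / 2}" for s
    proof -
      have "1 \<le> real n * s - 1" "1 \<le> 2 - 2 * s / s1" using that n s1 by (auto simp: field_simps)
      then show ?thesis by (simp add: v_def \<kappa>_def \<theta>_def smooth_step_eq_1)
    qed
    have "(H s)\<^sup>2 / s = s powr (- a - 1)" if "s \<in> {2 / real n..s1 / 2}" for s
    proof -
      have "s \<ge> 2 / real n" "2 / real n > 0" using that n by auto
      then have "s > 0" by linarith
      then show ?thesis by (simp add: Hsq v1[OF that])
    qed
    moreover have "H s = 0" if "s \<ge> s1 \<or> s \<le> 1 / real n" for s using v0[OF that] by (simp add: H_eq)
    ultimately show "\<exists>H H'. smooth H \<and>
    (\<forall>s. (H has_real_derivative H' s) (at s)) \<and> (\<forall>s\<ge>s1. H s = 0) \<and> (\<forall>s\<le>1 / real n. H s = 0) \<and>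
    (\<forall>s\<in>{2 / real n..s1 / 2}. (H s)\<^sup>2 / s = s powr (- a - 1)) \<and>
    (\<forall>s>0. 4 * s * (H' s)\<^sup>2 \<le> a\<^sup>2 * ((H s)\<^sup>2 / s)
      + (8 * a * M + 16 * M\<^sup>2) * (s powr (- a - 1) * indicator {1 / real n..2 / real n} s + s powr (- a - 1) * indicator {s1 / 2..s1} s))"
      using smH H' main by (intro exI[of _ H] exI[of _ H']) auto
  qed
qed

text \<open>With \<open>J\<close>, \<open>G\<close>, \<open>U\<close> the weighted integrals of
  \<open>u^2 / |x|^2\<close>, of the squared gradient and of \<open>u^2\<close>, the supposed
  inequality gives \<open>c J \<le> G + C' U\<close>, while the trial functions satisfy
  \<open>G \<le> a^2 J + K0\<close> and \<open>U \<le> s1 J\<close>. If \<open>c\<close> exceeds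
  \<open>a^2\<close>, this bounds \<open>J\<close> uniformly in \<open>n\<close>, against the
  divergence of the integral of \<open>|x|^-N\<close> at the origin.\<close>

lemma hardy_constant_optimal:
  fixes b m c C :: real
  assumes N: "DIM('a::euclidean_space) \<ge> 3" and m: "m > 0" and b: "b \<ge> 0"
    and c: "c > ((real DIM('a) - 2) / 2)\<^sup>2"
  shows "\<not> hardy_inequality (weighted_measure b m :: 'a measure) c C"
proof
  let ?\<mu> = "weighted_measure b m :: 'a measure"
  assume hardy: "hardy_inequality ?\<mu> c C"
  define a where "a = (real DIM('a) - 2) / 2"
  have a: "a > 0" using N by (simp add: a_def)
  have a1: "- a - 1 = - real DIM('a) / 2" by (simp add: a_def field_simps)
  define \<rho> where "\<rho> x = exp (- b * norm x powr m)" for x :: 'a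
  have \<rho>pos: "\<rho> x > 0" and \<rho>1: "\<rho> x \<le> 1" for x
    using weight_bounds(1)[OF b m, of x] by (simp_all add: \<rho>_def)
  have \<rho>m[measurable]: "\<rho> \<in> borel_measurable borel" unfolding \<rho>_def by measurable
  have nnw: "(\<integral>\<^sup>+x. ennreal (f x) \<partial>?\<mu>) = ennreal (\<integral>x. \<rho> x * f x \<partial>lborel)"
    if "f \<in> borel_measurable borel" "\<And>x. f x \<ge> 0" "integrable lborel (\<lambda>x. \<rho> x * f x)" for f
  proof -
    have "(\<integral>\<^sup>+x. ennreal (f x) \<partial>?\<mu>) = (\<integral>\<^sup>+x. ennreal (\<rho> x * f x) \<partial>lborel)"
      using nn_integral_weighted_measure[OF that(1,2)] by (simp only: \<rho>_def)
    also have "\<dots> = ennreal (\<integral>x. \<rho> x * f x \<partial>lborel)"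
      using that \<rho>pos by (intro nn_integral_eq_integral AE_I2) (auto simp: less_imp_le)
    finally show ?thesis .
  qed
  define \<kappa> where "\<kappa> = c - a\<^sup>2"
  have \<kappa>: "\<kappa> > 0" using c by (simp add: \<kappa>_def a_def)
  \<comment> \<open>A negative \<open>C\<close> acts as 0 after the conversion to
    \<open>ennreal\<close>.\<close>
  define C' where "C' = max C 0"
  have C': "C' \<ge> 0" "ennreal C = ennreal C'" by (auto simp: C'_def max_def ennreal_neg)
  \<comment> \<open>Small enough that \<open>C' * s1\<close> uses up at most half of the surplus
    \<kappa>; the summand 1 covers \<open>C' = 0\<close>.\<close>
  define s1 where "s1 = \<kappa> / (2 * (C' + 1))"
  have s1: "s1 > 0" using \<kappa> C' by (simp add: s1_def)
  have Cs1: "C' * s1 \<le> \<kappa> / 2" using \<kappa> C' by (simp add: s1_def field_simps)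
  obtain B where B: "B \<ge> 0" and prof: "\<And>n. n > 0 \<Longrightarrow> 2 / real n \<le> s1 / 2 \<Longrightarrow> \<exists>H H'. smooth H \<and>
    (\<forall>s. (H has_real_derivative H' s) (at s)) \<and> (\<forall>s\<ge>s1. H s = 0) \<and> (\<forall>s\<le>1 / real n. H s = 0) \<and>
    (\<forall>s\<in>{2 / real n..s1 / 2}. (H s)\<^sup>2 / s = s powr (- a - 1)) \<and>
    (\<forall>s>0. 4 * s * (H' s)\<^sup>2 \<le> a\<^sup>2 * ((H s)\<^sup>2 / s)
      + B * (s powr (- a - 1) * indicator {1 / real n..2 / real n} s + s powr (- a - 1) * indicator {s1 / 2..s1} s))"
    using minimizing_profile[OF a s1] by blast
  define K0 where "K0 = B * (2 * (unit_ball_vol DIM('a) * 2 powr (real DIM('a) / 2)))"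
  \<comment> \<open>A lower bound of the weight on the ball of squared radius \<open>s1\<close>,
    which contains the supports of all trial functions.\<close>
  define \<rho>0 where "\<rho>0 = exp (- b * sqrt s1 powr m)"
  have \<rho>0: "\<rho>0 > 0" by (simp add: \<rho>0_def)
  define W where "W p q x = (x \<bullet> x) powr (- real DIM('a) / 2) * indicator {p..q} (x \<bullet> x)" for p q and x :: 'a
  have Wm[measurable]: "W p q \<in> borel_measurable borel" for p q unfolding W_def[abs_def] by measurable
  have W0: "W p q x \<ge> 0" for p q x by (simp add: W_def)
  have bound: "integrable lborel (W (2 / real n) (s1 / 2)) \<and> (\<integral>x. W (2 / real n) (s1 / 2) x \<partial>lborel) \<le> 2 * K0 / \<kappa> / \<rho>0"
    if n: "n > 0" "2 / real n \<le> s1 / 2" for n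
  proof -
    obtain H H' where H: "smooth H" "\<And>s. (H has_real_derivative H' s) (at s)" "\<And>s. s \<ge> s1 \<Longrightarrow> H s = 0"
      "\<And>s. s \<le> 1 / real n \<Longrightarrow> H s = 0"
      "\<And>s. s \<in> {2 / real n..s1 / 2} \<Longrightarrow> (H s)\<^sup>2 / s = s powr (- a - 1)"
      "\<And>s. s > 0 \<Longrightarrow> 4 * s * (H' s)\<^sup>2 \<le> a\<^sup>2 * ((H s)\<^sup>2 / s)
      + B * (s powr (- a - 1) * indicator {1 / real n..2 / real n} s + s powr (- a - 1) * indicator {s1 / 2..s1} s)"
      using prof[OF n] by blast
    define u where "u x = H (x \<bullet> x)" for x :: 'a
    have test: "test_function u"
      unfolding u_def by (rule test_function_radial[OF H(1), of s1]) (simp add: H(3))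
    have cu: "continuous_on UNIV u" by (rule smooth_continuous[OF test_function_smooth[OF test]])
    have cg: "continuous_on UNIV (grad u)" by (rule continuous_grad[OF test_function_smooth[OF test]])
    have [measurable]: "u \<in> borel_measurable borel" "grad u \<in> borel_measurable borel"
      using borel_measurable_continuous_onI[OF cu] borel_measurable_continuous_onI[OF cg] .
    note u = test_function_H1[OF test m, of b, folded \<rho>_def]
    define q where "q x = \<rho> x * ((u x)\<^sup>2 / (norm x)\<^sup>2)" for x
    have nx: "(norm x)\<^sup>2 = x \<bullet> x" for x :: 'a by (rule power2_norm_eq_inner)
    have q0: "q x \<ge> 0" for x using \<rho>pos[of x] by (simp add: q_def)
    have supp: "1 / real n < x \<bullet> x" "x \<bullet> x < s1" if "u x \<noteq> 0" for x
      using that H(3)[of "x \<bullet> x"] H(4)[of "x \<bullet> x"] by (force simp: u_def)+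
    have iq: "integrable lborel q"
    proof (rule Bochner_Integration.integrable_bound[OF integrable_mult_right[OF u(2), of "real n"]])
      show "AE x in lborel. norm (q x) \<le> norm (real n * (\<rho> x * (u x)\<^sup>2))"
      proof (intro AE_I2)
        fix x
        have "(u x)\<^sup>2 / (x \<bullet> x) \<le> real n * (u x)\<^sup>2"
        proof (cases "u x = 0")
          case False
          have "0 < 1 / real n" using n by simp
          then have "x \<bullet> x > 0" "1 \<le> real n * (x \<bullet> x)" using supp(1)[OF False] n by (auto simp: field_simps)
          then show ?thesis
            using mult_right_mono[of 1 "real n * (x \<bullet> x)" "(u x)\<^sup>2"] by (simp add: pos_divide_le_eq mult_ac)
        qed simp
        then have "\<rho> x * ((u x)\<^sup>2 / (x \<bullet> x)) \<le> \<rho> x * (real n * (u x)\<^sup>2)"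
          using \<rho>pos[of x] by (intro mult_left_mono) auto
        then have "q x \<le> real n * (\<rho> x * (u x)\<^sup>2)" by (simp add: q_def nx mult_ac)
        then show "norm (q x) \<le> norm (real n * (\<rho> x * (u x)\<^sup>2))" using q0[of x] by simp
      qed
      show "q \<in> borel_measurable lborel" unfolding q_def[abs_def] by measurable
    qed
    define J where "J = (\<integral>x. q x \<partial>lborel)"
    define G where "G = (\<integral>x. \<rho> x * (norm (grad u x))\<^sup>2 \<partial>lborel)"
    define U where "U = (\<integral>x. \<rho> x * (u x)\<^sup>2 \<partial>lborel)"
    have J0: "J \<ge> 0" and G0: "G \<ge> 0" and U0: "U \<ge> 0"
      unfolding J_def G_def U_def using q0 \<rho>pos by (auto intro!: integral_nonneg simp: less_imp_le)
    have c0: "c \<ge> 0" using c by (rule order_trans[OF zero_le_power2 less_imp_le])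
    have "ennreal c * (\<integral>\<^sup>+x. ennreal ((u x)\<^sup>2 / (norm x)\<^sup>2) \<partial>?\<mu>)
       \<le> (\<integral>\<^sup>+x. ennreal ((norm (grad u x))\<^sup>2) \<partial>?\<mu>) + ennreal C * (\<integral>\<^sup>+x. ennreal ((u x)\<^sup>2) \<partial>?\<mu>)"
      using hardy u(1) weak_gradient_test_function[OF test] by (auto simp: hardy_inequality_def)
    also have "(\<integral>\<^sup>+x. ennreal ((u x)\<^sup>2 / (norm x)\<^sup>2) \<partial>?\<mu>) = ennreal J"
      unfolding J_def q_def using iq by (intro nnw) (auto simp: q_def[abs_def])
    also have "(\<integral>\<^sup>+x. ennreal ((norm (grad u x))\<^sup>2) \<partial>?\<mu>) = ennreal G"
      unfolding G_def by (intro nnw u) auto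
    also have "(\<integral>\<^sup>+x. ennreal ((u x)\<^sup>2) \<partial>?\<mu>) = ennreal U"
      unfolding U_def by (intro nnw u) auto
    finally have "ennreal (c * J) \<le> ennreal (G + C' * U)"
      using c0 J0 G0 U0 C' by (simp add: ennreal_mult ennreal_plus)
    moreover have "0 \<le> G + C' * U" using G0 U0 C' by simp
    ultimately have 1: "c * J \<le> G + C' * U" by (simp only: ennreal_le_iff)
    have W1: "integrable lborel (W (1 / real n) (2 / real n))"
        "(\<integral>x. W (1 / real n) (2 / real n) x \<partial>lborel) \<le> unit_ball_vol DIM('a) * 2 powr (real DIM('a) / 2)"
      using shell_integral_bound[where 'a='a and r="1 / real n"] n unfolding W_def[abs_def] by auto
    have W2: "integrable lborel (W (s1 / 2) s1)"
        "(\<integral>x. W (s1 / 2) s1 x \<partial>lborel) \<le> unit_ball_vol DIM('a) * 2 powr (real DIM('a) / 2)"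
      using shell_integral_bound[where 'a='a and r="s1 / 2"] s1 unfolding W_def[abs_def] by auto
    have "G \<le> (\<integral>x. a\<^sup>2 * q x + B * (W (1 / real n) (2 / real n) x + W (s1 / 2) s1 x) \<partial>lborel)"
      unfolding G_def
    proof (rule integral_mono_AE[OF u(3)])
      show "integrable lborel (\<lambda>x. a\<^sup>2 * q x + B * (W (1 / real n) (2 / real n) x + W (s1 / 2) s1 x))"
        by (intro Bochner_Integration.integrable_add integrable_mult_right iq W1 W2)
      show "AE x in lborel. \<rho> x * (norm (grad u x))\<^sup>2 \<le> a\<^sup>2 * q x + B * (W (1 / real n) (2 / real n) x + W (s1 / 2) s1 x)"
        using AE_lborel_singleton[of "0::'a"]
      proof eventually_elim
        case (elim x)
        then have s: "x \<bullet> x > 0" by simp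
        let ?V = "B * (W (1 / real n) (2 / real n) x + W (s1 / 2) s1 x)"
        have V0: "?V \<ge> 0" using B W0 by simp
        have "grad u x = (2 * H' (x \<bullet> x)) *\<^sub>R x" unfolding u_def by (rule grad_radial[OF H(2)])
        then have "(norm (grad u x))\<^sup>2 = 4 * (x \<bullet> x) * (H' (x \<bullet> x))\<^sup>2"
          by (simp add: power_mult_distrib nx)
        also have "\<dots> \<le> a\<^sup>2 * ((u x)\<^sup>2 / (x \<bullet> x)) + ?V"
          using H(6)[OF s] by (simp add: u_def W_def a1)
        finally have "\<rho> x * (norm (grad u x))\<^sup>2 \<le> \<rho> x * (a\<^sup>2 * ((u x)\<^sup>2 / (x \<bullet> x)) + ?V)"
          using \<rho>pos[of x] by (intro mult_left_mono) auto
        also have "\<dots> = a\<^sup>2 * q x + \<rho> x * ?V" by (simp add: q_def nx algebra_simps)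
        \<comment> \<open>The weight is estimated only in the layer terms. The main term keeps it
          and reproduces \<open>J\<close> with the exact coefficient \<open>a^2\<close>, as the
          comparison with \<open>c\<close> requires.\<close>
        also have "\<rho> x * ?V \<le> 1 * ?V" using \<rho>1[of x] V0 by (intro mult_right_mono)
        finally show "\<rho> x * (norm (grad u x))\<^sup>2 \<le> a\<^sup>2 * q x + ?V" by simp
      qed
    qed
    also have "\<dots> = a\<^sup>2 * J + B * ((\<integral>x. W (1 / real n) (2 / real n) x \<partial>lborel) + (\<integral>x. W (s1 / 2) s1 x \<partial>lborel))"
      using iq W1(1) W2(1) by (simp add: J_def)
    also have "\<dots> \<le> a\<^sup>2 * J + K0"
      unfolding K0_def using B W1(2) W2(2) by (intro add_left_mono mult_left_mono) auto
    finally have 2: "G \<le> a\<^sup>2 * J + K0" .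
    have "U \<le> (\<integral>x. s1 * q x \<partial>lborel)"
      unfolding U_def
    proof (rule integral_mono[OF u(2) integrable_mult_right[OF iq]])
      fix x
      have "(u x)\<^sup>2 \<le> s1 * ((u x)\<^sup>2 / (x \<bullet> x))"
      proof (cases "u x = 0")
        case False
        have "0 < 1 / real n" using n by simp
        then have "x \<bullet> x > 0" using supp(1)[OF False] by linarith
        moreover have "(u x)\<^sup>2 * (x \<bullet> x) \<le> (u x)\<^sup>2 * s1" using supp(2)[OF False] by (intro mult_left_mono) auto
        ultimately show ?thesis by (simp add: pos_le_divide_eq mult.commute)
      qed simp
      then have "\<rho> x * (u x)\<^sup>2 \<le> \<rho> x * (s1 * ((u x)\<^sup>2 / (x \<bullet> x)))"
        using \<rho>pos[of x] by (intro mult_left_mono) auto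
      then show "\<rho> x * (u x)\<^sup>2 \<le> s1 * q x" by (simp add: q_def nx mult_ac)
    qed
    then have 3: "U \<le> s1 * J" by (simp add: J_def)
    have "C' * U \<le> C' * (s1 * J)" using 3 C' by (intro mult_left_mono)
    also have "\<dots> = (C' * s1) * J" by simp
    also have "\<dots> \<le> \<kappa> / 2 * J" using Cs1 J0 by (rule mult_right_mono)
    finally have "c * J \<le> a\<^sup>2 * J + K0 + \<kappa> / 2 * J" using 1 2 by linarith
    moreover have "c * J = a\<^sup>2 * J + \<kappa> * J" by (simp add: \<kappa>_def algebra_simps)
    ultimately have "J * \<kappa> \<le> 2 * K0" by (simp add: mult.commute)
    then have J: "J \<le> 2 * K0 / \<kappa>" using \<kappa> by (simp add: pos_le_divide_eq)
    \<comment> \<open>Here the weight may be estimated crudely, since only boundedness in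
      \<open>n\<close> is at stake.\<close>
    have le: "W (2 / real n) (s1 / 2) x \<le> q x / \<rho>0" for x
    proof (cases "x \<bullet> x \<in> {2 / real n..s1 / 2}")
      case True
      then have "x \<bullet> x \<le> s1" using s1 by auto
      then have "\<rho>0 \<le> \<rho> x"
        unfolding \<rho>0_def \<rho>_def by (intro weight_bounds(2)[OF b m]) (simp add: norm_eq_sqrt_inner)
      then have "\<rho>0 * (x \<bullet> x) powr (- real DIM('a) / 2) \<le> \<rho> x * (x \<bullet> x) powr (- real DIM('a) / 2)"
        by (intro mult_right_mono) auto
      also have "\<dots> = q x" using H(5)[OF True] by (simp add: q_def nx u_def a1)
      finally show ?thesis using True \<rho>0 by (simp add: W_def pos_le_divide_eq mult.commute)
    next
      case False
      then show ?thesis using q0[of x] \<rho>0 by (simp add: W_def)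
    qed
    have iW: "integrable lborel (W (2 / real n) (s1 / 2))"
    proof (rule Bochner_Integration.integrable_bound)
      show "integrable lborel (\<lambda>x. q x / \<rho>0)" using iq by simp
      show "AE x in lborel. norm (W (2 / real n) (s1 / 2) x) \<le> norm (q x / \<rho>0)"
        using le W0 q0 \<rho>0 by (auto intro!: AE_I2)
    qed measurable
    have "(\<integral>x. W (2 / real n) (s1 / 2) x \<partial>lborel) \<le> (\<integral>x. q x / \<rho>0 \<partial>lborel)"
      by (rule integral_mono[OF iW _ le]) (use iq in simp)
    also have "\<dots> = J / \<rho>0" by (simp add: J_def)
    also have "\<dots> \<le> 2 * K0 / \<kappa> / \<rho>0" using J \<rho>0 by (intro divide_right_mono) auto
    finally show ?thesis using iW by simp
  qed
  obtain n0 where n0: "real n0 * (s1 / 2) > 2" using reals_Archimedean3[OF half_gt_zero[OF s1]] by blast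
  have n0': "n0 > 0" using n0 by (cases n0) auto
  have n02: "2 / real n0 \<le> s1 / 2" using n0 n0' by (simp add: pos_divide_le_eq mult.commute)
  have ok: "n0 + k > 0" "2 / real (n0 + k) \<le> s1 / 2" for k
  proof -
    show "n0 + k > 0" using n0' by simp
    have "2 / real (n0 + k) \<le> 2 / real n0" using n0' by (intro divide_left_mono) auto
    then show "2 / real (n0 + k) \<le> s1 / 2" using n02 by linarith
  qed
  \<comment> \<open>The bound does not depend on the inner radius, so by monotone convergence it
    would bound the integral over the whole ball of squared radius \<open>s1 / 2\<close>.\<close>
  define F where "F k = W (2 / real (n0 + k)) (s1 / 2)" for k
  let ?f = "\<lambda>x::'a. (x \<bullet> x) powr (- real DIM('a) / 2) * indicator {..s1 / 2} (x \<bullet> x)"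
  have fm: "?f \<in> borel_measurable borel" by measurable
  have "(\<integral>\<^sup>+x. ennreal (?f x) \<partial>lborel) \<le> (\<integral>\<^sup>+x. (SUP k. ennreal (F k x)) \<partial>lborel)"
  proof (rule nn_integral_mono)
    fix x :: 'a
    show "ennreal (?f x) \<le> (SUP k. ennreal (F k x))"
    proof (cases "x = 0")
      case False
      then have s: "x \<bullet> x > 0" by simp
      obtain k where k: "real k * (x \<bullet> x) > 2" using reals_Archimedean3[OF s] by blast
      then have "k > 0" by (cases k) auto
      then have "2 / real k \<le> x \<bullet> x" using k by (simp add: pos_divide_le_eq mult.commute)
      moreover have "2 / real (n0 + k) \<le> 2 / real k" using \<open>k > 0\<close> by (intro divide_left_mono) auto
      ultimately have "?f x = F k x" by (simp add: F_def W_def indicator_def)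
      then show ?thesis by (intro SUP_upper2[of k]) auto
    qed simp
  qed
  also have "\<dots> = (SUP k. (\<integral>\<^sup>+x. ennreal (F k x) \<partial>lborel))"
  proof (rule nn_integral_monotone_convergence_SUP)
    show "incseq (\<lambda>k x. ennreal (F k x))"
    proof (intro incseq_SucI le_funI ennreal_leI)
      fix k and x :: 'a
      have "2 / real (n0 + Suc k) \<le> 2 / real (n0 + k)" using n0' by (intro divide_left_mono) auto
      then show "F k x \<le> F (Suc k) x"
        unfolding F_def W_def by (intro mult_left_mono) (auto simp: indicator_def)
    qed
  qed (simp add: F_def)
  also have "\<dots> \<le> ennreal (2 * K0 / \<kappa> / \<rho>0)"
  proof (rule SUP_least)
    fix k
    have "(\<integral>\<^sup>+x. ennreal (F k x) \<partial>lborel) = ennreal (\<integral>x. F k x \<partial>lborel)"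
      using bound[OF ok] W0 by (intro nn_integral_eq_integral AE_I2) (auto simp: F_def)
    also have "\<dots> \<le> ennreal (2 * K0 / \<kappa> / \<rho>0)"
      using bound[OF ok, of k] by (intro ennreal_leI) (simp add: F_def)
    finally show "(\<integral>\<^sup>+x. ennreal (F k x) \<partial>lborel) \<le> ennreal (2 * K0 / \<kappa> / \<rho>0)" .
  qed
  also have "\<dots> < \<infinity>" by simp
  finally have "integrable lborel ?f"
    using fm by (intro integrableI_nonneg) (auto intro!: AE_I2)
  then show False using not_integrable_inverse_power[of "s1 / 2", where 'a='a] s1 by simp
qed

theorem proposition5p1:
  fixes b m :: real
  assumes "DIM('a::euclidean_space) \<ge> 3" and "m > 0" and "b \<ge> 0"
  shows "(\<exists>C>0. hardy_inequality (weighted_measure b m :: 'a measure)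
             (((real DIM('a) - 2) / 2)\<^sup>2) C) \<and>
         (\<forall>c > ((real DIM('a) - 2) / 2)\<^sup>2.
            \<not> (\<exists>C. hardy_inequality (weighted_measure b m :: 'a measure) c C))"
  using hardy_inequality_weighted[OF assms] hardy_constant_optimal[OF assms] by blast

end
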